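(* With $\Gamma$-limits taken with respect to the weak$^*$ topology on $\mathcal M^+(\Omega)$, one has $$\Gamma\text{-}\lim_{m}\widetilde{\mathcal E}_m=\mathcal E_\infty$$ and $$\Gamma\text{-}\lim_{n}\mathcal E_n=\Gamma\text{-}\lim_m\,\Gamma\text{-}\lim_n\mathcal E_{n,m}=\Gamma\text{-}\lim_n\,\Gamma\text{-}\lim_m\mathcal E_{n,m}=\mathcal E_\infty .$$
   Context: Let $\Omega=(0,1)^d$ and let $f\in L^\infty(\Omega)$ satisfy $\int_\Omega f\,dx=0$ and $\operatorname{conv}(\operatorname{supp} f)\subset\subset\Omega$. $\mathcal M^+(\Omega)$ is the set of non-negative finite Borel measures on $\Omega$, with the weak$^*$ topology: $\mu_j\rightharpoonup\mu$ iff $\int\varphi\,d\mu_j\to\int\varphi\,d\mu$ for all $\varphi\in C(\overline\Omega)$. A function is identified with the absolutely continuous measure having it as density. $(\mathcal T^n)_{n\in\mathbb N}$ is a sequence of nested simplicial triangulations of $\Omega$ obtained by successive uniform refinements. $\mathcal M_n^+$ is the set of non-negative functions that are constant (a.e.) on each simplex of $\mathcal T^n$. $\mathcal W_m$ is the space of continuous functions on $\Omega$, affine on each simplex of $\mathcal T^{m+1}$, with zero integral over $\Omega$. $(\delta_m)$ is a monotone sequence of positive reals with $\delta_m\downarrow0$. For $\mu\in\mathcal M^+(\Omega)$: $\mathcal E_{n,m}(\mu)=\sup_{u\in\mathcal W_m}\left(2\int_\Omega fu\,dx-\int_\Omega(\mu+\delta_m)|\nabla u|^2dx\right)+\int_\Omega\mu\,dx$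 if $\mu\in\mathcal M_n^+$, and $+\infty$ otherwise; $\mathcal E_n:=\mathcal E_{n,n}$; $\mathcal E_{\infty,m}:=\inf_n\mathcal E_{n,m}$; $\widetilde{\mathcal E}_m$ is the lower semicontinuous envelope of $\mathcal E_{\infty,m}$ in the weak$^*$ topology (the supremum of all weak$^*$ lower semicontinuous functionals $\le\mathcal E_{\infty,m}$); $\mathcal E_\infty:=\sup_m\widetilde{\mathcal E}_m$. $\Gamma$-convergence: for a topological space $X$ with neighbourhood filters $\mathcal N(x)$ and $f_n:X\to\overline{\mathbb R}$, $(\Gamma\text{-}\liminf f_n)(x)=\sup_{U\in\mathcal N(x)}\liminf_n\inf_{y\in U}f_n(y)$ and $(\Gamma\text{-}\limsup f_n)(x)=\sup_{U\in\mathcal N(x)}\limsup_n\inf_{y\in U}f_n(y)$; $\Gamma\text{-}\lim f_n=g$ means $\Gamma\text{-}\limsup f_n\le g\le\Gamma\text{-}\liminf f_n$ on $X$. *)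

theory Defs
  imports "HOL-Analysis.Analysis"
begin

section \<open>The domain, the data and the space of measures\<close>

definition cube :: "(real ^ 'd) set" where
  "cube = {x. \<forall>i. 0 < x $ i \<and> x $ i < 1}"

definition L_infinity :: "(real ^ 'd) set \<Rightarrow> (real ^ 'd \<Rightarrow> real) set" where
  "L_infinity U = {f. f \<in> borel_measurable (lebesgue_on U) \<and>
     (\<exists>C. AE x in lebesgue_on U. \<bar>f x\<bar> \<le> C)}"

text \<open>The support of an \<open>L\<^sup>\<infinity>\<close> class does not depend on the representative: it is the complement
  of the largest open set on which the function vanishes almost everywhere.\<close>

definition ess_support :: "(real ^ 'd) set \<Rightarrow> (real ^ 'd \<Rightarrow> real) \<Rightarrow> (real ^ 'd) set" where
  "ess_support U f =
     - \<Union> {V. open V \<and> (AE x in lebesgue_on U. x \<in> V \<longrightarrow> f x = 0)}"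

definition compactly_contained :: "(real ^ 'd) set \<Rightarrow> (real ^ 'd) set \<Rightarrow> bool" where
  "compactly_contained A B \<longleftrightarrow> compact (closure A) \<and> closure A \<subseteq> B"

definition Mplus :: "(real ^ 'd) measure set" where
  "Mplus = {\<mu>. space \<mu> = cube \<and> sets \<mu> = sets (restrict_space borel cube) \<and> finite_measure \<mu>}"

text \<open>The weak* topology is the initial topology of the functionals \<open>\<mu> \<mapsto> \<integral>\<phi> d\<mu>\<close>, where \<open>\<phi>\<close> is
  continuous on the closed cube. The values of \<open>\<phi>\<close> outside the closed cube are arbitrary and play
  no role, because the measures live on \<open>cube\<close>.\<close>

definition weak_star :: "(real ^ 'd) measure topology" where
  "weak_star = pullback_topology Mplus
     (\<lambda>\<mu>. \<lambda>\<phi>\<in>{\<phi>. continuous_on (closure cube) \<phi>}. \<integral>x. \<phi> x \<partial>\<mu>)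
     (product_topology (\<lambda>_. euclideanreal) {\<phi>. continuous_on (closure cube) \<phi>})"

lemma topspace_weak_star: "topspace weak_star = Mplus"
  unfolding weak_star_def by (auto simp: topspace_pullback_topology)

lemma limitin_weak_star:
  "limitin weak_star \<nu> \<mu> F \<longleftrightarrow>
     \<mu> \<in> Mplus \<and> (\<forall>\<^sub>F j in F. \<nu> j \<in> Mplus) \<and>
     (\<forall>\<phi> :: real ^ 'd \<Rightarrow> real. continuous_on (closure cube) \<phi> \<longrightarrow>
        ((\<lambda>j. \<integral>x. \<phi> x \<partial>\<nu> j) \<longlongrightarrow> (\<integral>x. \<phi> x \<partial>\<mu>)) F)"
proof -
  let ?C = "{\<phi> :: real ^ 'd \<Rightarrow> real. continuous_on (closure cube) \<phi>}"
  let ?P = "product_topology (\<lambda>_. euclideanreal) ?C"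
  let ?J = "\<lambda>\<mu>. \<lambda>\<phi>\<in>?C. \<integral>x. \<phi> x \<partial>\<mu>"
  have J: "?J \<mu> \<in> topspace ?P" for \<mu> :: "(real ^ 'd) measure"
    by simp
  have ev: "\<forall>\<^sub>F j in F. \<nu> j \<in> Mplus" if "limitin weak_star \<nu> \<mu> F"
    using that openin_topspace[of weak_star]
    unfolding limitin_def topspace_weak_star[symmetric] by blast
  have "limitin weak_star \<nu> \<mu> F \<longleftrightarrow>
      \<mu> \<in> Mplus \<and> (\<forall>\<^sub>F j in F. \<nu> j \<in> Mplus) \<and> limitin ?P (\<lambda>j. ?J (\<nu> j)) (?J \<mu>) F"
    (is "?L \<longleftrightarrow> ?R")
  proof
    assume L: ?L
    have "\<forall>\<^sub>F j in F. ?J (\<nu> j) \<in> U" if U: "openin ?P U" "?J \<mu> \<in> U" for U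
    proof -
      have "openin weak_star (?J -` U \<inter> Mplus)"
        using U unfolding weak_star_def openin_pullback_topology by blast
      moreover have "\<mu> \<in> ?J -` U \<inter> Mplus"
        using L U unfolding limitin_def topspace_weak_star by blast
      ultimately have "\<forall>\<^sub>F j in F. \<nu> j \<in> ?J -` U \<inter> Mplus"
        using L unfolding limitin_def by blast
      then show ?thesis by (rule eventually_mono) blast
    qed
    then show ?R
      using L ev[OF L] J unfolding limitin_def topspace_weak_star by blast
  next
    assume R: ?R
    have "\<forall>\<^sub>F j in F. \<nu> j \<in> V" if V: "openin weak_star V" "\<mu> \<in> V" for V
    proof -
      obtain U where U: "openin ?P U" "V = ?J -` U \<inter> Mplus"
        using V unfolding weak_star_def openin_pullback_topology by blast
      have "\<forall>\<^sub>F j in F. ?J (\<nu> j) \<in> U"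
        using R U V unfolding limitin_def by blast
      with R have "\<forall>\<^sub>F j in F. \<nu> j \<in> Mplus \<and> ?J (\<nu> j) \<in> U"
        by (simp add: eventually_conj)
      then show ?thesis
        by (rule eventually_mono) (use U in blast)
    qed
    then show ?L
      using R unfolding limitin_def topspace_weak_star by blast
  qed
  then show ?thesis
    by (simp add: limitin_componentwise restrict_extensional)
qed

section \<open>Triangulations and uniform refinement\<close>

definition simplicial_triangulation_of :: "(real ^ 'd) set \<Rightarrow> (real ^ 'd) set set \<Rightarrow> bool" where
  "simplicial_triangulation_of U \<T> \<longleftrightarrow>
     triangulation \<T> \<and> (\<forall>S\<in>\<T>. int CARD('d) simplex S) \<and> \<Union>\<T> = closure U"

text \<open>Every simplex is cut into \<open>2\<^sup>d\<close> subsimplices of equal volume, whose vertices are vertices or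
  edge midpoints of the parent (a vertex is \<open>midpoint a a\<close>).\<close>

definition uniform_refinement :: "(real ^ 'd) set set \<Rightarrow> (real ^ 'd) set set \<Rightarrow> bool" where
  "uniform_refinement \<T> \<T>' \<longleftrightarrow>
     (\<forall>S'\<in>\<T>'. \<exists>S\<in>\<T>. S' \<subseteq> S) \<and>
     (\<forall>S\<in>\<T>. card {S'\<in>\<T>'. S' \<subseteq> S} = 2 ^ CARD('d) \<and>
        (\<forall>S'\<in>\<T>'. S' \<subseteq> S \<longrightarrow>
           measure lebesgue S' = measure lebesgue S / 2 ^ CARD('d) \<and>
           (\<forall>v. v extreme_point_of S' \<longrightarrow>
              (\<exists>a b. a extreme_point_of S \<and> b extreme_point_of S \<and> v = midpoint a b))))"

definition shape_regular :: "(nat \<Rightarrow> (real ^ 'd) set set) \<Rightarrow> bool" where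
  "shape_regular \<T> \<longleftrightarrow>
     (\<exists>\<kappa>>0. \<forall>n. \<forall>S\<in>\<T> n. \<exists>c r. 0 < r \<and> cball c r \<subseteq> S \<and> diameter S \<le> \<kappa> * r)"

text \<open>A single step of \<^const>\<open>uniform_refinement\<close> leaves open which interior diagonals are
  used. The standard rules (e.g. that of Freudenthal) choose them so that only finitely many shapes
  occur; arbitrary choices could let the simplices degenerate. Shape regularity is what is common to
  those rules.\<close>

definition successive_uniform_refinements :: "(nat \<Rightarrow> (real ^ 'd) set set) \<Rightarrow> bool" where
  "successive_uniform_refinements \<T> \<longleftrightarrow>
     (\<forall>n. simplicial_triangulation_of cube (\<T> n)) \<and>
     (\<forall>n. uniform_refinement (\<T> n) (\<T> (Suc n))) \<and>
     shape_regular \<T>"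

section \<open>The discrete spaces\<close>

definition M_discrete :: "(nat \<Rightarrow> (real ^ 'd) set set) \<Rightarrow> nat \<Rightarrow> (real ^ 'd) measure set" where
  "M_discrete \<T> n = {density (restrict_space lborel cube) (\<lambda>x. ennreal (g x)) | g.
     g \<in> borel_measurable (restrict_space lborel cube) \<and> (\<forall>x\<in>cube. 0 \<le> g x) \<and>
     (\<forall>S\<in>\<T> n. \<exists>c. AE x in restrict_space lborel cube. x \<in> S \<longrightarrow> g x = c)}"

definition W_discrete :: "(nat \<Rightarrow> (real ^ 'd) set set) \<Rightarrow> nat \<Rightarrow> (real ^ 'd \<Rightarrow> real) set" where
  "W_discrete \<T> m = {u. continuous_on cube u \<and>
     (\<forall>S\<in>\<T> (Suc m). \<exists>a b. \<forall>x\<in>S \<inter> cube. u x = a \<bullet> x + b) \<and>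
     (\<integral>x. u x \<partial>lebesgue_on cube) = 0}"

text \<open>The pointwise gradient. For \<open>u\<close> in \<^const>\<open>W_discrete\<close> it is the classical gradient in the
  interior of each simplex; the remaining points form a null set, where the value is irrelevant.\<close>

definition grad :: "(real ^ 'd \<Rightarrow> real) \<Rightarrow> real ^ 'd \<Rightarrow> real ^ 'd" where
  "grad u x = (\<chi> i. frechet_derivative u (at x) (axis i 1))"

section \<open>Semicontinuous envelopes and Gamma-convergence\<close>

definition lower_semicontinuous :: "'b topology \<Rightarrow> ('b \<Rightarrow> ereal) \<Rightarrow> bool" where
  "lower_semicontinuous X h \<longleftrightarrow> (\<forall>a. openin X {x \<in> topspace X. a < h x})"

definition lsc_envelope :: "'b topology \<Rightarrow> ('b \<Rightarrow> ereal) \<Rightarrow> 'b \<Rightarrow> ereal" where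
  "lsc_envelope X F x =
     (SUP h \<in> {h. lower_semicontinuous X h \<and> (\<forall>y\<in>topspace X. h y \<le> F y)}. h x)"

definition neighbourhoods :: "'b topology \<Rightarrow> 'b \<Rightarrow> 'b set set" where
  "neighbourhoods X x = {U. U \<subseteq> topspace X \<and> (\<exists>V. openin X V \<and> x \<in> V \<and> V \<subseteq> U)}"

definition Gamma_liminf :: "'b topology \<Rightarrow> (nat \<Rightarrow> 'b \<Rightarrow> ereal) \<Rightarrow> 'b \<Rightarrow> ereal" where
  "Gamma_liminf X F x = (SUP U \<in> neighbourhoods X x. liminf (\<lambda>n. INF y\<in>U. F n y))"

definition Gamma_limsup :: "'b topology \<Rightarrow> (nat \<Rightarrow> 'b \<Rightarrow> ereal) \<Rightarrow> 'b \<Rightarrow> ereal" where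
  "Gamma_limsup X F x = (SUP U \<in> neighbourhoods X x. limsup (\<lambda>n. INF y\<in>U. F n y))"

definition is_Gamma_lim :: "'b topology \<Rightarrow> (nat \<Rightarrow> 'b \<Rightarrow> ereal) \<Rightarrow> ('b \<Rightarrow> ereal) \<Rightarrow> bool" where
  "is_Gamma_lim X F G \<longleftrightarrow>
     (\<forall>x\<in>topspace X. Gamma_limsup X F x \<le> G x \<and> G x \<le> Gamma_liminf X F x)"

section \<open>The energies\<close>

text \<open>Functions are identified with the measures they are densities of, so that
  \<open>\<integral>(\<mu> + \<delta>\<^sub>m)|\<nabla>u|\<^sup>2 dx\<close> is \<open>\<integral>|\<nabla>u|\<^sup>2 d\<mu> + \<delta>\<^sub>m \<integral>|\<nabla>u|\<^sup>2 dx\<close> and \<open>\<integral>\<mu> dx\<close> is the total mass of \<open>\<mu>\<close>.\<close>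

definition energy ::
  "(real ^ 'd \<Rightarrow> real) \<Rightarrow> (nat \<Rightarrow> (real ^ 'd) set set) \<Rightarrow> (nat \<Rightarrow> real) \<Rightarrow>
   nat \<Rightarrow> nat \<Rightarrow> (real ^ 'd) measure \<Rightarrow> ereal" where
  "energy f \<T> \<delta> n m \<mu> =
     (if \<mu> \<in> M_discrete \<T> n
      then (SUP u \<in> W_discrete \<T> m.
              ereal (2 * (\<integral>x. f x * u x \<partial>lebesgue_on cube)
                - ((\<integral>x. (norm (grad u x))\<^sup>2 \<partial>\<mu>)
                   + \<delta> m * (\<integral>x. (norm (grad u x))\<^sup>2 \<partial>lebesgue_on cube))))
           + ereal (measure \<mu> cube)
      else \<infinity>)"

definition energy_diag ::
  "(real ^ 'd \<Rightarrow> real) \<Rightarrow> (nat \<Rightarrow> (real ^ 'd) set set) \<Rightarrow> (nat \<Rightarrow> real) \<Rightarrow>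
   nat \<Rightarrow> (real ^ 'd) measure \<Rightarrow> ereal" where
  "energy_diag f \<T> \<delta> n = energy f \<T> \<delta> n n"

definition energy_inf ::
  "(real ^ 'd \<Rightarrow> real) \<Rightarrow> (nat \<Rightarrow> (real ^ 'd) set set) \<Rightarrow> (nat \<Rightarrow> real) \<Rightarrow>
   nat \<Rightarrow> (real ^ 'd) measure \<Rightarrow> ereal" where
  "energy_inf f \<T> \<delta> m \<mu> = (INF n. energy f \<T> \<delta> n m \<mu>)"

definition energy_tilde ::
  "(real ^ 'd \<Rightarrow> real) \<Rightarrow> (nat \<Rightarrow> (real ^ 'd) set set) \<Rightarrow> (nat \<Rightarrow> real) \<Rightarrow>
   nat \<Rightarrow> (real ^ 'd) measure \<Rightarrow> ereal" where
  "energy_tilde f \<T> \<delta> m = lsc_envelope weak_star (energy_inf f \<T> \<delta> m)"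

definition energy_limit ::
  "(real ^ 'd \<Rightarrow> real) \<Rightarrow> (nat \<Rightarrow> (real ^ 'd) set set) \<Rightarrow> (nat \<Rightarrow> real) \<Rightarrow>
   (real ^ 'd) measure \<Rightarrow> ereal" where
  "energy_limit f \<T> \<delta> \<mu> = (SUP m. energy_tilde f \<T> \<delta> m \<mu>)"

end

theory Submission imports Defs begin

text \<open>The energies \<open>E n m\<close> increase in \<open>m\<close> and decrease in \<open>n\<close>, and the Gamma-limit of a monotone
  sequence is a supremum of envelopes or the envelope of an infimum. Everything then follows formally
  from one non-formal inequality: near every \<open>\<mu>\<close> there is \<open>\<nu>'\<close> in some \<open>M_discrete \<T> n\<close> whose energies
  \<open>E n k \<nu>'\<close> are, for all \<open>k\<close> at once, at most slightly above the limit energy of \<open>\<mu>\<close>.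

  To find it, take \<open>\<nu>\<close> close to \<open>\<mu>\<close> and almost optimal for a coarse \<open>m\<close>, and let \<open>\<nu>'\<close> be
  \<open>\<nu>\<close> mollified at a scale \<open>s\<close> independent of \<open>m\<close>, plus a small multiple \<open>\<epsilon>\<close> of Lebesgue measure, rounded
  up to a piecewise constant density. A fine competitor \<open>u\<close> for \<open>\<nu>'\<close> is turned into a coarse competitor
  for \<open>\<nu>\<close> by mollifying \<open>u\<close> and interpolating the result \<open>v\<close> on the coarse mesh: by Jensen the Dirichlet
  integral of \<open>v\<close> against \<open>\<nu>\<close> is at most that of \<open>u\<close> against the mollified \<open>\<nu>\<close>, and \<open>\<nabla>v\<close> is Lipschitz with
  a constant controlled by the \<open>L\<^sup>1\<close> norm of \<open>\<nabla>u\<close>, so the interpolation error is small once the mesh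
  is fine compared with \<open>s\<close>. All errors are linear in \<open>\<parallel>\<nabla>u\<parallel>\<close> with a small factor or small multiples of
  \<open>\<parallel>\<nabla>u\<parallel>\<^sup>2\<close>; they are absorbed by the term \<open>\<epsilon> \<integral> \<bar>\<nabla>u\<bar>\<^sup>2\<close>.\<close>

section \<open>Semicontinuous envelopes and Gamma-limits of monotone sequences\<close>

text \<open>The obstacle is uniformity. The measure \<nu> supplied by the envelope depends on
  \<open>m\<close>, and the index \<open>k\<close> of the fine competitor \<open>u\<close> is
  unbounded, so the mollification scale must be fixed before \<nu> is known and must not involve the
  mesh of \<open>u\<close>. Of \<nu> only a mass bound is needed, and testing its energy with the
  zero function gives one independent of \<open>m\<close>. Of \<open>u\<close> nothing is known, so
  every error is expressed by the integral of \<open>norm (grad u)\<close>, which the added multiple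
  of Lebesgue measure controls; the term with \<open>\<delta> k\<close> cannot do this, since it
  vanishes as \<open>k\<close> grows. Averaging over \<open>(1 - s) x + s y\<close> instead of
  convolving avoids any extension or cut-off at the boundary. It also puts a factor
  \<open>1 - s\<close> into the gradient, and this slack absorbs the interpolation error while the
  Dirichlet term keeps coefficient exactly 1, as it must, not being small. The comparison is made
  with \<nu> and not with \<mu> because \<nu> has a density and so does not charge the faces of the
  mesh, where gradients are undefined. Subtracting the mean of an interpolant is free because
  \<open>f\<close> has integral zero.\<close>

lemma lsc_envelope_lsc: "lower_semicontinuous X (lsc_envelope X F)"
  unfolding lower_semicontinuous_def
proof
  fix a
  let ?H = "{h. lower_semicontinuous X h \<and> (\<forall>y\<in>topspace X. h y \<le> F y)}"
  have "{x \<in> topspace X. a < lsc_envelope X F x} = (\<Union>h\<in>?H. {x \<in> topspace X. a < h x})"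
    by (auto simp: lsc_envelope_def less_SUP_iff)
  also have "openin X \<dots>"
    by (rule openin_Union) (auto simp: lower_semicontinuous_def)
  finally show "openin X {x \<in> topspace X. a < lsc_envelope X F x}" .
qed

lemma lsc_envelope_le: "x \<in> topspace X \<Longrightarrow> lsc_envelope X F x \<le> F x"
  unfolding lsc_envelope_def by (rule SUP_least) auto

lemma lsc_envelope_greatest:
  "lower_semicontinuous X h \<Longrightarrow> (\<And>y. y \<in> topspace X \<Longrightarrow> h y \<le> F y) \<Longrightarrow> h x \<le> lsc_envelope X F x"
  unfolding lsc_envelope_def by (rule SUP_upper) auto

lemma lsc_envelope_mono:
  "(\<And>y. y \<in> topspace X \<Longrightarrow> F y \<le> G y) \<Longrightarrow> x \<in> topspace X \<Longrightarrow> lsc_envelope X F x \<le> lsc_envelope X G x"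
  by (rule lsc_envelope_greatest[OF lsc_envelope_lsc]) (metis order_trans lsc_envelope_le)

lemma lsc_envelope_lsc_eq:
  "lower_semicontinuous X h \<Longrightarrow> x \<in> topspace X \<Longrightarrow> lsc_envelope X h x = h x"
  by (intro antisym lsc_envelope_le lsc_envelope_greatest) auto

lemma lower_semicontinuous_SUP:
  assumes "\<And>i. i \<in> I \<Longrightarrow> lower_semicontinuous X (F i)"
  shows "lower_semicontinuous X (\<lambda>x. SUP i\<in>I. F i x)"
  unfolding lower_semicontinuous_def
proof
  fix a
  have "{x \<in> topspace X. a < (SUP i\<in>I. F i x)} = (\<Union>i\<in>I. {x \<in> topspace X. a < F i x})"
    by (auto simp: less_SUP_iff)
  also have "openin X \<dots>"
    using assms by (intro openin_Union) (auto simp: lower_semicontinuous_def)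
  finally show "openin X {x \<in> topspace X. a < (SUP i\<in>I. F i x)}" .
qed

lemma neighbourhoods_openI: "openin X U \<Longrightarrow> x \<in> U \<Longrightarrow> U \<in> neighbourhoods X x"
  unfolding neighbourhoods_def using openin_subset by blast

text \<open>A neighbourhood \<open>U\<close> that witnesses a value above \<open>a\<close> at
  \<open>x\<close> is also a neighbourhood of every point of an open set around \<open>x\<close>
  inside \<open>U\<close>, so it witnesses the same there.\<close>

lemma lower_semicontinuous_SUP_INF:
  "lower_semicontinuous X (\<lambda>x. SUP U\<in>neighbourhoods X x. INF y\<in>U. F y)"
  unfolding lower_semicontinuous_def
proof
  fix a
  let ?h = "\<lambda>x. SUP U\<in>neighbourhoods X x. INF y\<in>U. F y"
  show "openin X {x \<in> topspace X. a < ?h x}"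
  proof (subst openin_subopen, safe)
    fix x assume x: "x \<in> topspace X" "a < ?h x"
    then obtain U where U: "U \<in> neighbourhoods X x" "a < (INF y\<in>U. F y)"
      by (auto simp: less_SUP_iff)
    then obtain V where V: "openin X V" "x \<in> V" "V \<subseteq> U" "U \<subseteq> topspace X"
      unfolding neighbourhoods_def by auto
    have "a < ?h z" if "z \<in> V" for z
    proof -
      have "U \<in> neighbourhoods X z"
        using V that unfolding neighbourhoods_def by blast
      then show ?thesis using U(2) by (auto simp: less_SUP_iff)
    qed
    then show "\<exists>T. openin X T \<and> x \<in> T \<and> T \<subseteq> {x \<in> topspace X. a < ?h x}"
      using V by (intro exI[of _ V]) auto
  qed
qed

text \<open>Links envelopes to Gamma-limits: the right-hand side is the Gamma-limit of the constant
  sequence \<open>F\<close>. For the harder inequality, each \<open>a\<close> below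
  \<open>h x\<close> is attained as a lower bound on the open superlevel set of
  \<open>h\<close>.\<close>

lemma lsc_envelope_eq_SUP_INF:
  assumes x: "x \<in> topspace X"
  shows "lsc_envelope X F x = (SUP U\<in>neighbourhoods X x. INF y\<in>U. F y)"
proof (rule antisym)
  show "(SUP U\<in>neighbourhoods X x. INF y\<in>U. F y) \<le> lsc_envelope X F x"
  proof (rule lsc_envelope_greatest[OF lower_semicontinuous_SUP_INF])
    fix y assume "y \<in> topspace X"
    show "(SUP U\<in>neighbourhoods X y. INF z\<in>U. F z) \<le> F y"
      by (intro SUP_least INF_lower) (auto simp: neighbourhoods_def)
  qed
  show "lsc_envelope X F x \<le> (SUP U\<in>neighbourhoods X x. INF y\<in>U. F y)"
    unfolding lsc_envelope_def
  proof (rule SUP_least, safe)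
    fix h assume h: "lower_semicontinuous X h" "\<forall>y\<in>topspace X. h y \<le> F y"
    show "h x \<le> (SUP U\<in>neighbourhoods X x. INF y\<in>U. F y)"
    proof (rule dense_le)
      fix a assume a: "a < h x"
      let ?U = "{y \<in> topspace X. a < h y}"
      have "?U \<in> neighbourhoods X x"
        using h(1) a x unfolding lower_semicontinuous_def by (intro neighbourhoods_openI) auto
      moreover have "a \<le> (INF y\<in>?U. F y)"
      proof (rule INF_greatest)
        fix y assume "y \<in> ?U"
        then show "a \<le> F y" using h(2) by (metis (mono_tags, lifting) mem_Collect_eq less_imp_le order_trans)
      qed
      ultimately show "a \<le> (SUP U\<in>neighbourhoods X x. INF y\<in>U. F y)"
        by (metis (no_types, lifting) SUP_upper order_trans)
    qed
  qed
qed

text \<open>For fixed \<open>U\<close> the infima over \<open>U\<close> increase, so their limit is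
  a supremum, and suprema over \<open>U\<close> and over the index commute. The envelopes cannot be
  dropped, as the \<open>F m\<close> need not be lower semicontinuous.\<close>

lemma is_Gamma_lim_incseq:
  assumes inc: "\<And>x m n. x \<in> topspace X \<Longrightarrow> m \<le> n \<Longrightarrow> F m x \<le> F n x"
  shows "is_Gamma_lim X F (\<lambda>x. SUP m. lsc_envelope X (F m) x)"
  unfolding is_Gamma_lim_def
proof (intro ballI conjI)
  fix x assume x: "x \<in> topspace X"
  have mono: "(INF y\<in>U. F m y) \<le> (INF y\<in>U. F n y)" if "U \<in> neighbourhoods X x" "m \<le> n" for U m n
  proof (rule INF_mono)
    fix y assume "y \<in> U"
    then show "\<exists>z\<in>U. F m z \<le> F n y"
      using that inc[of y m n] unfolding neighbourhoods_def by auto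
  qed
  show "Gamma_limsup X F x \<le> (SUP m. lsc_envelope X (F m) x)"
    unfolding Gamma_limsup_def
  proof (rule SUP_least)
    fix U assume U: "U \<in> neighbourhoods X x"
    have "limsup (\<lambda>n. INF y\<in>U. F n y) = (SUP n. INF y\<in>U. F n y)"
      using mono[OF U] by (intro lim_imp_Limsup LIMSEQ_SUP) (auto simp: incseq_def)
    also have "\<dots> \<le> (SUP m. lsc_envelope X (F m) x)"
      using U by (intro SUP_mono') (auto simp: lsc_envelope_eq_SUP_INF[OF x] intro: SUP_upper)
    finally show "limsup (\<lambda>n. INF y\<in>U. F n y) \<le> (SUP m. lsc_envelope X (F m) x)" .
  qed
  show "(SUP m. lsc_envelope X (F m) x) \<le> Gamma_liminf X F x"
  proof (rule SUP_least)
    fix m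
    show "lsc_envelope X (F m) x \<le> Gamma_liminf X F x"
      unfolding lsc_envelope_eq_SUP_INF[OF x] Gamma_liminf_def
    proof (rule SUP_mono, intro bexI)
      fix U assume U: "U \<in> neighbourhoods X x"
      show "(INF y\<in>U. F m y) \<le> liminf (\<lambda>n. INF y\<in>U. F n y)"
        by (rule Liminf_bounded) (auto simp: eventually_sequentially intro!: exI[of _ m] mono[OF U])
    qed
  qed
qed

text \<open>For fixed \<open>U\<close> the infima over \<open>U\<close> decrease, so their limit is
  an infimum, and the two infima commute.\<close>

lemma is_Gamma_lim_decseq:
  assumes dec: "\<And>x m n. x \<in> topspace X \<Longrightarrow> m \<le> n \<Longrightarrow> F n x \<le> F m x"
  shows "is_Gamma_lim X F (lsc_envelope X (\<lambda>x. INF n. F n x))"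
proof -
  have "Gamma_liminf X F x = lsc_envelope X (\<lambda>x. INF n. F n x) x \<and>
        Gamma_limsup X F x = lsc_envelope X (\<lambda>x. INF n. F n x) x" if x: "x \<in> topspace X" for x
  proof -
    have lim: "(\<lambda>n. INF y\<in>U. F n y) \<longlonglongrightarrow> (INF y\<in>U. INF n. F n y)"
      if U: "U \<in> neighbourhoods X x" for U
    proof -
      have "(\<lambda>n. INF y\<in>U. F n y) \<longlonglongrightarrow> (INF n. INF y\<in>U. F n y)"
      proof (intro LIMSEQ_INF decseq_SucI INF_mono)
        fix n y assume "y \<in> U"
        then show "\<exists>z\<in>U. F (Suc n) z \<le> F n y"
          using U dec[of y n "Suc n"] unfolding neighbourhoods_def by auto
      qed
      then show ?thesis by (subst INF_commute)
    qed
    show ?thesis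
      unfolding lsc_envelope_eq_SUP_INF[OF x] Gamma_liminf_def Gamma_limsup_def
      by (intro conjI SUP_cong refl lim_imp_Liminf lim_imp_Limsup lim) auto
  qed
  then show ?thesis unfolding is_Gamma_lim_def by simp
qed

lemma is_Gamma_lim_cong:
  assumes "\<And>x. x \<in> topspace X \<Longrightarrow> G x = G' x" "is_Gamma_lim X F G"
  shows "is_Gamma_lim X F G'"
  using assms unfolding is_Gamma_lim_def by simp

section \<open>Neighbourhoods in the weak* topology\<close>

lemma continuous_map_weak_star_integral:
  fixes \<phi> :: "real ^ 'd \<Rightarrow> real"
  assumes "continuous_on (closure cube) \<phi>"
  shows "continuous_map weak_star euclideanreal (\<lambda>\<mu>. \<integral>x. \<phi> x \<partial>\<mu>)"
proof -
  let ?C = "{\<phi> :: real ^ 'd \<Rightarrow> real. continuous_on (closure cube) \<phi>}"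
  let ?J = "\<lambda>\<mu>. \<lambda>\<phi>\<in>?C. \<integral>x. \<phi> x \<partial>\<mu>"
  have "continuous_map weak_star euclideanreal ((\<lambda>g. g \<phi>) \<circ> ?J)"
    unfolding weak_star_def
    by (intro continuous_map_pullback continuous_map_product_projection) (use assms in simp)
  then show ?thesis
    using assms by (simp add: comp_def)
qed

text \<open>A basic open set of a product topology restricts only finitely many coordinates. Being
  weak* close thus reduces to finitely many integrals with one common tolerance.\<close>

lemma weak_star_neighbourhood_basis:
  fixes \<mu> :: "(real ^ 'd) measure"
  assumes "openin weak_star U" "\<mu> \<in> U"
  shows "\<exists>\<Phi> r. finite \<Phi> \<and> 0 < (r::real) \<and> (\<forall>\<phi>\<in>\<Phi>. continuous_on (closure cube) \<phi>) \<and>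
    (\<forall>\<nu>\<in>Mplus. (\<forall>\<phi>\<in>\<Phi>. \<bar>(\<integral>x. \<phi> x \<partial>\<nu>) - (\<integral>x. \<phi> x \<partial>\<mu>)\<bar> < r) \<longrightarrow> \<nu> \<in> U)"
proof -
  let ?C = "{\<phi> :: real ^ 'd \<Rightarrow> real. continuous_on (closure cube) \<phi>}"
  let ?J = "\<lambda>\<mu>. \<lambda>\<phi>\<in>?C. \<integral>x. \<phi> x \<partial>\<mu>"
  obtain W where W: "openin (product_topology (\<lambda>_. euclideanreal) ?C) W" "U = ?J -` W \<inter> Mplus"
    using assms(1) unfolding weak_star_def openin_pullback_topology by blast
  have "?J \<mu> \<in> W" using W assms by auto
  then have "\<exists>V. finite {\<phi> \<in> ?C. V \<phi> \<noteq> UNIV} \<and> (\<forall>\<phi>\<in>?C. open (V \<phi>)) \<and> ?J \<mu> \<in> Pi\<^sub>E ?C V \<and> Pi\<^sub>E ?C V \<subseteq> W"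
    using W(1)[unfolded openin_product_topology_alt topspace_euclidean open_openin[symmetric], rule_format, of "?J \<mu>"] by blast
  then obtain V where V: "finite {\<phi> \<in> ?C. V \<phi> \<noteq> UNIV}" "\<And>\<phi>. \<phi> \<in> ?C \<Longrightarrow> open (V \<phi>)"
    "?J \<mu> \<in> Pi\<^sub>E ?C V" "Pi\<^sub>E ?C V \<subseteq> W"
    by blast
  let ?\<Phi> = "{\<phi> \<in> ?C. V \<phi> \<noteq> UNIV}"
  have "\<exists>r>0. \<forall>t. \<bar>t - (\<integral>x. \<phi> x \<partial>\<mu>)\<bar> < r \<longrightarrow> t \<in> V \<phi>" if "\<phi> \<in> ?\<Phi>" for \<phi>
  proof -
    have \<phi>: "\<phi> \<in> ?C" using that by simp
    have "open (V \<phi>)" "(\<integral>x. \<phi> x \<partial>\<mu>) \<in> V \<phi>"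
      using V(2)[OF \<phi>] PiE_mem[OF V(3) \<phi>] \<phi> by simp_all
    then show ?thesis unfolding open_dist dist_real_def by blast
  qed
  then have "\<forall>\<phi>\<in>?\<Phi>. \<exists>r. 0 < r \<and> (\<forall>t. \<bar>t - (\<integral>x. \<phi> x \<partial>\<mu>)\<bar> < r \<longrightarrow> t \<in> V \<phi>)"
    by blast
  from bchoice[OF this] obtain \<rho> where
    "\<forall>\<phi>\<in>?\<Phi>. 0 < \<rho> \<phi> \<and> (\<forall>t. \<bar>t - (\<integral>x. \<phi> x \<partial>\<mu>)\<bar> < \<rho> \<phi> \<longrightarrow> t \<in> V \<phi>)" ..
  then have \<rho>: "\<And>\<phi>. \<phi> \<in> ?\<Phi> \<Longrightarrow> 0 < \<rho> \<phi>"
    "\<And>\<phi> t. \<phi> \<in> ?\<Phi> \<Longrightarrow> \<bar>t - (\<integral>x. \<phi> x \<partial>\<mu>)\<bar> < \<rho> \<phi> \<Longrightarrow> t \<in> V \<phi>"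
    by blast+
  \<comment> \<open>The inserted 1 keeps the minimum defined when no coordinate is
    restricted.\<close>
  define r where "r = Min (insert 1 (\<rho> ` ?\<Phi>))"
  have r: "0 < r" "\<And>\<phi>. \<phi> \<in> ?\<Phi> \<Longrightarrow> r \<le> \<rho> \<phi>"
    unfolding r_def using V(1) \<rho>(1) by auto
  show ?thesis
  proof (intro exI conjI ballI impI)
    show "finite ?\<Phi>" "0 < r" by (rule V(1), rule r(1))
    show "continuous_on (closure cube) \<phi>" if "\<phi> \<in> ?\<Phi>" for \<phi> using that by simp
    fix \<nu> :: "(real ^ 'd) measure"
    assume \<nu>: "\<nu> \<in> Mplus" "\<forall>\<phi>\<in>?\<Phi>. \<bar>(\<integral>x. \<phi> x \<partial>\<nu>) - (\<integral>x. \<phi> x \<partial>\<mu>)\<bar> < r"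
    have "(\<integral>x. \<phi> x \<partial>\<nu>) \<in> V \<phi>" if "\<phi> \<in> ?C" for \<phi>
    proof (cases "V \<phi> = UNIV")
      case False
      then have "\<phi> \<in> ?\<Phi>" using that by simp
      with r(2)[OF this] \<nu>(2) show ?thesis by (intro \<rho>(2)) (blast, rule less_le_trans, blast+)
    qed simp
    then have "?J \<nu> \<in> Pi\<^sub>E ?C V" by (intro restrict_PiE_iff[THEN iffD2] ballI)
    with V(4) have "?J \<nu> \<in> W" by (rule subsetD)
    then show "\<nu> \<in> U" using W(2) \<nu>(1) by simp
  qed
qed

section \<open>Piecewise affine functions on the cube\<close>

text \<open>Identifies the coordinates of \<open>One\<close>, which reconciles the coordinatewise
  definition of \<open>cube\<close> with the box calculus.\<close>

lemma sum_Basis_nth: "(\<Sum>x\<in>(Basis :: (real ^ 'd) set). x $ i) = 1"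
  using inner_sum_left_Basis[of "axis i (1::real)" "\<lambda>_. 1"]
  by (simp add: inner_axis axis_in_Basis_iff)

lemma cube_eq_box: "(cube :: (real ^ 'd) set) = box 0 One"
  by (auto simp: cube_def mem_box_cart sum_Basis_nth)

lemma open_cube: "open (cube :: (real ^ 'd) set)"
  and convex_cube: "convex (cube :: (real ^ 'd) set)"
  and bounded_cube: "bounded (cube :: (real ^ 'd) set)"
  and cube_nonempty: "(cube :: (real ^ 'd) set) \<noteq> {}"
  and emeasure_cube: "emeasure lborel (cube :: (real ^ 'd) set) = 1"
  and closure_cube: "closure cube = cbox (0 :: real ^ 'd) One"
  by (auto simp: cube_eq_box box_ne_empty closure_box emeasure_lborel_box)

lemma closure_cube_iff: "x \<in> closure (cube :: (real ^ 'd) set) \<longleftrightarrow> (\<forall>i. 0 \<le> x $ i \<and> x $ i \<le> 1)"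
  by (auto simp: closure_cube mem_box_cart sum_Basis_nth)

lemma cube_subset_closure: "x \<in> cube \<Longrightarrow> x \<in> closure cube"
  using closure_subset by blast

lemma borel_cube [measurable]: "(cube :: (real ^ 'd) set) \<in> sets borel"
  by (simp add: open_cube borel_open)

text \<open>Allows \<open>x\<close> on the boundary: mollified functions are evaluated at mesh
  vertices, some of which lie on the boundary of the cube.\<close>

lemma cube_mix:
  fixes x y :: "real ^ 'd"
  assumes "x \<in> closure cube" "y \<in> cube" "0 < s" "s \<le> 1"
  shows "(1 - s) *\<^sub>R x + s *\<^sub>R y \<in> cube"
  unfolding cube_def
proof (intro CollectI allI)
  fix i
  have x: "0 \<le> x $ i" "x $ i \<le> 1" and y: "0 < y $ i" "y $ i < 1"
    using assms(1)[unfolded closure_cube_iff] assms(2)[unfolded cube_def] by auto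
  have "0 \<le> (1 - s) * x $ i" "(1 - s) * x $ i \<le> 1 - s" "0 < s * y $ i" "s * y $ i < s"
    using x y assms(3,4) by (auto intro!: mult_left_le)
  then show "0 < ((1 - s) *\<^sub>R x + s *\<^sub>R y) $ i \<and> ((1 - s) *\<^sub>R x + s *\<^sub>R y) $ i < 1"
    by simp
qed

lemma closure_cube_dist:
  fixes x y :: "real ^ 'd"
  assumes "x \<in> closure cube" "y \<in> closure cube"
  shows "norm (x - y) \<le> real CARD('d)"
proof -
  have "norm (x - y) \<le> (\<Sum>i\<in>UNIV. \<bar>(x - y) $ i\<bar>)"
    by (rule norm_le_l1_cart)
  also have "\<dots> \<le> (\<Sum>i\<in>(UNIV :: 'd set). 1)"
  proof (rule sum_mono)
    fix i :: 'd
    show "\<bar>(x - y) $ i\<bar> \<le> 1" using assms[unfolded closure_cube_iff, rule_format, of i] by (simp add: abs_le_iff)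
  qed
  finally show ?thesis by simp
qed

section \<open>Pointwise gradients of piecewise affine functions\<close>

lemma grad_eqI:
  assumes "(u has_derivative (\<lambda>h. g \<bullet> h)) (at x)"
  shows "grad u x = g"
  using frechet_derivative_at[OF assms, symmetric]
  by (simp add: grad_def vec_eq_iff inner_axis)

text \<open>Where no derivative exists, \<open>frechet_derivative\<close> chooses from an
  unsatisfiable predicate. The value is unknown but the same at all such points, which makes
  \<open>grad u\<close> Borel and bounded everywhere and not just almost everywhere.\<close>

lemma grad_not_differentiable:
  fixes u :: "real ^ 'd \<Rightarrow> real"
  assumes "\<not> u differentiable (at x)"
  shows "grad u x = (\<chi> i. (SOME f' :: real ^ 'd \<Rightarrow> real. False) (axis i 1))"
  using assms unfolding grad_def frechet_derivative_def differentiable_def by (intro vec_eq_iff[THEN iffD2] allI) simp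

text \<open>The finitely many sets \<open>{x. x \<in> S \<longleftrightarrow> S \<in> I}\<close>, \<open>I \<subseteq> T\<close>, partition the space.\<close>

lemma measurable_finite_atoms:
  assumes "finite T" "\<And>S. S \<in> T \<Longrightarrow> S \<inter> space M \<in> sets M"
    and h: "\<And>x. x \<in> space M \<Longrightarrow> h x \<in> space N"
    and eq: "\<And>x y. x \<in> space M \<Longrightarrow> y \<in> space M \<Longrightarrow> {S\<in>T. x \<in> S} = {S\<in>T. y \<in> S} \<Longrightarrow> h x = h y"
  shows "h \<in> measurable M N"
proof (rule measurableI[OF h])
  fix A
  let ?at = "\<lambda>x. {S\<in>T. x \<in> S}"
  let ?P = "?at ` (h -` A \<inter> space M)"
  have fin: "finite ?P"
    by (rule finite_subset[of _ "Pow T"]) (use assms(1) in auto)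
  have "{x\<in>space M. ?at x = I} \<in> sets M" if "I \<in> ?P" for I
  proof -
    have "{x\<in>space M. x \<in> S \<longleftrightarrow> S \<in> I} \<in> sets M" if S: "S \<in> T" for S
    proof -
      have "{x\<in>space M. x \<in> S \<longleftrightarrow> S \<in> I} = (if S \<in> I then S \<inter> space M else space M - S \<inter> space M)"
        by auto
      then show ?thesis using assms(2)[OF S] by auto
    qed
    then have "{x\<in>space M. \<forall>S\<in>T. x \<in> S \<longleftrightarrow> S \<in> I} \<in> sets M"
      using assms(1) by (intro sets.sets_Collect_finite_All)
    moreover have "I \<subseteq> T" using that by auto
    then have "{x\<in>space M. ?at x = I} = {x\<in>space M. \<forall>S\<in>T. x \<in> S \<longleftrightarrow> S \<in> I}"
      by auto
    ultimately show ?thesis by simp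
  qed
  then have "(\<Union>I\<in>?P. {x\<in>space M. ?at x = I}) \<in> sets M"
    by (intro sets.finite_UN[OF fin])
  also have "(\<Union>I\<in>?P. {x\<in>space M. ?at x = I}) = h -` A \<inter> space M"
  proof (intro set_eqI iffI)
    fix x assume "x \<in> (\<Union>I\<in>?P. {x\<in>space M. ?at x = I})"
    then obtain y where "y \<in> h -` A \<inter> space M" "x \<in> space M" "?at x = ?at y" by blast
    then show "x \<in> h -` A \<inter> space M" using eq[of x y] by simp
  qed blast
  finally show "h -` A \<inter> space M \<in> sets M" .
qed

text \<open>Affinity is asked only on the open cube, as in \<open>W_discrete\<close>, where values
  on the boundary are arbitrary. Nonempty interiors make the coefficient \<open>a S\<close> readable
  from a derivative.\<close>

locale piecewise_affine =
  fixes T :: "(real ^ 'd) set set" and u :: "real ^ 'd \<Rightarrow> real"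
    and a :: "(real ^ 'd) set \<Rightarrow> real ^ 'd" and b :: "(real ^ 'd) set \<Rightarrow> real"
  assumes finite_T: "finite T"
    and closed_T: "S \<in> T \<Longrightarrow> closed S"
    and convex_T: "S \<in> T \<Longrightarrow> convex S"
    and interior_T: "S \<in> T \<Longrightarrow> interior S \<noteq> {}"
    and cube_cover: "cube \<subseteq> \<Union>T"
    and affine: "S \<in> T \<Longrightarrow> x \<in> S \<Longrightarrow> x \<in> cube \<Longrightarrow> u x = a S \<bullet> x + b S"
begin

lemma has_derivative_interior:
  assumes "S \<in> T" "x \<in> interior S" "x \<in> cube"
  shows "(u has_derivative (\<lambda>h. a S \<bullet> h)) (at x)"
proof (rule has_derivative_transform_within_open)
  show "((\<lambda>y. a S \<bullet> y + b S) has_derivative (\<lambda>h. a S \<bullet> h)) (at x)"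
    by (auto intro!: derivative_eq_intros)
  show "open (interior S \<inter> cube)" using open_cube by blast
  show "x \<in> interior S \<inter> cube" using assms by blast
qed (use assms(1) interior_subset[of S] affine[of S] in auto)

text \<open>Close to \<open>x\<close> only pieces through \<open>x\<close> occur, since the others
  are finitely many closed sets. If the pieces through \<open>x\<close> share a slope, they also
  share the value at \<open>x\<close> and glue to one affine function.\<close>

lemma has_derivative_common:
  assumes x: "x \<in> cube" and g: "\<And>S. S \<in> T \<Longrightarrow> x \<in> S \<Longrightarrow> a S = g"
  shows "(u has_derivative (\<lambda>h. g \<bullet> h)) (at x)"
proof (rule has_derivative_transform_within_open)
  let ?N = "cube - \<Union>{S\<in>T. x \<notin> S}"
  show "((\<lambda>y. g \<bullet> y + (u x - g \<bullet> x)) has_derivative (\<lambda>h. g \<bullet> h)) (at x)"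
    by (auto intro!: derivative_eq_intros)
  show "open ?N"
    using finite_T closed_T by (intro open_Diff open_cube closed_Union) auto
  show "x \<in> ?N" using x by auto
  fix y assume y: "y \<in> ?N"
  then obtain S where S: "S \<in> T" "y \<in> S" "x \<in> S" using cube_cover by blast
  then show "g \<bullet> y + (u x - g \<bullet> x) = u y"
    using affine[of S x] affine[of S y] g[of S] x y by simp
qed

text \<open>The point may lie on the boundary of \<open>S\<close>. Along segments from
  \<open>x\<close> into \<open>S\<close> the one-sided derivative is that of the affine piece, and
  differences of such directions fill a ball because \<open>S\<close> has interior points.\<close>

lemma grad_eq_coefficient:
  assumes x: "x \<in> cube" and S: "S \<in> T" "x \<in> S" and diff: "u differentiable (at x)"
  shows "grad u x = a S" "(u has_derivative (\<lambda>h. a S \<bullet> h)) (at x)"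
proof -
  obtain D where D: "(u has_derivative D) (at x)" using diff unfolding differentiable_def by auto
  have line: "D (s - x) = a S \<bullet> (s - x)" if s: "s \<in> S" for s
  proof -
    obtain e where e: "e > 0" "ball x e \<subseteq> cube" using open_cube x open_contains_ball by blast
    \<comment> \<open>\<open>S\<close> may leave the open cube; up to time \<open>t0\<close> the
      segment towards \<open>s\<close> stays inside a ball around \<open>x\<close> on which the
      formula for \<open>u\<close> is available.\<close>
    define t0 where "t0 = min 1 (e / (2 * (norm (s - x) + 1)))"
    have t0: "0 < t0" "t0 \<le> 1" unfolding t0_def using e by (auto simp: add_nonneg_pos)
    have in_cube: "x + t *\<^sub>R (s - x) \<in> cube \<inter> S" if t: "t \<in> {0..t0}" for t
    proof
      have "norm (t *\<^sub>R (s - x)) \<le> t0 * norm (s - x)" using t by (simp add: mult_right_mono)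
      also have "\<dots> \<le> (e / (2 * (norm (s - x) + 1))) * norm (s - x)"
        unfolding t0_def by (intro mult_right_mono) auto
      also have "\<dots> < e"
      proof -
        have "norm (s - x) < 2 * (norm (s - x) + 1)" by (smt (verit) norm_ge_zero)
        then show ?thesis
          using e(1) mult_strict_left_mono[of "norm (s - x)" "2 * (norm (s - x) + 1)" e]
          by (simp add: pos_divide_less_eq add_nonneg_pos)
      qed
      finally show "x + t *\<^sub>R (s - x) \<in> cube" using e(2) by (auto simp: dist_norm)
      have "(1 - t) *\<^sub>R x + t *\<^sub>R s \<in> S"
        using t t0 convex_T[OF S(1)] S(2) s by (intro convexD) auto
      then show "x + t *\<^sub>R (s - x) \<in> S" by (simp add: algebra_simps)
    qed
    have D': "(u has_derivative D) (at (x + 0 *\<^sub>R (s - x)))" using D by simp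
    have lin: "linear D" using D has_derivative_linear by blast
    have "((\<lambda>t. x + t *\<^sub>R (s - x)) has_derivative (\<lambda>t. t *\<^sub>R (s - x))) (at 0 within {0..t0})"
      by (auto intro!: derivative_eq_intros)
    from has_derivative_compose[OF this D']
    have 1: "((\<lambda>t. u (x + t *\<^sub>R (s - x))) has_vector_derivative D (s - x)) (at 0 within {0..t0})"
      by (simp add: has_vector_derivative_def linear_scale[OF lin])
    have "((\<lambda>t. a S \<bullet> (x + t *\<^sub>R (s - x)) + b S) has_vector_derivative a S \<bullet> (s - x)) (at 0 within {0..t0})"
      unfolding has_vector_derivative_def by (auto intro!: derivative_eq_intros)
    then have 2: "((\<lambda>t. u (x + t *\<^sub>R (s - x))) has_vector_derivative a S \<bullet> (s - x)) (at 0 within {0..t0})"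
      by (rule has_vector_derivative_transform[rotated 2]) (use affine[OF S(1)] in_cube t0 in auto)
    show ?thesis
      using t0 1 2 by (intro vector_derivative_unique_within_closed_interval[of 0 t0 0]) auto
  qed
  obtain c r where cr: "r > 0" "cball c r \<subseteq> S"
    using interior_T[OF S(1)] by (metis all_not_in_conv mem_interior_cball)
  have lin: "linear D" using D has_derivative_linear by blast
  have "D h = a S \<bullet> h" for h
  proof (cases "h = 0")
    case True then show ?thesis using lin by (simp add: linear_0)
  next
    case False
    define t where "t = r / norm h"
    have t: "t > 0" unfolding t_def using cr False by simp
    have "c + t *\<^sub>R h \<in> S" "c \<in> S"
      using cr False unfolding t_def by (auto intro!: subsetD[OF cr(2)] simp: dist_norm)
    note line[OF this(1)] line[OF this(2)]
    moreover have "D (c + t *\<^sub>R h - x) = D (c - x) + t * D h"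
      using linear_add[OF lin, of "c - x" "t *\<^sub>R h"] linear_scale[OF lin, of t h] by (simp add: algebra_simps)
    ultimately have "t * D h = t * (a S \<bullet> h)" by (simp add: inner_diff_right inner_add_right)
    then show ?thesis using t by simp
  qed
  then have "D = (\<lambda>h. a S \<bullet> h)" by blast
  with D show d: "(u has_derivative (\<lambda>h. a S \<bullet> h)) (at x)" by simp
  then show "grad u x = a S" by (rule grad_eqI)
qed

text \<open>Differentiability at \<open>x\<close> forces all pieces through \<open>x\<close> to have
  one slope, and this transfers to any point met by the same pieces. At the remaining points the
  common default value applies.\<close>

lemma grad_eq_of_same_atom:
  assumes "x \<in> cube" "y \<in> cube" "{S\<in>T. x \<in> S} = {S\<in>T. y \<in> S}"
  shows "grad u x = grad u y"
proof -
  have *: "u differentiable (at y)" "grad u y = grad u x"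
    if d: "x \<in> cube" "y \<in> cube" "\<And>S. S \<in> T \<Longrightarrow> x \<in> S \<longleftrightarrow> y \<in> S" "u differentiable (at x)" for x y
  proof -
    have "(u has_derivative (\<lambda>h. grad u x \<bullet> h)) (at y)"
    proof (rule has_derivative_common[OF d(2)])
      fix S assume S: "S \<in> T" "y \<in> S"
      then have "x \<in> S" using d(3) by blast
      from grad_eq_coefficient(1)[OF d(1) S(1) this d(4)] show "a S = grad u x" by simp
    qed
    then show "u differentiable (at y)" "grad u y = grad u x"
      using grad_eqI unfolding differentiable_def by blast+
  qed
  have same: "x \<in> S \<longleftrightarrow> y \<in> S" if "S \<in> T" for S using assms(3) that by blast
  show ?thesis
  proof (cases "u differentiable (at x)")
    case True
    show ?thesis by (rule *(2)[symmetric]) (use assms same True in blast)+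
  next
    case False
    then have "\<not> u differentiable (at y)" using *(1)[of y x] assms same by blast
    then show ?thesis using False by (simp add: grad_not_differentiable)
  qed
qed

lemma borel_measurable_grad: "grad u \<in> borel_measurable (restrict_space borel cube)"
  by (rule measurable_finite_atoms[OF finite_T])
     (auto simp: sets_restrict_space space_restrict_space borel_closed closed_T intro: grad_eq_of_same_atom)

lemma grad_bounded: "\<exists>B. \<forall>x\<in>cube. norm (grad u x) \<le> B"
proof -
  let ?J = "(\<chi> i. (SOME f' :: real ^ 'd \<Rightarrow> real. False) (axis i 1)) :: real ^ 'd"
  \<comment> \<open>The maximum includes the default value \<open>?J\<close> taken where
    \<open>u\<close> is not differentiable.\<close>
  have "norm (grad u x) \<le> Max (insert (norm ?J) ((\<lambda>S. norm (a S)) ` T))" if x: "x \<in> cube" for x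
  proof (cases "u differentiable (at x)")
    case True
    obtain S where "S \<in> T" "x \<in> S" using x cube_cover by blast
    then show ?thesis using grad_eq_coefficient(1)[OF x _ _ True] finite_T by (intro Max_ge) auto
  next
    case False
    then show ?thesis using finite_T by (intro Max_ge) (auto simp: grad_not_differentiable)
  qed
  then show ?thesis by blast
qed

lemma AE_interior: "AE x in restrict_space lborel cube. \<exists>S\<in>T. x \<in> interior S"
proof -
  have "negligible (\<Union>S\<in>T. frontier S)"
    using finite_T convex_T negligible_convex_frontier by (intro negligible_Union) auto
  \<comment> \<open>Closedness makes the negligible set Borel, hence null for \<open>lborel\<close>
    and not merely for its completion.\<close>
  moreover have "closed (\<Union>S\<in>T. frontier S)"
    using finite_T by (intro closed_UN) auto
  ultimately have "(\<Union>S\<in>T. frontier S) \<in> null_sets lborel"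
    by (auto simp: null_sets_def negligible_iff_null_sets borel_closed)
  then have "AE x in lborel. x \<notin> (\<Union>S\<in>T. frontier S)" by (rule AE_not_in)
  then have "AE x in lborel. x \<in> cube \<longrightarrow> (\<exists>S\<in>T. x \<in> interior S)"
  proof (rule AE_mp, intro AE_I2 impI)
    fix x assume x: "x \<notin> (\<Union>S\<in>T. frontier S)" "x \<in> cube"
    then obtain S where S: "S \<in> T" "x \<in> S" using cube_cover by blast
    then show "\<exists>S\<in>T. x \<in> interior S" using x closed_T[OF S(1)] by (auto simp: frontier_def)
  qed
  then show ?thesis by (simp add: AE_restrict_space_iff)
qed

lemma AE_has_derivative:
  "AE x in restrict_space lborel cube. (u has_derivative (\<lambda>h. grad u x \<bullet> h)) (at x)"
proof (rule AE_mp[OF AE_interior], intro AE_I2 impI)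
  fix x assume "x \<in> space (restrict_space lborel cube)" "\<exists>S\<in>T. x \<in> interior S"
  then obtain S where "S \<in> T" "x \<in> interior S" "x \<in> cube" by (auto simp: space_restrict_space)
  from has_derivative_interior[OF this] grad_eqI[OF has_derivative_interior[OF this]]
  show "(u has_derivative (\<lambda>h. grad u x \<bullet> h)) (at x)" by simp
qed

text \<open>Convexity of the cube reduces the claim to a segment. Finitely many closed pieces cover
  the parameter interval, and Lipschitz bounds on them combine with the same constant.\<close>

lemma lipschitz: "\<exists>L. L-lipschitz_on cube u"
proof -
  define A where "A = (\<Sum>S\<in>T. norm (a S))"
  have A: "norm (a S) \<le> A" if "S \<in> T" for S
    unfolding A_def using that finite_T by (intro member_le_sum) auto
  have "A-lipschitz_on cube u"
  proof (rule lipschitz_onI)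
    show "0 \<le> A" unfolding A_def by (simp add: sum_nonneg)
    fix x y :: "real ^ 'd" assume xy: "x \<in> cube" "y \<in> cube"
    define g where "g t = x + t *\<^sub>R (y - x)" for t :: real
    have g_cube: "g t \<in> cube" if "t \<in> {0..1}" for t
      using convexD_alt[OF convex_cube xy, of t] that by (simp add: g_def algebra_simps)
    have g_diff: "g t - g s = (t - s) *\<^sub>R (y - x)" for s t by (simp add: g_def algebra_simps)
    have "(A * norm (y - x))-lipschitz_on {0..1} (\<lambda>t. u (g t))"
    proof (rule lipschitz_on_closed_Union)
      show "finite T" by (rule finite_T)
      show "0 \<le> A * norm (y - x)" using \<open>0 \<le> A\<close> by simp
      show "{0..1} \<subseteq> (\<Union>S\<in>T. {0..1} \<inter> g -` S)"
        using g_cube cube_cover by blast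
      fix S assume S: "S \<in> T"
      have "continuous_on UNIV g" unfolding g_def by (intro continuous_intros)
      then show "closed ({0..1} \<inter> g -` S)"
        using closed_T[OF S] by (intro closed_Int closed_vimage) auto
      show "(A * norm (y - x))-lipschitz_on ({0..1} \<inter> g -` S) (\<lambda>t. u (g t))"
      proof (rule lipschitz_onI)
        fix s t assume st: "s \<in> {0..1} \<inter> g -` S" "t \<in> {0..1} \<inter> g -` S"
        then have "u (g s) - u (g t) = a S \<bullet> (g s - g t)"
          using affine[OF S] g_cube by (simp add: inner_diff_right)
        also have "\<bar>\<dots>\<bar> \<le> norm (a S) * norm (g s - g t)" by (rule Cauchy_Schwarz_ineq2)
        also have "\<dots> \<le> A * (\<bar>s - t\<bar> * norm (y - x))"
          unfolding g_diff using A[OF S] by (simp add: mult_right_mono)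
        finally show "dist (u (g s)) (u (g t)) \<le> A * norm (y - x) * dist s t"
          by (simp add: dist_real_def mult_ac)
      qed (use \<open>0 \<le> A\<close> in simp)
    qed
    from lipschitz_onD[OF this, of 0 1]
    show "dist (u x) (u y) \<le> A * dist x y"
      by (simp add: g_def dist_norm norm_minus_commute)
  qed
  then show ?thesis by blast
qed

end

section \<open>Nodal interpolation and mesh size\<close>

text \<open>Moving one vertex to the origin turns affine into linear independence, so a linear
  functional with prescribed differences exists.\<close>

lemma affine_interpolation:
  fixes C :: "'a::euclidean_space set" and g :: "'a \<Rightarrow> real"
  assumes "\<not> affine_dependent C"
  shows "\<exists>a b. \<forall>c\<in>C. a \<bullet> c + b = g c"
proof (cases "C = {}")
  case False
  then obtain c0 where c0: "c0 \<in> C" by blast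
  have "independent ((\<lambda>x. - c0 + x) ` (C - {c0}))"
    using assms affine_dependent_iff_dependent2[OF c0] by simp
  from linear_independent_extend[OF this, of "\<lambda>x. g (c0 + x) - g c0"]
  obtain l where l: "linear l" "\<forall>x\<in>(\<lambda>x. - c0 + x) ` (C - {c0}). l x = g (c0 + x) - g c0"
    by blast
  \<comment> \<open>The adjoint evaluated at 1 is the Riesz vector of the functional
    \<open>l\<close>.\<close>
  define a where "a = adjoint l (1::real)"
  have a: "a \<bullet> x = l x" for x
    using adjoint_works[OF l(1), of x 1] by (simp add: a_def inner_commute)
  have "a \<bullet> c + (g c0 - a \<bullet> c0) = g c" if "c \<in> C" for c
  proof (cases "c = c0")
    case False
    then have "l (- c0 + c) = g (c0 + (- c0 + c)) - g c0" using l(2) that by blast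
    then show ?thesis using linear_diff[OF l(1), of c c0] by (simp add: a)
  qed simp
  then show ?thesis by blast
qed simp

lemma simplex_affine_interpolation:
  fixes S :: "'a::euclidean_space set"
  assumes "n simplex S"
  shows "\<exists>a b. \<forall>v. v extreme_point_of S \<longrightarrow> a \<bullet> v + b = g v"
  using assms affine_interpolation[of _ g] extreme_point_of_convex_hull unfolding simplex by metis

text \<open>Continuity across simplices: a common face is the convex hull of its extreme points,
  these are vertices of both simplices, and there both affine pieces equal \<open>g\<close>.\<close>

lemma triangulation_interpolation:
  fixes T :: "'a::euclidean_space set set" and g :: "'a \<Rightarrow> real"
  assumes T: "triangulation T"
  obtains w a b where "continuous_on (\<Union>T) w"
    "\<And>S x. S \<in> T \<Longrightarrow> x \<in> S \<Longrightarrow> w x = a S \<bullet> x + b S"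
    "\<And>S v. S \<in> T \<Longrightarrow> v extreme_point_of S \<Longrightarrow> w v = g v"
proof -
  have "\<forall>S\<in>T. \<exists>ab. \<forall>v. v extreme_point_of S \<longrightarrow> fst ab \<bullet> v + snd ab = g v"
    using T simplex_affine_interpolation[of _ _ g] unfolding triangulation_def by force
  from bchoice[OF this] obtain ab where
    ab: "\<forall>S\<in>T. \<forall>v. v extreme_point_of S \<longrightarrow> fst (ab S) \<bullet> v + snd (ab S) = g v" ..
  define a b where "a S = fst (ab S)" and "b S = snd (ab S)" for S
  have vertex: "a S \<bullet> v + b S = g v" if "S \<in> T" "v extreme_point_of S" for S v
    using ab that unfolding a_def b_def by blast
  have simp: "\<exists>n. n simplex S" "compact S" "convex S" if "S \<in> T" for S
    using T that compact_simplex convex_simplex unfolding triangulation_def by blast+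
  have compat: "a S \<bullet> x + b S = a S' \<bullet> x + b S'" if S: "S \<in> T" "S' \<in> T" "x \<in> S" "x \<in> S'" for S S' x
  proof -
    let ?F = "S \<inter> S'"
    have F: "?F face_of S" "?F face_of S'"
      using T S(1,2) unfolding triangulation_def by (blast, metis Int_commute)
    have "?F = convex hull {v. v extreme_point_of ?F}"
      using simp[OF S(1)] simp[OF S(2)] by (intro Krein_Milman_Minkowski compact_Int convex_Int)
    moreover have "{v. v extreme_point_of ?F} \<subseteq> {x. (a S - a S') \<bullet> x = b S' - b S}"
    proof safe
      fix v assume "v extreme_point_of ?F"
      then have "v extreme_point_of S" "v extreme_point_of S'"
        using extreme_point_of_face F by blast+
      then show "(a S - a S') \<bullet> v = b S' - b S"
        using vertex[OF S(1)] vertex[OF S(2)] by (simp add: inner_diff_left algebra_simps)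
    qed
    ultimately have "?F \<subseteq> {x. (a S - a S') \<bullet> x = b S' - b S}"
      by (metis hull_minimal convex_hyperplane)
    then have "(a S - a S') \<bullet> x = b S' - b S" using S by blast
    then show ?thesis by (simp add: inner_diff_left algebra_simps)
  qed
  define sel where "sel x = (SOME S. S \<in> T \<and> x \<in> S)" for x
  define w where "w x = a (sel x) \<bullet> x + b (sel x)" for x
  have w: "w x = a S \<bullet> x + b S" if "S \<in> T" "x \<in> S" for S x
  proof -
    have "sel x \<in> T \<and> x \<in> sel x" unfolding sel_def by (rule someI) (use that in blast)
    then show ?thesis unfolding w_def using compat that by blast
  qed
  show thesis
  proof (rule that[OF _ w])
    have "continuous_on S w" if "S \<in> T" for S
      by (rule continuous_on_eq[of _ "\<lambda>x. a S \<bullet> x + b S"]) (use w[OF that] in \<open>auto intro!: continuous_intros\<close>)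
    moreover have "finite T" using T unfolding triangulation_def by blast
    ultimately show "continuous_on (\<Union>T) w"
      using continuous_on_closed_Union[of T "\<lambda>S. S" w] simp(2) compact_imp_closed by auto
    fix S v assume "S \<in> T" "v extreme_point_of S"
    then show "w v = g v" using vertex w extreme_point_of_def by metis
  qed
qed

text \<open>Writing \<open>L\<close> for the difference of the interpolant and the first order expansion of \<open>g\<close> at the
  centre \<open>c\<close> of an inscribed ball of radius \<open>r\<close>, the bound on \<open>\<bar>L\<bar>\<close> at the vertices extends to all
  of \<open>S\<close> by convexity, and the gradient of \<open>L\<close> is read off on a diameter of the ball.\<close>

lemma simplex_interpolation_error:
  fixes S :: "'a::euclidean_space set" and g :: "'a \<Rightarrow> real"
  assumes S: "compact S" "convex S" and ball: "0 < r" "cball c r \<subseteq> S"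
    and diam: "\<And>x. x \<in> S \<Longrightarrow> norm (x - c) \<le> h" and \<kappa>: "h \<le> \<kappa> * r" and \<omega>: "0 \<le> \<omega>"
    and g: "\<And>x. x \<in> S \<Longrightarrow> \<bar>g x - g c - P \<bullet> (x - c)\<bar> \<le> \<omega> * norm (x - c)"
    and vertex: "\<And>v. v extreme_point_of S \<Longrightarrow> a \<bullet> v + b = g v"
  shows "norm (a - P) \<le> \<kappa> * \<omega>" "\<And>x. x \<in> S \<Longrightarrow> \<bar>a \<bullet> x + b - g x\<bar> \<le> 2 * h * \<omega>"
proof -
  define L where "L x = a \<bullet> x + b - g c - P \<bullet> (x - c)" for x
  have gb: "\<bar>g x - g c - P \<bullet> (x - c)\<bar> \<le> h * \<omega>" if "x \<in> S" for x
    using g[OF that] mult_left_mono[OF diam[OF that] \<omega>] by (simp add: mult_ac)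
  have L_eq: "L x = (a - P) \<bullet> x - (g c - b - P \<bullet> c)" for x
    by (simp add: L_def inner_diff_left inner_diff_right)
  have "{x. \<bar>L x\<bar> \<le> h * \<omega>} = {x. (a - P) \<bullet> x \<le> h * \<omega> + (g c - b - P \<bullet> c)} \<inter>
      {x. (a - P) \<bullet> x \<ge> (g c - b - P \<bullet> c) - h * \<omega>}"
    unfolding L_eq by auto
  then have "convex {x. \<bar>L x\<bar> \<le> h * \<omega>}"
    by (simp add: convex_Int convex_halfspace_le convex_halfspace_ge)
  moreover have "{v. v extreme_point_of S} \<subseteq> {x. \<bar>L x\<bar> \<le> h * \<omega>}"
  proof safe
    fix v assume v: "v extreme_point_of S"
    then have "v \<in> S" by (simp add: extreme_point_of_def)
    then show "\<bar>L v\<bar> \<le> h * \<omega>" using gb[of v] vertex[OF v] by (simp add: L_def)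
  qed
  ultimately have L: "\<bar>L x\<bar> \<le> h * \<omega>" if "x \<in> S" for x
    using Krein_Milman_Minkowski[OF S] that by (metis (mono_tags, lifting) hull_minimal mem_Collect_eq subsetD)
  show "\<bar>a \<bullet> x + b - g x\<bar> \<le> 2 * h * \<omega>" if "x \<in> S" for x
    using L[OF that] gb[OF that] unfolding L_def by linarith
  show "norm (a - P) \<le> \<kappa> * \<omega>"
  proof (cases "a = P")
    case True
    have "0 \<le> h" using diam[of c] ball(1) subsetD[OF ball(2), of c] by simp
    then have "0 \<le> \<kappa>" using \<kappa> ball(1) by (metis mult_neg_pos not_le order_trans)
    then show ?thesis using True \<omega> by simp
  next
    case False
    define e where "e = (1 / norm (a - P)) *\<^sub>R (a - P)"
    have e: "norm e = 1" "(a - P) \<bullet> e = norm (a - P)"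
      using False by (simp_all add: e_def norm_eq_sqrt_inner real_div_sqrt)
    have "c + r *\<^sub>R e \<in> S" "c - r *\<^sub>R e \<in> S"
      using ball e(1) by (auto intro!: subsetD[OF ball(2)] simp: dist_norm)
    then have "\<bar>L (c + r *\<^sub>R e)\<bar> \<le> h * \<omega>" "\<bar>L (c - r *\<^sub>R e)\<bar> \<le> h * \<omega>" using L by blast+
    moreover have "L (c + r *\<^sub>R e) - L (c - r *\<^sub>R e) = 2 * (r * norm (a - P))"
      unfolding L_eq using e(2) by (simp add: inner_add_right inner_diff_right)
    ultimately have "r * norm (a - P) \<le> h * \<omega>" by linarith
    also have "\<dots> \<le> r * (\<kappa> * \<omega>)" using mult_right_mono[OF \<kappa> \<omega>] by (simp add: mult_ac)
    finally show ?thesis using ball(1) by simp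
  qed
qed

section \<open>Simplices and mesh size of the refined triangulations\<close>

lemma simplicial_triangulation_facts:
  fixes T :: "(real ^ 'd) set set"
  assumes "simplicial_triangulation_of cube T"
  shows "finite T" "\<And>S. S \<in> T \<Longrightarrow> compact S" "\<And>S. S \<in> T \<Longrightarrow> convex S"
    "\<And>S. S \<in> T \<Longrightarrow> interior S \<noteq> {}" "\<Union>T = closure cube" "\<And>S. S \<in> T \<Longrightarrow> S \<subseteq> closure cube"
    "triangulation T"
proof -
  show "triangulation T" "\<Union>T = closure cube" "finite T"
    using assms unfolding simplicial_triangulation_of_def triangulation_def by auto
  fix S assume S: "S \<in> T"
  then have simp: "int CARD('d) simplex S"
    using assms unfolding simplicial_triangulation_of_def by blast
  show "S \<subseteq> closure cube" using S \<open>\<Union>T = closure cube\<close> by blast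
  show "compact S" "convex S"
    using simp compact_simplex convex_simplex by blast+
  have dim: "aff_dim S = int DIM(real ^ 'd)"
    using aff_dim_simplex[OF simp] by simp
  then have "S \<noteq> {}" by auto
  then show "interior S \<noteq> {}"
    using rel_interior_interior[of S] aff_dim_eq_full[of S] dim \<open>convex S\<close> rel_interior_eq_empty by metis
qed

text \<open>A face of a simplex that meets its interior is the whole simplex; this is applied to the
  intersection from both sides.\<close>

lemma simplicial_triangulation_interior_unique:
  assumes "simplicial_triangulation_of cube T" "S \<in> T" "S' \<in> T" "x \<in> interior S" "x \<in> S'"
  shows "S' = S"
proof -
  have tri: "\<And>A B. A \<in> T \<Longrightarrow> B \<in> T \<Longrightarrow> (A \<inter> B) face_of A"
    using simplicial_triangulation_facts(7)[OF assms(1)] unfolding triangulation_def by blast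
  have "S \<inter> S' = S"
    using face_of_disjoint_interior[OF tri[OF assms(2,3)]] assms(4,5) interior_subset by blast
  then have "S \<subseteq> S'" by blast
  moreover have "S' \<inter> S = S'"
    using face_of_disjoint_interior[OF tri[OF assms(3,2)]] interior_mono[OF \<open>S \<subseteq> S'\<close>] assms(4) interior_subset by blast
  ultimately show ?thesis by blast
qed

lemma refinement_volume:
  fixes \<T> :: "nat \<Rightarrow> (real ^ 'd) set set"
  assumes "successive_uniform_refinements \<T>" "S \<in> \<T> n"
  shows "measure lebesgue S \<le> (1 / 2 ^ CARD('d)) ^ n"
  using assms(2)
proof (induction n arbitrary: S)
  case 0
  have tri: "simplicial_triangulation_of cube (\<T> 0)"
    using assms(1) unfolding successive_uniform_refinements_def by blast
  have "measure lebesgue S \<le> measure lebesgue (closure cube :: (real ^ 'd) set)"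
    using simplicial_triangulation_facts(2,6)[OF tri 0]
    by (intro measure_mono_fmeasurable) (auto simp: closure_cube lmeasurable_compact fmeasurableD)
  also have "\<dots> = 1" by (simp add: closure_cube)
  finally show ?case by simp
next
  case (Suc n)
  have ref: "uniform_refinement (\<T> n) (\<T> (Suc n))"
    using assms(1) unfolding successive_uniform_refinements_def by blast
  then obtain S0 where S0: "S0 \<in> \<T> n" "S \<subseteq> S0"
    using Suc.prems unfolding uniform_refinement_def by blast
  then have "measure lebesgue S = measure lebesgue S0 / 2 ^ CARD('d)"
    using ref Suc.prems unfolding uniform_refinement_def by blast
  then show ?case using Suc.IH[OF S0(1)] by (simp add: divide_right_mono)
qed

text \<open>Refinement controls volumes; shape regularity converts this to diameters, as a simplex
  of diameter at least \<epsilon> contains a ball of radius \<open>\<epsilon> / \<kappa>\<close>,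
  too large for the volume allowed at a late level.\<close>

lemma refinement_mesh:
  fixes \<T> :: "nat \<Rightarrow> (real ^ 'd) set set"
  assumes "successive_uniform_refinements \<T>" "0 < (\<epsilon>::real)"
  shows "\<exists>N. \<forall>n\<ge>N. \<forall>S\<in>\<T> n. diameter S < \<epsilon>"
proof -
  obtain \<kappa> where \<kappa>: "\<kappa> > 0" "\<And>n S. S \<in> \<T> n \<Longrightarrow> \<exists>c r. 0 < r \<and> cball c r \<subseteq> S \<and> diameter S \<le> \<kappa> * r"
    using assms(1) unfolding successive_uniform_refinements_def shape_regular_def by blast
  let ?V = "unit_ball_vol (real CARD('d)) * (\<epsilon> / \<kappa>) ^ CARD('d)"
  have "?V > 0" using assms(2) \<kappa>(1) by simp
  have "(\<lambda>n. (1 / 2 ^ CARD('d)) ^ n) \<longlonglongrightarrow> (0::real)"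
    by (rule LIMSEQ_power_zero) (simp add: one_less_power)
  from order_tendstoD(2)[OF this \<open>?V > 0\<close>]
  obtain N where N: "\<And>n. n \<ge> N \<Longrightarrow> (1 / 2 ^ CARD('d)) ^ n < ?V"
    unfolding eventually_sequentially by blast
  have "diameter S < \<epsilon>" if n: "n \<ge> N" and S: "S \<in> \<T> n" for n S
  proof (rule ccontr)
    assume big: "\<not> diameter S < \<epsilon>"
    have tri: "simplicial_triangulation_of cube (\<T> n)"
      using assms(1) unfolding successive_uniform_refinements_def by blast
    obtain c r where cr: "0 < r" "cball c r \<subseteq> S" "diameter S \<le> \<kappa> * r" using \<kappa>(2)[OF S] by blast
    then have "\<epsilon> / \<kappa> \<le> r" using big \<kappa>(1) by (simp add: divide_le_eq mult.commute)
    then have "?V \<le> unit_ball_vol (real CARD('d)) * r ^ CARD('d)"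
      using assms(2) \<kappa>(1) by (intro mult_left_mono power_mono) auto
    also have "\<dots> = measure lebesgue (cball c r)" using content_cball[of r c] cr(1) by simp
    also have "\<dots> \<le> measure lebesgue S"
      using simplicial_triangulation_facts(2)[OF tri S] cr(2)
      by (intro measure_mono_fmeasurable) (auto simp: lmeasurable_compact)
    also have "\<dots> \<le> (1 / 2 ^ CARD('d)) ^ n" by (rule refinement_volume[OF assms(1) S])
    finally show False using N[OF n] by simp
  qed
  then show ?thesis by blast
qed

section \<open>Integration on the cube\<close>

text \<open>Built on Borel sets, so that it has the same sigma-algebra as every member of
  \<open>Mplus\<close> and measurability passes freely between them.\<close>

abbreviation lcube :: "(real ^ 'd) measure" where
  "lcube \<equiv> restrict_space lborel cube"

lemma space_lcube: "space lcube = cube"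
  by (simp add: space_restrict_space)

lemma sets_lcube: "sets lcube = sets (restrict_space borel cube)"
  by (simp add: sets_restrict_space)

lemma emeasure_lcube: "emeasure lcube (cube :: (real ^ 'd) set) = 1"
  by (simp add: emeasure_restrict_space emeasure_cube)

lemma measure_lcube: "measure lcube (cube :: (real ^ 'd) set) = 1"
  by (simp add: measure_def emeasure_lcube)

interpretation lcube: finite_measure "lcube :: (real ^ 'd) measure"
  by (rule finite_measureI) (simp add: space_lcube emeasure_lcube)

lemma integrable_bounded:
  fixes h :: "'a \<Rightarrow> 'b::{banach, second_countable_topology}"
  assumes "finite_measure M" "h \<in> borel_measurable M" "\<And>x. x \<in> space M \<Longrightarrow> norm (h x) \<le> B"
  shows "integrable M h"
  using assms by (intro finite_measure.integrable_const_bound[of M h B]) auto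

lemma integral_lcube:
  fixes h :: "real ^ 'd \<Rightarrow> 'b::{banach, second_countable_topology}"
  shows "(\<integral>x. h x \<partial>lcube) = (\<integral>x. indicator cube x *\<^sub>R h x \<partial>lborel)"
  by (simp add: integral_restrict_space)

lemma borel_measurable_cube_extend:
  fixes h :: "real ^ 'd \<Rightarrow> 'b::{banach, second_countable_topology}"
  assumes "h \<in> borel_measurable lcube"
  shows "(\<lambda>x. indicator cube x *\<^sub>R h x) \<in> borel_measurable borel"
  using assms by (subst (asm) borel_measurable_restrict_space_iff) auto

lemma measurable_cong_cube:
  "sets M = sets lcube \<Longrightarrow> h \<in> measurable M N \<longleftrightarrow> h \<in> measurable lcube N"
  using measurable_cong_sets by blast

lemma borel_measurable_continuous_cube:
  fixes h :: "real ^ 'd \<Rightarrow> 'b::topological_space"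
  assumes "continuous_on cube h"
  shows "h \<in> borel_measurable lcube"
  using borel_measurable_continuous_on_restrict[OF assms] measurable_cong_sets[OF sets_lcube refl] by blast

lemma borel_measurable_lebesgue_on_cube:
  fixes h :: "real ^ 'd \<Rightarrow> 'b::{banach, second_countable_topology}"
  assumes "h \<in> borel_measurable lcube"
  shows "h \<in> borel_measurable (lebesgue_on cube)"
proof -
  have "(\<lambda>x. indicator cube x *\<^sub>R h x) \<in> borel_measurable lebesgue"
    using borel_measurable_cube_extend[OF assms] by (intro measurable_completion) simp
  then show ?thesis by (subst borel_measurable_restrict_space_iff) auto
qed

lemma integral_lebesgue_on_cube:
  fixes h :: "real ^ 'd \<Rightarrow> 'b::{banach, second_countable_topology}"
  assumes "h \<in> borel_measurable lcube"
  shows "(\<integral>x. h x \<partial>lebesgue_on cube) = (\<integral>x. h x \<partial>lcube)"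
proof -
  have "(\<integral>x. h x \<partial>lebesgue_on cube) = (\<integral>x. indicator cube x *\<^sub>R h x \<partial>lebesgue)"
    by (rule integral_restrict_space) simp
  also have "\<dots> = (\<integral>x. indicator cube x *\<^sub>R h x \<partial>lborel)"
    using borel_measurable_cube_extend[OF assms] by (intro integral_completion) simp
  finally show ?thesis by (simp add: integral_lcube)
qed

text \<open>The datum is only Lebesgue measurable and only bounded almost everywhere. A truncated
  Borel version has the same pairings and a bound valid at every point.\<close>

lemma L_infinity_borel_representative:
  assumes "f \<in> L_infinity cube"
  obtains f1 F where "f1 \<in> borel_measurable lcube" "0 \<le> F" "\<And>x. \<bar>f1 x\<bar> \<le> F"
    "\<And>u. u \<in> borel_measurable lcube \<Longrightarrow>
      (\<integral>x. f x * u x \<partial>lebesgue_on cube) = (\<integral>x. f1 x * u x \<partial>lcube)"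
proof -
  obtain C where f: "f \<in> borel_measurable (lebesgue_on cube)" "AE x in lebesgue_on cube. \<bar>f x\<bar> \<le> C"
    using assms unfolding L_infinity_def by blast
  have "(\<lambda>x. indicator cube x *\<^sub>R f x) \<in> borel_measurable lebesgue"
    using f(1) by (subst (asm) borel_measurable_restrict_space_iff) auto
  from completion_ex_borel_measurable_real[OF this]
  obtain g where g: "g \<in> borel_measurable lborel" "AE x in lborel. indicator cube x *\<^sub>R f x = g x"
    by blast
  \<comment> \<open>Truncating at the absolute value of \<open>C\<close> gives a nonnegative bound
    without examining the sign of \<open>C\<close>.\<close>
  define f1 where "f1 x = max (- \<bar>C\<bar>) (min \<bar>C\<bar> (g x))" for x
  have f1m: "f1 \<in> borel_measurable lborel" unfolding f1_def using g(1) by measurable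
  have "AE x in lebesgue. x \<in> cube \<longrightarrow> f1 x = f x"
  proof -
    have "AE x in lebesgue. indicator cube x *\<^sub>R f x = g x" using g(2) by (rule AE_completion)
    moreover have "AE x in lebesgue. x \<in> cube \<longrightarrow> \<bar>f x\<bar> \<le> C"
      using f(2) by (simp add: AE_restrict_space_iff)
    ultimately show ?thesis by eventually_elim (auto simp: f1_def)
  qed
  then have ae: "AE x in lebesgue_on cube. f1 x = f x" by (simp add: AE_restrict_space_iff)
  have f1L: "f1 \<in> borel_measurable lcube"
    using f1m by (rule measurable_restrict_space1)
  show thesis
  proof (rule that[OF f1L, of "\<bar>C\<bar>"])
    fix u :: "real ^ 'a \<Rightarrow> real" assume u: "u \<in> borel_measurable lcube"
    have "(\<integral>x. f x * u x \<partial>lebesgue_on cube) = (\<integral>x. f1 x * u x \<partial>lebesgue_on cube)"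
    proof (rule integral_cong_AE)
      show "(\<lambda>x. f x * u x) \<in> borel_measurable (lebesgue_on cube)"
        using f(1) borel_measurable_lebesgue_on_cube[OF u] by (rule borel_measurable_times)
      show "(\<lambda>x. f1 x * u x) \<in> borel_measurable (lebesgue_on cube)"
        using borel_measurable_lebesgue_on_cube[OF f1L] borel_measurable_lebesgue_on_cube[OF u]
        by (rule borel_measurable_times)
      show "AE x in lebesgue_on cube. f x * u x = f1 x * u x" using ae by eventually_elim simp
    qed
    also have "\<dots> = (\<integral>x. f1 x * u x \<partial>lcube)"
      using f1L u by (intro integral_lebesgue_on_cube borel_measurable_times)
    finally show "(\<integral>x. f x * u x \<partial>lebesgue_on cube) = (\<integral>x. f1 x * u x \<partial>lcube)" .
  qed (auto simp: f1_def)
qed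

lemma integral_lborel_affine:
  fixes \<psi> :: "'a::euclidean_space \<Rightarrow> 'b::{banach, second_countable_topology}"
  assumes "\<psi> \<in> borel_measurable borel" "c > 0"
  shows "(\<integral>x. \<psi> x \<partial>lborel) = (c ^ DIM('a)) *\<^sub>R (\<integral>x. \<psi> (t + c *\<^sub>R x) \<partial>lborel)"
proof -
  have "(\<integral>x. \<psi> x \<partial>lborel) = (\<integral>x. \<psi> x \<partial>density (distr lborel borel (\<lambda>x. t + c *\<^sub>R x)) (\<lambda>_. ennreal (c ^ DIM('a))))"
    using lborel_affine[of c t] assms(2) by (simp add: ennreal_power)
  also have "\<dots> = (\<integral>x. (c ^ DIM('a)) *\<^sub>R \<psi> x \<partial>distr lborel borel (\<lambda>x. t + c *\<^sub>R x))"
    using assms by (subst integral_density) auto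
  also have "\<dots> = (\<integral>x. (c ^ DIM('a)) *\<^sub>R \<psi> (t + c *\<^sub>R x) \<partial>lborel)"
    using assms by (intro integral_distr) auto
  finally show ?thesis by simp
qed

text \<open>Scaling by \<open>c > 0\<close> and translating pull null sets back to null sets, and no
  point of the cube is moved out of it.\<close>

lemma AE_cube_affine:
  fixes t :: "real ^ 'd"
  assumes "AE x in lcube. P x" "c > 0" "\<And>y. y \<in> cube \<Longrightarrow> t + c *\<^sub>R y \<in> cube"
  shows "AE y in lcube. P (t + c *\<^sub>R y)"
proof -
  have "AE x in lborel. x \<in> cube \<longrightarrow> P x" using assms(1) by (simp add: AE_restrict_space_iff)
  \<comment> \<open>The exceptional set is enlarged to a Borel null set, so that image measures can
    be applied to it.\<close>
  then obtain N where N: "N \<in> sets lborel" "emeasure lborel N = 0" "{x \<in> space lborel. \<not> (x \<in> cube \<longrightarrow> P x)} \<subseteq> N"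
    by (rule AE_E) blast
  then have "AE x in lborel. x \<notin> N" by (intro AE_not_in) (simp add: null_sets_def)
  then have "AE x in density (distr lborel borel (\<lambda>x. t + c *\<^sub>R x)) (\<lambda>_. \<bar>c\<bar> ^ DIM(real ^ 'd)). x \<notin> N"
    using lborel_affine[of c t] assms(2) by (metis less_irrefl)
  then have "AE x in distr lborel borel (\<lambda>x. t + c *\<^sub>R x). x \<notin> N"
    using assms(2) by (simp add: AE_density)
  then have "AE x in lborel. t + c *\<^sub>R x \<notin> N"
    using N(1) by (subst (asm) AE_distr_iff) auto
  then have "AE x in lborel. x \<in> cube \<longrightarrow> P (t + c *\<^sub>R x)"
    by eventually_elim (use N(3) assms(3) in auto)
  then show ?thesis by (simp add: AE_restrict_space_iff)
qed

text \<open>After substitution the left side is the integral over the image of the cube, a part of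
  the cube; the factor is the Jacobian. Nonnegativity of \<open>g\<close> discards the rest.\<close>

lemma integral_cube_affine_le:
  fixes g :: "real ^ 'd \<Rightarrow> real"
  assumes g: "g \<in> borel_measurable lcube" "\<And>x. x \<in> cube \<Longrightarrow> 0 \<le> g x" "\<And>x. x \<in> cube \<Longrightarrow> g x \<le> B"
    and c: "c > 0" and t: "\<And>y. y \<in> cube \<Longrightarrow> t + c *\<^sub>R y \<in> cube"
  shows "c ^ CARD('d) * (\<integral>x. g (t + c *\<^sub>R x) \<partial>lcube) \<le> (\<integral>x. g x \<partial>lcube)"
proof -
  define g' where "g' x = indicator cube x *\<^sub>R g x" for x
  have m: "g' \<in> borel_measurable borel" unfolding g'_def by (rule borel_measurable_cube_extend[OF g(1)])
  have "integrable lcube g"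
    by (rule integrable_bounded[OF _ g(1), of B]) (use g in \<open>auto simp: space_lcube lcube.finite_measure_axioms\<close>)
  then have int: "integrable lborel g'" unfolding g'_def by (simp add: integrable_restrict_space)
  have int': "integrable lborel (\<lambda>x. g' (t + c *\<^sub>R x))"
  proof -
    have "integrable (density (distr lborel borel (\<lambda>x. t + c *\<^sub>R x)) (\<lambda>_. ennreal (c ^ DIM(real ^ 'd)))) g'"
      using lborel_affine[of c t] int c by (simp add: ennreal_power)
    then have "integrable (distr lborel borel (\<lambda>x. t + c *\<^sub>R x)) (\<lambda>x. (c ^ DIM(real ^ 'd)) *\<^sub>R g' x)"
      using m c by (subst (asm) integrable_density) auto
    then have "integrable lborel (\<lambda>x. (c ^ DIM(real ^ 'd)) *\<^sub>R g' (t + c *\<^sub>R x))"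
      using m by (subst (asm) integrable_distr_eq) auto
    then show ?thesis using c by simp
  qed
  have "(\<integral>x. g (t + c *\<^sub>R x) \<partial>lcube) = (\<integral>x. indicator cube x *\<^sub>R g' (t + c *\<^sub>R x) \<partial>lborel)"
    unfolding integral_lcube by (rule Bochner_Integration.integral_cong) (auto simp: g'_def indicator_def t)
  also have "\<dots> \<le> (\<integral>x. g' (t + c *\<^sub>R x) \<partial>lborel)"
    using int' g(2) by (intro integral_mono integrable_mult_indicator) (auto simp: g'_def indicator_def)
  finally have "c ^ CARD('d) * (\<integral>x. g (t + c *\<^sub>R x) \<partial>lcube) \<le> c ^ CARD('d) * (\<integral>x. g' (t + c *\<^sub>R x) \<partial>lborel)"
    using c by simp
  also have "\<dots> = (\<integral>x. g x \<partial>lcube)"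
    using integral_lborel_affine[OF m c, of t] by (simp add: integral_lcube g'_def)
  finally show ?thesis .
qed

text \<open>Jensen's inequality for a probability density, proved by expanding the nonnegative
  variance around the mean \<open>p\<close>.\<close>

lemma weighted_norm_integral_square_le:
  fixes h :: "'a \<Rightarrow> 'b::euclidean_space"
  assumes K: "\<And>x. x \<in> space M \<Longrightarrow> 0 \<le> K x" "integrable M K" "(\<integral>x. K x \<partial>M) = 1"
    and h: "integrable M (\<lambda>x. K x *\<^sub>R h x)" "integrable M (\<lambda>x. K x * (norm (h x))\<^sup>2)"
  shows "(norm (\<integral>x. K x *\<^sub>R h x \<partial>M))\<^sup>2 \<le> (\<integral>x. K x * (norm (h x))\<^sup>2 \<partial>M)"
proof -
  define p where "p = (\<integral>x. K x *\<^sub>R h x \<partial>M)"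
  have eq: "K x * (norm (h x - p))\<^sup>2 = K x * (norm (h x))\<^sup>2 - 2 * ((K x *\<^sub>R h x) \<bullet> p) + (norm p)\<^sup>2 * K x" for x
    by (simp add: power2_norm_eq_inner inner_diff_left inner_diff_right inner_commute algebra_simps)
  have ip: "integrable M (\<lambda>x. (K x *\<^sub>R h x) \<bullet> p)"
    "(\<integral>x. (K x *\<^sub>R h x) \<bullet> p \<partial>M) = p \<bullet> p"
    using integrable_inner_left[of p M, OF h(1)] integral_inner_left[of p M, OF h(1)] by (simp_all only: p_def)
  have "0 \<le> (\<integral>x. K x * (norm (h x - p))\<^sup>2 \<partial>M)"
    using K(1) by (intro Bochner_Integration.integral_nonneg) auto
  also have "\<dots> = (\<integral>x. K x * (norm (h x))\<^sup>2 \<partial>M) - 2 * (p \<bullet> p) + (norm p)\<^sup>2 * 1"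
  proof -
    have "(\<integral>x. A x - 2 * B x + c * K x \<partial>M) = (\<integral>x. A x \<partial>M) - 2 * (\<integral>x. B x \<partial>M) + c * (\<integral>x. K x \<partial>M)"
      if "integrable M A" "integrable M B" for A B :: "'a \<Rightarrow> real" and c
      using that K(2) by simp
    from this[OF h(2) ip(1)] show ?thesis unfolding eq by (simp only: ip(2) K(3))
  qed
  finally show ?thesis by (simp add: p_def power2_norm_eq_inner)
qed

text \<open>Only a.e. differentiability of the Lipschitz function \<open>u\<close> is needed: the exceptional set may
  depend on the time \<open>t\<^sub>0\<close>, because dominated convergence is applied at \<open>t\<^sub>0\<close> only.\<close>

lemma has_real_derivative_integral_along_lines:
  fixes u :: "real ^ 'd \<Rightarrow> real" and \<alpha> \<beta> :: "'a \<Rightarrow> real ^ 'd"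
  assumes M: "finite_measure M" and G: "G \<in> borel_measurable M" "\<And>\<omega>. \<omega> \<in> space M \<Longrightarrow> \<bar>G \<omega>\<bar> \<le> F"
    and u: "L-lipschitz_on cube u" and grad: "grad u \<in> borel_measurable lcube"
    and \<alpha>[measurable]: "\<alpha> \<in> borel_measurable M" and \<beta>[measurable]: "\<beta> \<in> borel_measurable M"
    and \<beta>_le: "\<And>\<omega>. \<omega> \<in> space M \<Longrightarrow> norm (\<beta> \<omega>) \<le> b"
    and in_cube: "\<And>\<omega> t. \<omega> \<in> space M \<Longrightarrow> t \<in> {0..1} \<Longrightarrow> \<alpha> \<omega> + t *\<^sub>R \<beta> \<omega> \<in> cube"
    and t0: "t0 \<in> {0..1}"
    and diff: "AE \<omega> in M. (u has_derivative (\<lambda>h. grad u (\<alpha> \<omega> + t0 *\<^sub>R \<beta> \<omega>) \<bullet> h)) (at (\<alpha> \<omega> + t0 *\<^sub>R \<beta> \<omega>))"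
  shows "((\<lambda>t. \<integral>\<omega>. G \<omega> * u (\<alpha> \<omega> + t *\<^sub>R \<beta> \<omega>) \<partial>M) has_real_derivative
      (\<integral>\<omega>. G \<omega> * (grad u (\<alpha> \<omega> + t0 *\<^sub>R \<beta> \<omega>) \<bullet> \<beta> \<omega>) \<partial>M)) (at t0 within {0..1})"
proof (cases "space M = {}")
  case True
  then show ?thesis by (simp add: Bochner_Integration.integral_empty)
next
  case False
  then obtain \<omega>0 where \<omega>0: "\<omega>0 \<in> space M" by blast
  define \<gamma> where "\<gamma> t \<omega> = \<alpha> \<omega> + t *\<^sub>R \<beta> \<omega>" for t \<omega>
  have F0: "0 \<le> F" using G(2)[OF \<omega>0] by simp
  have L0: "0 \<le> L" using u by (rule lipschitz_on_nonneg)
  have \<gamma>m: "\<gamma> t \<in> measurable M lcube" if "t \<in> {0..1}" for t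
    unfolding \<gamma>_def using in_cube that
    by (intro measurable_restrict_space2) auto
  have um: "u \<in> borel_measurable lcube"
    using u by (intro borel_measurable_continuous_cube lipschitz_on_continuous_on)
  have u\<gamma>[measurable]: "(\<lambda>\<omega>. u (\<gamma> t \<omega>)) \<in> borel_measurable M" if "t \<in> {0..1}" for t
    using measurable_compose[OF \<gamma>m[OF that] um] .
  have g\<gamma>: "(\<lambda>\<omega>. grad u (\<gamma> t0 \<omega>)) \<in> borel_measurable M"
    using measurable_compose[OF \<gamma>m[OF t0] grad] .
  have u_diff: "\<bar>u (\<gamma> t \<omega>) - u (\<gamma> t' \<omega>)\<bar> \<le> L * (b * \<bar>t - t'\<bar>)"
    if "t \<in> {0..1}" "t' \<in> {0..1}" "\<omega> \<in> space M" for t t' \<omega>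
  proof -
    have "\<bar>u (\<gamma> t \<omega>) - u (\<gamma> t' \<omega>)\<bar> \<le> L * norm (\<gamma> t \<omega> - \<gamma> t' \<omega>)"
      using lipschitz_onD[OF u, of "\<gamma> t \<omega>" "\<gamma> t' \<omega>"] in_cube that by (simp add: \<gamma>_def dist_norm)
    also have "\<gamma> t \<omega> - \<gamma> t' \<omega> = (t - t') *\<^sub>R \<beta> \<omega>" by (simp add: \<gamma>_def algebra_simps)
    also have "L * norm ((t - t') *\<^sub>R \<beta> \<omega>) \<le> L * (b * \<bar>t - t'\<bar>)"
      using mult_right_mono[OF \<beta>_le[OF that(3)], of "\<bar>t - t'\<bar>"] L0
      by (intro mult_left_mono) (simp_all add: mult.commute)
    finally show ?thesis .
  qed
  obtain B where B: "\<And>x. x \<in> cube \<Longrightarrow> \<bar>u x\<bar> \<le> B"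
    using bounded_uniformly_continuous_image[OF lipschitz_on_uniformly_continuous[OF u] bounded_cube]
    unfolding bounded_iff by auto
  have int: "integrable M (\<lambda>\<omega>. G \<omega> * u (\<gamma> t \<omega>))" if t: "t \<in> {0..1}" for t
  proof (rule integrable_bounded[OF M])
    show "(\<lambda>\<omega>. G \<omega> * u (\<gamma> t \<omega>)) \<in> borel_measurable M" using G(1) u\<gamma>[OF t] by (rule borel_measurable_times)
    fix \<omega> assume \<omega>: "\<omega> \<in> space M"
    then have "\<bar>u (\<gamma> t \<omega>)\<bar> \<le> B" using B in_cube t by (simp add: \<gamma>_def)
    then show "norm (G \<omega> * u (\<gamma> t \<omega>)) \<le> F * B"
      using G(2)[OF \<omega>] F0 by (auto simp: abs_mult intro!: mult_mono)
  qed
  show ?thesis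
    unfolding has_field_derivative_iff tendsto_at_iff_sequentially \<gamma>_def[symmetric]
  proof (intro allI impI)
    fix X :: "nat \<Rightarrow> real" assume X: "\<forall>i. X i \<in> {0..1} - {t0}" "X \<longlonglongrightarrow> t0"
    have Xi: "X i \<in> {0..1}" "X i \<noteq> t0" for i using X(1) by auto
    define q where "q i \<omega> = G \<omega> * ((u (\<gamma> (X i) \<omega>) - u (\<gamma> t0 \<omega>)) / (X i - t0))" for i \<omega>
    have "(\<lambda>i. \<integral>\<omega>. q i \<omega> \<partial>M) \<longlonglongrightarrow> (\<integral>\<omega>. G \<omega> * (grad u (\<gamma> t0 \<omega>) \<bullet> \<beta> \<omega>) \<partial>M)"
    \<comment> \<open>The Lipschitz bound on \<open>u\<close> makes all difference quotients at most
      \<open>L * b\<close>, which gives the constant majorant.\<close>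
    proof (rule integral_dominated_convergence[where w="\<lambda>_. F * (L * b)"])
      show "(\<lambda>\<omega>. G \<omega> * (grad u (\<gamma> t0 \<omega>) \<bullet> \<beta> \<omega>)) \<in> borel_measurable M"
        using G(1) g\<gamma> \<beta> by (intro borel_measurable_times borel_measurable_inner)
      show "q i \<in> borel_measurable M" for i
        unfolding q_def using G(1) u\<gamma>[OF Xi(1)] u\<gamma>[OF t0]
        by (intro borel_measurable_times borel_measurable_divide borel_measurable_diff borel_measurable_const)
      show "integrable M (\<lambda>_. F * (L * b))" using M by (simp add: finite_measure.integrable_const)
      show "AE \<omega> in M. norm (q i \<omega>) \<le> F * (L * b)" for i
      proof (rule AE_I2)
        fix \<omega> assume \<omega>: "\<omega> \<in> space M"
        have "\<bar>(u (\<gamma> (X i) \<omega>) - u (\<gamma> t0 \<omega>)) / (X i - t0)\<bar> \<le> L * b"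
          using u_diff[OF Xi(1) t0 \<omega>, of i] Xi(2)[of i] by (simp add: abs_divide pos_divide_le_eq mult_ac)
        then show "norm (q i \<omega>) \<le> F * (L * b)"
          unfolding q_def real_norm_def abs_mult using G(2)[OF \<omega>] F0 by (intro mult_mono) auto
      qed
      show "AE \<omega> in M. (\<lambda>i. q i \<omega>) \<longlonglongrightarrow> G \<omega> * (grad u (\<gamma> t0 \<omega>) \<bullet> \<beta> \<omega>)"
        using diff
      proof (eventually_elim)
        fix \<omega> assume d: "(u has_derivative (\<lambda>h. grad u (\<alpha> \<omega> + t0 *\<^sub>R \<beta> \<omega>) \<bullet> h)) (at (\<alpha> \<omega> + t0 *\<^sub>R \<beta> \<omega>))"
        have "((\<lambda>t. \<alpha> \<omega> + t *\<^sub>R \<beta> \<omega>) has_derivative (\<lambda>t. t *\<^sub>R \<beta> \<omega>)) (at t0 within {0..1})"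
          by (auto intro!: derivative_eq_intros)
        from has_derivative_compose[OF this d]
        have "((\<lambda>t. u (\<gamma> t \<omega>)) has_real_derivative grad u (\<gamma> t0 \<omega>) \<bullet> \<beta> \<omega>) (at t0 within {0..1})"
          unfolding has_field_derivative_def \<gamma>_def by (simp add: mult.commute[of _ "grad u _ \<bullet> _"])
        then have "(\<lambda>i. (u (\<gamma> (X i) \<omega>) - u (\<gamma> t0 \<omega>)) / (X i - t0)) \<longlonglongrightarrow> grad u (\<gamma> t0 \<omega>) \<bullet> \<beta> \<omega>"
          using X unfolding has_field_derivative_iff tendsto_at_iff_sequentially by (auto simp: comp_def)
        then show "(\<lambda>i. q i \<omega>) \<longlonglongrightarrow> G \<omega> * (grad u (\<gamma> t0 \<omega>) \<bullet> \<beta> \<omega>)"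
          unfolding q_def by (rule tendsto_mult_left)
      qed
    qed
    moreover have "(\<integral>\<omega>. q i \<omega> \<partial>M) = ((\<integral>\<omega>. G \<omega> * u (\<gamma> (X i) \<omega>) \<partial>M) - (\<integral>\<omega>. G \<omega> * u (\<gamma> t0 \<omega>) \<partial>M)) / (X i - t0)" for i
    proof -
      have "q i = (\<lambda>\<omega>. (G \<omega> * u (\<gamma> (X i) \<omega>) - G \<omega> * u (\<gamma> t0 \<omega>)) / (X i - t0))"
        unfolding q_def by (auto simp: right_diff_distrib)
      then show ?thesis using int[OF Xi(1)] int[OF t0] by simp
    qed
    ultimately show "((\<lambda>t. ((\<integral>\<omega>. G \<omega> * u (\<gamma> t \<omega>) \<partial>M) - (\<integral>\<omega>. G \<omega> * u (\<gamma> t0 \<omega>) \<partial>M)) / (t - t0)) \<circ> X)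
        \<longlonglongrightarrow> (\<integral>\<omega>. G \<omega> * (grad u (\<gamma> t0 \<omega>) \<bullet> \<beta> \<omega>) \<partial>M)"
      by (simp add: comp_def)
  qed
qed

section \<open>Mollification inside the cube\<close>

lemma Fubini_bounded:
  fixes h :: "'a \<Rightarrow> 'b \<Rightarrow> real"
  assumes M: "finite_measure M" and N: "finite_measure N"
    and h: "case_prod h \<in> borel_measurable (M \<Otimes>\<^sub>M N)"
    and B: "\<And>x y. x \<in> space M \<Longrightarrow> y \<in> space N \<Longrightarrow> \<bar>h x y\<bar> \<le> B"
  shows "(\<integral>y. (\<integral>x. h x y \<partial>M) \<partial>N) = (\<integral>x. (\<integral>y. h x y \<partial>N) \<partial>M)"
    "integrable M (\<lambda>x. \<integral>y. h x y \<partial>N)" "integrable N (\<lambda>y. \<integral>x. h x y \<partial>M)"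
proof -
  interpret M: finite_measure M by fact
  interpret N: finite_measure N by fact
  interpret pair_sigma_finite M N ..
  have int: "integrable (M \<Otimes>\<^sub>M N) (case_prod h)"
    by (rule integrable_bounded[OF finite_measure_pair_measure[OF N M] h, of B])
       (use B in \<open>auto simp: space_pair_measure\<close>)
  show "(\<integral>y. (\<integral>x. h x y \<partial>M) \<partial>N) = (\<integral>x. (\<integral>y. h x y \<partial>N) \<partial>M)" by (rule Fubini_integral[OF int])
  show "integrable M (\<lambda>x. \<integral>y. h x y \<partial>N)" "integrable N (\<lambda>y. \<integral>x. h x y \<partial>M)"
    using integrable_fst[OF int] integrable_snd[OF int] by simp_all
qed

text \<open>The density is the normalised distance to the complement of the cube: it has Lipschitz
  constant 1 before normalisation, is positive exactly on the cube and vanishes outside.\<close>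

lemma exists_lipschitz_cube_density:
  obtains k :: "real ^ 'd \<Rightarrow> real" and B where "\<And>y. 0 \<le> k y" "\<And>y. k y \<le> B" "\<And>y. y \<notin> cube \<Longrightarrow> k y = 0"
    "\<And>x y. \<bar>k x - k y\<bar> \<le> B * norm (x - y)" "(\<integral>y. k y \<partial>lcube) = 1"
proof -
  let ?A = "- cube :: (real ^ 'd) set"
  define i where "i y = infdist y ?A" for y :: "real ^ 'd"
  have z: "(0 :: real ^ 'd) \<in> ?A" by (simp add: cube_def)
  have cl: "closed ?A" using open_cube by (simp add: closed_def)
  have i0: "i y = 0" if "y \<notin> cube" for y using that by (simp add: i_def)
  have ipos: "0 < i y" if "y \<in> cube" for y
    unfolding i_def using cl z that by (intro infdist_pos_not_in_closed) auto
  have i_nonneg: "0 \<le> i y" for y by (simp add: i_def infdist_nonneg)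
  have lip: "\<bar>i x - i y\<bar> \<le> norm (x - y)" for x y
    using infdist_triangle_abs[of x ?A y] by (simp add: i_def dist_norm)
  have i_le: "i y \<le> real CARD('d)" for y
  proof (cases "y \<in> cube")
    case True
    have "i y \<le> norm (y - 0)" using lip[of y 0] i0[of 0] z by simp
    also have "\<dots> \<le> real CARD('d)"
      by (intro closure_cube_dist cube_subset_closure[OF True]) (simp add: closure_cube_iff)
    finally show ?thesis .
  qed (simp add: i0)
  have im: "i \<in> borel_measurable lcube"
    unfolding i_def by (intro borel_measurable_continuous_cube continuous_intros)
  have iint: "integrable lcube i"
    by (rule integrable_bounded[OF _ im, of "real CARD('d)"])
       (use i_le i_nonneg in \<open>auto simp: lcube.finite_measure_axioms\<close>)
  define Z where "Z = (\<integral>y. i y \<partial>lcube)"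
  have "Z \<noteq> 0"
  proof
    assume "Z = 0"
    then have "AE y in lcube. i y = 0"
      using integral_nonneg_eq_0_iff_AE[OF iint] i_nonneg unfolding Z_def by simp
    moreover have "AE y in lcube. i y \<noteq> 0"
      by (rule AE_I2) (use ipos in \<open>force simp: space_lcube\<close>)
    ultimately have "AE y in lcube. y \<notin> (cube :: (real ^ 'd) set)" by eventually_elim simp
    then have "(cube :: (real ^ 'd) set) \<in> null_sets lcube"
      by (subst AE_iff_null_sets) (simp add: sets_restrict_space_iff)
    then show False using emeasure_lcube[where 'd='d] by (simp add: null_sets_def)
  qed
  moreover have "0 \<le> Z" unfolding Z_def using i_nonneg by simp
  ultimately have Z: "Z > 0" by simp
  show thesis
  \<comment> \<open>One constant serves as height and as slope: \<open>CARD('d)\<close> bounds the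
    distance function and 1 its Lipschitz constant.\<close>
  proof (rule that[of "\<lambda>y. i y / Z" "max 1 (real CARD('d)) / Z"])
    fix x y :: "real ^ 'd"
    show "0 \<le> i y / Z" using i_nonneg Z by simp
    show "i y / Z \<le> max 1 (real CARD('d)) / Z" using i_le[of y] Z by (intro divide_right_mono) auto
    show "i y / Z = 0" if "y \<notin> cube" using i0[OF that] by simp
    have "\<bar>i x / Z - i y / Z\<bar> = \<bar>i x - i y\<bar> / Z" using Z by (simp add: diff_divide_distrib[symmetric])
    also have "\<dots> \<le> norm (x - y) / Z" using lip[of x y] Z by (simp add: divide_right_mono)
    also have "\<dots> \<le> max 1 (real CARD('d)) / Z * norm (x - y)"
      using Z mult_right_mono[of 1 "max 1 (real CARD('d))" "norm (x - y)"] by (simp add: divide_right_mono)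
    finally show "\<bar>i x / Z - i y / Z\<bar> \<le> max 1 (real CARD('d)) / Z * norm (x - y)" .
  next
    show "(\<integral>y. i y / Z \<partial>lcube) = 1" using Z by (simp add: Z_def)
  qed
qed

text \<open>\<open>K x\<close> is the density of \<open>(1 - s) x + s y\<close> for \<open>y\<close> distributed according to \<open>k\<close>. Since the cube
  is convex, this mollification does not leave the cube.\<close>

locale cube_kernel =
  fixes k :: "real ^ 'd \<Rightarrow> real" and B s :: real
  assumes k_nonneg: "0 \<le> k y" and k_le: "k y \<le> B" and k_outside: "y \<notin> cube \<Longrightarrow> k y = 0"
    and k_lipschitz: "\<bar>k x - k y\<bar> \<le> B * norm (x - y)"
    and integral_k: "(\<integral>y. k y \<partial>lcube) = 1"
    and s_pos: "0 < s" and s_le: "s \<le> 1/2"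
begin

definition K :: "real ^ 'd \<Rightarrow> real ^ 'd \<Rightarrow> real" where
  "K x z = k ((1 / s) *\<^sub>R (z - (1 - s) *\<^sub>R x)) / s ^ CARD('d)"

text \<open>Bounds both \<open>K\<close> and its slope: rescaling to size \<open>s\<close> costs one
  factor \<open>1 / s\<close> per dimension for the height and one more for the slope, and
  \<open>s\<close> is below 1.\<close>

definition C :: real where "C = B / s ^ Suc (CARD('d))"

lemma B_nonneg: "0 \<le> B"
  using k_nonneg k_le order_trans by blast

lemma C_nonneg: "0 \<le> C"
  using B_nonneg s_pos by (simp add: C_def)

lemma continuous_k: "continuous_on UNIV k"
proof -
  have "B-lipschitz_on UNIV k"
    using k_lipschitz B_nonneg by (intro lipschitz_onI) (auto simp: dist_norm)
  then show ?thesis by (rule lipschitz_on_continuous_on)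
qed

lemma k_measurable: "k \<in> borel_measurable lcube"
  using continuous_k continuous_on_subset by (intro borel_measurable_continuous_cube) blast

lemma K_nonneg: "0 \<le> K x z"
  using k_nonneg s_pos by (simp add: K_def)

lemma K_le: "K x z \<le> C"
proof -
  have "K x z \<le> B / s ^ CARD('d)"
    using k_le s_pos by (simp add: K_def divide_right_mono)
  also have "\<dots> \<le> B / s ^ Suc (CARD('d))"
    using B_nonneg s_pos s_le power_Suc_le_self[of s "CARD('d)"] by (intro divide_left_mono) auto
  finally show ?thesis by (simp add: C_def)
qed

lemma K_abs_le: "\<bar>K x z\<bar> \<le> C"
  using K_nonneg K_le by simp

lemma K_lipschitz:
  "\<bar>K x z - K x' z'\<bar> \<le> C * norm ((z - (1 - s) *\<^sub>R x) - (z' - (1 - s) *\<^sub>R x'))"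
proof -
  let ?a = "(1 / s) *\<^sub>R (z - (1 - s) *\<^sub>R x)" and ?b = "(1 / s) *\<^sub>R (z' - (1 - s) *\<^sub>R x')"
  have "\<bar>K x z - K x' z'\<bar> = \<bar>k ?a - k ?b\<bar> / s ^ CARD('d)"
    using s_pos by (simp add: K_def diff_divide_distrib[symmetric])
  also have "\<dots> \<le> B * norm (?a - ?b) / s ^ CARD('d)"
    using k_lipschitz[of ?a ?b] s_pos by (intro divide_right_mono) auto
  also have "?a - ?b = (1 / s) *\<^sub>R ((z - (1 - s) *\<^sub>R x) - (z' - (1 - s) *\<^sub>R x'))"
    by (simp only: scaleR_diff_right)
  also have "B * norm ((1 / s) *\<^sub>R e) / s ^ CARD('d) = C * norm e" for e :: "real ^ 'd"
    using s_pos by (simp add: C_def)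
  finally show ?thesis .
qed

lemma K_lipschitz_left: "\<bar>K x z - K x' z\<bar> \<le> C * norm (x - x')"
proof -
  have "\<bar>K x z - K x' z\<bar> \<le> C * norm ((z - (1 - s) *\<^sub>R x) - (z - (1 - s) *\<^sub>R x'))" by (rule K_lipschitz)
  also have "(z - (1 - s) *\<^sub>R x) - (z - (1 - s) *\<^sub>R x') = (1 - s) *\<^sub>R (x' - x)" by (simp add: algebra_simps)
  also have "C * norm ((1 - s) *\<^sub>R (x' - x)) \<le> C * norm (x - x')"
    using s_pos s_le C_nonneg by (intro mult_left_mono) (auto simp: norm_minus_commute mult_left_le_one_le)
  finally show ?thesis .
qed

lemma K_lipschitz_right: "\<bar>K x z - K x z'\<bar> \<le> C * norm (z - z')"
  using K_lipschitz[of x z x z'] by simp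

lemma K_measurable [measurable]:
  assumes [measurable]: "a \<in> borel_measurable M" "b \<in> borel_measurable M"
  shows "(\<lambda>\<omega>. K (a \<omega>) (b \<omega>)) \<in> borel_measurable M"
proof (rule borel_measurable_continuous_Pair[OF assms])
  have "continuous_on UNIV (k \<circ> (\<lambda>x. (1 / s) *\<^sub>R (snd x - (1 - s) *\<^sub>R fst x)))"
    by (intro continuous_on_compose continuous_intros continuous_on_subset[OF continuous_k]) auto
  then show "continuous_on UNIV (\<lambda>x. K (fst x) (snd x))"
    unfolding K_def comp_def using s_pos by (intro continuous_intros) auto
qed

lemma id_cube_measurable [measurable]: "(\<lambda>x. x) \<in> borel_measurable lcube"
  by (intro borel_measurable_continuous_cube continuous_intros)

lemma mix_in_cube: "x \<in> closure cube \<Longrightarrow> y \<in> cube \<Longrightarrow> (1 - s) *\<^sub>R x + s *\<^sub>R y \<in> cube"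
  using s_pos s_le by (intro cube_mix) auto

text \<open>Substitution \<open>z = (1 - s) x + s y\<close>. The Jacobian cancels the normalisation
  in \<open>K\<close>, and no mass is lost since the support of \<open>k\<close> is mapped into the
  cube.\<close>

lemma integral_K:
  fixes \<psi> :: "real ^ 'd \<Rightarrow> 'b::{banach, second_countable_topology}"
  assumes x: "x \<in> closure cube" and \<psi>: "\<psi> \<in> borel_measurable lcube"
  shows "(\<integral>z. K x z *\<^sub>R \<psi> z \<partial>lcube) = (\<integral>y. k y *\<^sub>R \<psi> ((1 - s) *\<^sub>R x + s *\<^sub>R y) \<partial>lcube)"
proof -
  define \<Psi> where "\<Psi> z = indicator cube z *\<^sub>R (K x z *\<^sub>R \<psi> z)" for z
  have m: "\<Psi> \<in> borel_measurable borel"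
    unfolding \<Psi>_def
    by (intro borel_measurable_cube_extend borel_measurable_scaleR K_measurable id_cube_measurable \<psi>) simp
  \<comment> \<open>For \<open>y\<close> outside the cube both sides are zero, because
    \<open>k\<close> vanishes there.\<close>
  have "s ^ CARD('d) *\<^sub>R \<Psi> ((1 - s) *\<^sub>R x + s *\<^sub>R y) = indicator cube y *\<^sub>R (k y *\<^sub>R \<psi> ((1 - s) *\<^sub>R x + s *\<^sub>R y))" for y
    using mix_in_cube[OF x, of y] k_outside[of y] s_pos by (cases "y \<in> cube") (auto simp: \<Psi>_def K_def)
  then have "(\<integral>y. k y *\<^sub>R \<psi> ((1 - s) *\<^sub>R x + s *\<^sub>R y) \<partial>lcube)
      = (\<integral>y. s ^ CARD('d) *\<^sub>R \<Psi> ((1 - s) *\<^sub>R x + s *\<^sub>R y) \<partial>lborel)"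
    by (simp add: integral_lcube)
  also have "\<dots> = (\<integral>z. \<Psi> z \<partial>lborel)"
    using integral_lborel_affine[OF m s_pos, of "(1 - s) *\<^sub>R x"] by simp
  finally show ?thesis by (simp add: integral_lcube \<Psi>_def)
qed

lemma integral_K_eq_1: "x \<in> closure cube \<Longrightarrow> (\<integral>z. K x z \<partial>lcube) = 1"
  using integral_K[of x "\<lambda>_. 1 :: real"] integral_k by simp

text \<open>If the kernel is nonzero then \<open>z - x = s (y - x)\<close> with \<open>y\<close> in
  the cube, so mollification moves mass by at most \<open>s\<close> times the diameter
  bound.\<close>

lemma K_support:
  assumes "x \<in> closure cube" "K x z \<noteq> 0"
  shows "norm (z - x) \<le> s * real CARD('d)"
proof -
  let ?y = "(1 / s) *\<^sub>R (z - (1 - s) *\<^sub>R x)"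
  have "?y \<in> cube" using assms(2) k_outside[of ?y] unfolding K_def by fastforce
  then have "norm (?y - x) \<le> real CARD('d)"
    by (intro closure_cube_dist cube_subset_closure[of ?y] assms(1))
  moreover have "z - x = s *\<^sub>R (?y - x)" using s_pos by (simp add: algebra_simps)
  ultimately show ?thesis using s_pos by simp
qed

end

text \<open>Collects what is used of a fine competitor. The numbers \<open>L\<close> and
  \<open>G\<close> depend on its mesh; they serve integrability and differentiation under the
  integral, and appear in no resulting estimate.\<close>

locale mollified = cube_kernel k B s for k :: "real ^ 'd \<Rightarrow> real" and B s +
  fixes u :: "real ^ 'd \<Rightarrow> real" and L G :: real
  assumes u_lipschitz: "L-lipschitz_on cube u"
    and grad_measurable: "grad u \<in> borel_measurable lcube"
    and grad_le: "x \<in> cube \<Longrightarrow> norm (grad u x) \<le> G"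
    and AE_derivative: "AE x in lcube. (u has_derivative (\<lambda>h. grad u x \<bullet> h)) (at x)"
begin

definition N1 :: real where "N1 = (\<integral>z. norm (grad u z) \<partial>lcube)"
definition N2 :: real where "N2 = (\<integral>z. (norm (grad u z))\<^sup>2 \<partial>lcube)"
text \<open>Up to the factor \<open>1 - s\<close> this is the gradient of \<open>v\<close>. It is
  written with the kernel, so that its dependence on \<open>x\<close> sits in the Lipschitz function
  \<open>K\<close>; \<open>v\<close> is written over \<open>y\<close>, so that derivatives fall on
  \<open>u\<close>.\<close>

definition p :: "real ^ 'd \<Rightarrow> real ^ 'd" where "p x = (\<integral>z. K x z *\<^sub>R grad u z \<partial>lcube)"
definition v :: "real ^ 'd \<Rightarrow> real" where "v x = (\<integral>y. k y * u ((1 - s) *\<^sub>R x + s *\<^sub>R y) \<partial>lcube)"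

lemma u_measurable: "u \<in> borel_measurable lcube"
  using u_lipschitz by (intro borel_measurable_continuous_cube lipschitz_on_continuous_on)

lemma u_bounded: "\<exists>U. \<forall>x\<in>cube. \<bar>u x\<bar> \<le> U"
  using bounded_uniformly_continuous_image[OF lipschitz_on_uniformly_continuous[OF u_lipschitz] bounded_cube]
  unfolding bounded_iff by auto

lemma integrable_norm_grad: "integrable lcube (\<lambda>z. norm (grad u z))"
  by (rule integrable_bounded[where B=G])
     (use grad_measurable grad_le in \<open>auto simp: space_lcube lcube.finite_measure_axioms\<close>)

lemma integrable_norm_grad_square: "integrable lcube (\<lambda>z. (norm (grad u z))\<^sup>2)"
  by (rule integrable_bounded[where B="G\<^sup>2"])
     (use grad_measurable grad_le in \<open>auto simp: space_lcube lcube.finite_measure_axioms intro!: power_mono\<close>)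

lemma integrable_K: "integrable lcube (K x)"
  by (rule integrable_bounded[where B=C])
     (use K_abs_le in \<open>auto simp: space_lcube lcube.finite_measure_axioms\<close>)

lemma integrable_K_grad: "integrable lcube (\<lambda>z. K x z *\<^sub>R grad u z)"
proof (rule integrable_bounded[where B="C * G"])
  show "(\<lambda>z. K x z *\<^sub>R grad u z) \<in> borel_measurable lcube"
    using grad_measurable by measurable
  fix z :: "real ^ 'd" assume "z \<in> space lcube"
  then show "norm (K x z *\<^sub>R grad u z) \<le> C * G"
    using K_abs_le grad_le C_nonneg by (auto simp: space_lcube intro!: mult_mono)
qed (rule lcube.finite_measure_axioms)

lemma integrable_K_grad_square: "integrable lcube (\<lambda>z. K x z * (norm (grad u z))\<^sup>2)"
proof (rule integrable_bounded[where B="C * G\<^sup>2"])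
  show "(\<lambda>z. K x z * (norm (grad u z))\<^sup>2) \<in> borel_measurable lcube"
    using grad_measurable by measurable
  fix z :: "real ^ 'd" assume "z \<in> space lcube"
  then show "norm (K x z * (norm (grad u z))\<^sup>2) \<le> C * G\<^sup>2"
    using K_abs_le grad_le C_nonneg by (auto simp: space_lcube abs_mult intro!: mult_mono power_mono)
qed (rule lcube.finite_measure_axioms)

lemma N1_nonneg: "0 \<le> N1"
  by (simp add: N1_def)

text \<open>Jensen with weight 1, as the cube has volume 1.\<close>

lemma N1_square_le: "N1\<^sup>2 \<le> N2"
  using weighted_norm_integral_square_le[of lcube "\<lambda>_. 1" "\<lambda>z. norm (grad u z)"]
    integrable_norm_grad integrable_norm_grad_square
  by (simp add: N1_def N2_def space_lcube measure_lcube)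

lemma p_square_le:
  "x \<in> closure cube \<Longrightarrow> (norm (p x))\<^sup>2 \<le> (\<integral>z. K x z * (norm (grad u z))\<^sup>2 \<partial>lcube)"
  unfolding p_def using K_nonneg integrable_K integral_K_eq_1 integrable_K_grad integrable_K_grad_square
  by (intro weighted_norm_integral_square_le) auto

lemma p_le: "norm (p x) \<le> C * N1"
proof -
  have "norm (p x) \<le> (\<integral>z. norm (K x z *\<^sub>R grad u z) \<partial>lcube)"
    unfolding p_def by (rule integral_norm_bound)
  also have "\<dots> \<le> (\<integral>z. C * norm (grad u z) \<partial>lcube)"
    by (intro integral_mono[OF integrable_norm[OF integrable_K_grad] integrable_mult_right[OF integrable_norm_grad]])
       (use K_abs_le in \<open>auto intro: mult_right_mono\<close>)
  finally show ?thesis by (simp add: N1_def)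
qed

text \<open>Only the kernel varies with \<open>x\<close>, so the L1 norm of the gradient suffices,
  with no regularity of the gradient itself.\<close>

lemma p_lipschitz: "norm (p x - p x') \<le> C * N1 * norm (x - x')"
proof -
  have "p x - p x' = (\<integral>z. (K x z - K x' z) *\<^sub>R grad u z \<partial>lcube)"
    unfolding p_def using integrable_K_grad by (simp add: scaleR_diff_left)
  also have "norm \<dots> \<le> (\<integral>z. norm ((K x z - K x' z) *\<^sub>R grad u z) \<partial>lcube)"
    by (rule integral_norm_bound)
  also have "\<dots> \<le> (\<integral>z. (C * norm (x - x')) * norm (grad u z) \<partial>lcube)"
  proof (intro integral_mono integrable_mult_right integrable_norm_grad)
    show "integrable lcube (\<lambda>z. norm ((K x z - K x' z) *\<^sub>R grad u z))"
      using integrable_K_grad[of x] integrable_K_grad[of x'] by (intro integrable_norm) (simp add: scaleR_diff_left)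
    show "norm ((K x z - K x' z) *\<^sub>R grad u z) \<le> (C * norm (x - x')) * norm (grad u z)" for z
      using K_lipschitz_left by (auto intro: mult_right_mono)
  qed
  finally show ?thesis by (simp add: N1_def mult_ac)
qed

text \<open>Restricting \<open>v\<close> to the segment from \<open>c\<close> to \<open>x\<close>
  leaves a scalar function, differentiated under the integral at each time. The scalar mean value
  theorem then replaces any discussion of differentiability of \<open>v\<close> in several
  variables.\<close>

lemma v_mean_value:
  assumes x: "x \<in> closure cube" and c: "c \<in> closure cube"
  shows "\<exists>\<xi>. norm (\<xi> - c) \<le> norm (x - c) \<and> v x - v c = (1 - s) * (p \<xi> \<bullet> (x - c))"
proof -
  define \<xi> where "\<xi> t = c + t *\<^sub>R (x - c)" for t :: real
  define \<phi> where "\<phi> t = v (\<xi> t)" for t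
  have \<xi>: "\<xi> t \<in> closure cube" if "t \<in> {0..1}" for t
    using convexD_alt[OF convex_closure[OF convex_cube] c x, of t] that by (simp add: \<xi>_def algebra_simps)
  \<comment> \<open>While \<xi> runs along the segment, the contracted point moves with constant
    velocity \<open>(1 - s) (x - c)\<close>; this is the origin of the factor
    \<open>1 - s\<close>.\<close>
  have line: "((1 - s) *\<^sub>R c + s *\<^sub>R y) + t *\<^sub>R ((1 - s) *\<^sub>R (x - c)) = (1 - s) *\<^sub>R \<xi> t + s *\<^sub>R y" for y t
    by (simp add: \<xi>_def algebra_simps)
  have "(\<phi> has_real_derivative (1 - s) * (p (\<xi> t) \<bullet> (x - c))) (at t within {0..1})"
    if t: "t \<in> {0..1}" for t
  proof -
    have ae: "AE y in lcube. (u has_derivative (\<lambda>h. grad u ((1 - s) *\<^sub>R \<xi> t + s *\<^sub>R y) \<bullet> h))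
        (at ((1 - s) *\<^sub>R \<xi> t + s *\<^sub>R y))"
      by (rule AE_cube_affine[OF AE_derivative s_pos]) (rule mix_in_cube[OF \<xi>[OF t]])
    have "((\<lambda>t. \<integral>y. k y * u (((1 - s) *\<^sub>R c + s *\<^sub>R y) + t *\<^sub>R ((1 - s) *\<^sub>R (x - c))) \<partial>lcube) has_real_derivative
      (\<integral>y. k y * (grad u (((1 - s) *\<^sub>R c + s *\<^sub>R y) + t *\<^sub>R ((1 - s) *\<^sub>R (x - c))) \<bullet> ((1 - s) *\<^sub>R (x - c))) \<partial>lcube))
      (at t within {0..1})"
    proof (rule has_real_derivative_integral_along_lines[where F=B and b="norm ((1 - s) *\<^sub>R (x - c))"])
      show "\<bar>k y\<bar> \<le> B" for y using k_nonneg k_le by simp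
      show "((1 - s) *\<^sub>R c + s *\<^sub>R y) + t *\<^sub>R ((1 - s) *\<^sub>R (x - c)) \<in> cube"
        if "y \<in> space lcube" "t \<in> {0..1}" for y t
        unfolding line using that by (intro mix_in_cube \<xi>) (auto simp: space_lcube)
      show "(\<lambda>y. (1 - s) *\<^sub>R c + s *\<^sub>R y) \<in> borel_measurable lcube" by measurable
      show "AE y in lcube. (u has_derivative
          (\<lambda>h. grad u (((1 - s) *\<^sub>R c + s *\<^sub>R y) + t *\<^sub>R ((1 - s) *\<^sub>R (x - c))) \<bullet> h))
          (at (((1 - s) *\<^sub>R c + s *\<^sub>R y) + t *\<^sub>R ((1 - s) *\<^sub>R (x - c))))"
        unfolding line by (rule ae)
    qed (use t k_measurable u_lipschitz grad_measurable lcube.finite_measure_axioms in auto)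
    moreover have "(\<integral>y. k y * (grad u ((1 - s) *\<^sub>R \<xi> t + s *\<^sub>R y) \<bullet> ((1 - s) *\<^sub>R (x - c))) \<partial>lcube)
      = (1 - s) * (p (\<xi> t) \<bullet> (x - c))"
    proof -
      let ?e = "(1 - s) *\<^sub>R (x - c)"
      have gm: "(\<lambda>z. grad u z \<bullet> ?e) \<in> borel_measurable lcube" using grad_measurable by measurable
      have "(\<integral>y. k y * (grad u ((1 - s) *\<^sub>R \<xi> t + s *\<^sub>R y) \<bullet> ?e) \<partial>lcube)
        = (\<integral>z. K (\<xi> t) z * (grad u z \<bullet> ?e) \<partial>lcube)"
        using integral_K[OF \<xi>[OF t] gm] unfolding real_scaleR_def by (rule sym)
      also have "\<dots> = (\<integral>z. (K (\<xi> t) z *\<^sub>R grad u z) \<bullet> ?e \<partial>lcube)"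
        by (simp only: inner_scaleR_left)
      also have "\<dots> = p (\<xi> t) \<bullet> ?e"
        unfolding p_def by (rule integral_inner_left[OF integrable_K_grad])
      finally show ?thesis by simp
    qed
    ultimately show ?thesis unfolding \<phi>_def v_def line by simp
  qed
  then have "(\<phi> has_derivative (\<lambda>r. (1 - s) * (p (\<xi> t) \<bullet> (x - c)) * r)) (at t within {0..1})"
    if "0 \<le> t" "t \<le> 1" for t
    using that unfolding has_field_derivative_def by simp
  from mvt_very_simple[OF zero_le_one this] obtain t where
    t: "t \<in> {0..1}" "\<phi> 1 - \<phi> 0 = (1 - s) * (p (\<xi> t) \<bullet> (x - c)) * (1 - 0)" ..
  have "norm (\<xi> t - c) \<le> norm (x - c)" using t(1) by (simp add: \<xi>_def mult_left_le_one_le)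
  moreover have "v x - v c = (1 - s) * (p (\<xi> t) \<bullet> (x - c))" using t(2) by (simp add: \<phi>_def \<xi>_def)
  ultimately show ?thesis by blast
qed

text \<open>The mean value formula evaluates \<open>p\<close> at an intermediate point no farther
  from \<open>c\<close> than \<open>x\<close> is, so \<open>p_lipschitz\<close> makes the remainder
  quadratic.\<close>

lemma v_first_order:
  assumes "x \<in> closure cube" "c \<in> closure cube"
  shows "\<bar>v x - v c - ((1 - s) *\<^sub>R p c) \<bullet> (x - c)\<bar> \<le> (C * N1 * norm (x - c)) * norm (x - c)"
proof -
  obtain \<xi> where \<xi>: "norm (\<xi> - c) \<le> norm (x - c)" "v x - v c = (1 - s) * (p \<xi> \<bullet> (x - c))"
    using v_mean_value[OF assms] by blast
  have "v x - v c - ((1 - s) *\<^sub>R p c) \<bullet> (x - c) = (1 - s) * ((p \<xi> - p c) \<bullet> (x - c))"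
    by (simp add: \<xi>(2) inner_diff_left algebra_simps)
  also have "\<bar>\<dots>\<bar> \<le> \<bar>(p \<xi> - p c) \<bullet> (x - c)\<bar>"
    using s_pos s_le by (simp add: abs_mult mult_left_le_one_le)
  also have "\<dots> \<le> norm (p \<xi> - p c) * norm (x - c)" by (rule Cauchy_Schwarz_ineq2)
  also have "\<dots> \<le> (C * N1 * norm (x - c)) * norm (x - c)"
  proof (intro mult_right_mono)
    have "norm (p \<xi> - p c) \<le> C * N1 * norm (\<xi> - c)" by (rule p_lipschitz)
    also have "\<dots> \<le> C * N1 * norm (x - c)" using \<xi>(1) C_nonneg N1_nonneg by (intro mult_left_mono) auto
    finally show "norm (p \<xi> - p c) \<le> C * N1 * norm (x - c)" .
  qed simp
  finally show ?thesis .
qed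

lemma v_lipschitz:
  assumes "x \<in> closure cube" "c \<in> closure cube"
  shows "\<bar>v x - v c\<bar> \<le> C * N1 * norm (x - c)"
proof -
  obtain \<xi> where \<xi>: "v x - v c = (1 - s) * (p \<xi> \<bullet> (x - c))"
    using v_mean_value[OF assms] by blast
  have "\<bar>v x - v c\<bar> \<le> \<bar>p \<xi> \<bullet> (x - c)\<bar>"
    unfolding \<xi> using s_pos s_le by (simp add: abs_mult mult_left_le_one_le)
  also have "\<dots> \<le> norm (p \<xi>) * norm (x - c)" by (rule Cauchy_Schwarz_ineq2)
  also have "\<dots> \<le> C * N1 * norm (x - c)" using p_le by (intro mult_right_mono) auto
  finally show ?thesis .
qed

lemma p_measurable: "p \<in> borel_measurable lcube"
proof -
  have "(C * N1)-lipschitz_on cube p"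
    using p_lipschitz C_nonneg N1_nonneg by (intro lipschitz_onI) (auto simp: dist_norm)
  then show ?thesis by (intro borel_measurable_continuous_cube lipschitz_on_continuous_on)
qed

lemma v_measurable: "v \<in> borel_measurable lcube"
proof -
  have "(C * N1)-lipschitz_on cube v"
    using v_lipschitz C_nonneg N1_nonneg by (intro lipschitz_onI) (auto simp: dist_norm cube_subset_closure)
  then show ?thesis by (intro borel_measurable_continuous_cube lipschitz_on_continuous_on)
qed

text \<open>Each \<open>x\<close> is moved straight towards the fixed \<open>y\<close>. The
  derivative in time is the gradient at contracted points, times a displacement of order
  \<open>s\<close>; undoing a contraction by at least 1/2, which is where \<open>s \<le> 1/2\<close>
  enters, costs the factor \<open>2 ^ CARD('d)\<close>.\<close>

lemma translation_estimate:
  assumes f: "f \<in> borel_measurable lcube" "\<And>x. \<bar>f x\<bar> \<le> F" and y: "y \<in> cube"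
  shows "\<bar>(\<integral>x. f x * u x \<partial>lcube) - (\<integral>x. f x * u ((1 - s) *\<^sub>R x + s *\<^sub>R y) \<partial>lcube)\<bar>
    \<le> F * (s * real CARD('d)) * 2 ^ CARD('d) * N1"
proof -
  define w where "w t x = (s * t) *\<^sub>R y + (1 - s * t) *\<^sub>R x" for t :: real and x
  define \<phi> where "\<phi> t = (\<integral>x. f x * u (w t x) \<partial>lcube)" for t
  have F: "0 \<le> F" using f(2)[of 0] by simp
  have st: "0 \<le> s * t" "s * t \<le> 1/2" if "t \<in> {0..1}" for t
    using that s_pos s_le mult_mono[of s "1/2" t 1] by auto
  have w_cube: "w t x \<in> cube" if "t \<in> {0..1}" "x \<in> cube" for t x
    using convexD_alt[OF convex_cube that(2) y, of "s * t"] st[OF that(1)] by (simp add: w_def add.commute)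
  have line: "x + t *\<^sub>R (s *\<^sub>R (y - x)) = w t x" for t x
    by (simp add: w_def algebra_simps)
  define \<phi>' where "\<phi>' t = (\<integral>x. f x * (grad u (w t x) \<bullet> (s *\<^sub>R (y - x))) \<partial>lcube)" for t
  have "(\<phi> has_real_derivative \<phi>' t) (at t within {0..1})" if t: "t \<in> {0..1}" for t
  proof -
    have ae: "AE x in lcube. (u has_derivative (\<lambda>h. grad u (w t x) \<bullet> h)) (at (w t x))"
      unfolding w_def
    proof (rule AE_cube_affine[OF AE_derivative])
      show "0 < 1 - s * t" using st[OF t] by simp
      show "(s * t) *\<^sub>R y + (1 - s * t) *\<^sub>R x \<in> cube" if "x \<in> cube" for x
        using w_cube[OF t that] by (simp add: w_def)
    qed
    have "((\<lambda>t. \<integral>x. f x * u (x + t *\<^sub>R (s *\<^sub>R (y - x))) \<partial>lcube) has_real_derivative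
        (\<integral>x. f x * (grad u (x + t *\<^sub>R (s *\<^sub>R (y - x))) \<bullet> (s *\<^sub>R (y - x))) \<partial>lcube)) (at t within {0..1})"
    proof (rule has_real_derivative_integral_along_lines[where F=F and b="s * real CARD('d)" and \<alpha>="\<lambda>x. x"])
      show "norm (s *\<^sub>R (y - x)) \<le> s * real CARD('d)" if "x \<in> space lcube" for x
        using closure_cube_dist[of y x] that y s_pos by (simp add: space_lcube cube_subset_closure)
      show "(\<lambda>x. s *\<^sub>R (y - x)) \<in> borel_measurable lcube" by measurable
      show "x + t *\<^sub>R (s *\<^sub>R (y - x)) \<in> cube" if "x \<in> space lcube" "t \<in> {0..1}" for x t
        unfolding line using that w_cube by (auto simp: space_lcube)
      show "AE x in lcube. (u has_derivative (\<lambda>h. grad u (x + t *\<^sub>R (s *\<^sub>R (y - x))) \<bullet> h))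
          (at (x + t *\<^sub>R (s *\<^sub>R (y - x))))" unfolding line by (rule ae)
    qed (use f t u_lipschitz grad_measurable lcube.finite_measure_axioms in auto)
    then show ?thesis unfolding line \<phi>_def \<phi>'_def .
  qed
  then have "(\<phi> has_derivative (\<lambda>r. \<phi>' t * r)) (at t within {0..1})" if "0 \<le> t" "t \<le> 1" for t
    using that unfolding has_field_derivative_def by simp
  from mvt_very_simple[OF zero_le_one this] obtain t where t: "t \<in> {0..1}" "\<phi> 1 - \<phi> 0 = \<phi>' t * (1 - 0)" ..
  let ?q = "F * (s * real CARD('d))"
  have gm: "(\<lambda>x. norm (grad u x)) \<in> borel_measurable lcube" using grad_measurable by measurable
  have "w t \<in> measurable lcube lcube"
  proof (rule measurable_restrict_space2)
    show "w t \<in> space lcube \<rightarrow> cube" using w_cube[OF t(1)] by (auto simp: space_lcube)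
    have "w t \<in> borel_measurable lcube" unfolding w_def by measurable
    then show "w t \<in> measurable lcube lborel" by simp
  qed
  from measurable_compose[OF this grad_measurable]
  have gwm: "(\<lambda>x. grad u (w t x)) \<in> borel_measurable lcube" .
  have gwint: "integrable lcube (\<lambda>x. norm (grad u (w t x)))"
    by (rule integrable_bounded[where B=G])
       (use gwm grad_le w_cube[OF t(1)] in \<open>auto simp: space_lcube lcube.finite_measure_axioms\<close>)
  have pw: "norm (f x * (grad u (w t x) \<bullet> (s *\<^sub>R (y - x)))) \<le> ?q * norm (grad u (w t x))" if x: "x \<in> cube" for x
  proof -
    have "\<bar>grad u (w t x) \<bullet> (s *\<^sub>R (y - x))\<bar> \<le> norm (grad u (w t x)) * norm (s *\<^sub>R (y - x))"
      by (rule Cauchy_Schwarz_ineq2)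
    also have "\<dots> \<le> norm (grad u (w t x)) * (s * real CARD('d))"
      using closure_cube_dist[of y x] x y s_pos by (intro mult_left_mono) (auto simp: cube_subset_closure)
    finally have "\<bar>f x\<bar> * \<bar>grad u (w t x) \<bullet> (s *\<^sub>R (y - x))\<bar> \<le> F * (norm (grad u (w t x)) * (s * real CARD('d)))"
      using f(2)[of x] F by (intro mult_mono) auto
    then show ?thesis by (simp add: abs_mult mult_ac)
  qed
  have "\<bar>\<phi>' t\<bar> \<le> (\<integral>x. norm (f x * (grad u (w t x) \<bullet> (s *\<^sub>R (y - x)))) \<partial>lcube)"
    unfolding \<phi>'_def real_norm_def[symmetric] by (rule integral_norm_bound)
  also have "\<dots> \<le> (\<integral>x. ?q * norm (grad u (w t x)) \<partial>lcube)"
  proof (rule integral_mono')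
    show "integrable lcube (\<lambda>x. ?q * norm (grad u (w t x)))" using gwint by simp
  qed (use pw F s_pos in \<open>auto simp: space_lcube\<close>)
  also have "\<dots> = ?q * (\<integral>x. norm (grad u (w t x)) \<partial>lcube)" by simp
  also have "\<dots> \<le> ?q * (2 ^ CARD('d) * N1)"
  proof (rule mult_left_mono)
    have le: "(1 - s * t) ^ CARD('d) * (\<integral>x. norm (grad u (w t x)) \<partial>lcube) \<le> N1"
      unfolding N1_def w_def
      by (rule integral_cube_affine_le[where B=G])
         (use gm grad_le st[OF t(1)] w_cube[OF t(1)] in \<open>auto simp: w_def\<close>)
    have "(1/2) ^ CARD('d) * (\<integral>x. norm (grad u (w t x)) \<partial>lcube)
        \<le> (1 - s * t) ^ CARD('d) * (\<integral>x. norm (grad u (w t x)) \<partial>lcube)"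
      using st[OF t(1)] by (intro mult_right_mono power_mono) auto
    with le have "(1/2) ^ CARD('d) * (\<integral>x. norm (grad u (w t x)) \<partial>lcube) \<le> N1" by linarith
    then show "(\<integral>x. norm (grad u (w t x)) \<partial>lcube) \<le> 2 ^ CARD('d) * N1"
      by (simp add: power_one_over pos_divide_le_eq mult.commute)
    show "0 \<le> ?q" using F s_pos by simp
  qed
  finally have "\<bar>\<phi>' t\<bar> \<le> ?q * 2 ^ CARD('d) * N1" by (simp add: mult_ac)
  moreover have "\<phi> 0 = (\<integral>x. f x * u x \<partial>lcube)" "\<phi> 1 = (\<integral>x. f x * u ((1 - s) *\<^sub>R x + s *\<^sub>R y) \<partial>lcube)"
    by (simp_all add: \<phi>_def w_def add.commute)
  ultimately show ?thesis using t(2) by simp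
qed

text \<open>By Fubini, pairing with \<open>v\<close> is the \<open>k\<close>-average over
  \<open>y\<close> of pairings with the shifted copies of \<open>u\<close>, and
  \<open>translation_estimate\<close> is uniform in \<open>y\<close>.\<close>

lemma integral_mollification_error:
  assumes f: "f \<in> borel_measurable lcube" "\<And>x. \<bar>f x\<bar> \<le> F"
  shows "\<bar>(\<integral>x. f x * u x \<partial>lcube) - (\<integral>x. f x * v x \<partial>lcube)\<bar> \<le> F * (s * real CARD('d)) * 2 ^ CARD('d) * N1"
    (is "_ \<le> ?E")
proof -
  let ?w = "\<lambda>x y. (1 - s) *\<^sub>R x + s *\<^sub>R y"
  obtain U where U: "\<And>x. x \<in> cube \<Longrightarrow> \<bar>u x\<bar> \<le> U" using u_bounded by blast
  have F: "0 \<le> F" using f(2)[of 0] by simp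
  let ?P = "lcube \<Otimes>\<^sub>M lcube :: ((real ^ 'd) \<times> (real ^ 'd)) measure"
  have [measurable]: "f \<in> borel_measurable lcube" "k \<in> borel_measurable lcube" by (rule f k_measurable)+
  have wm: "(\<lambda>(x, y). ?w x y) \<in> measurable ?P lcube"
  proof (rule measurable_restrict_space2)
    show "(\<lambda>(x, y). ?w x y) \<in> space ?P \<rightarrow> cube"
      using mix_in_cube cube_subset_closure by (auto simp: space_pair_measure space_lcube)
    have "(\<lambda>(x, y). ?w x y) \<in> borel_measurable ?P" by measurable
    then show "(\<lambda>(x, y). ?w x y) \<in> measurable ?P lborel" by simp
  qed
  have m: "(\<lambda>(x, y). f x * (k y * u (?w x y))) \<in> borel_measurable ?P"
    using measurable_compose[OF wm u_measurable] by (simp add: case_prod_beta)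
  have bd: "\<bar>f x * (k y * u (?w x y))\<bar> \<le> F * (B * U)"
    if "x \<in> space lcube" "y \<in> space lcube" for x y
  proof -
    have "?w x y \<in> cube"
      using that by (intro mix_in_cube cube_subset_closure) (simp_all add: space_lcube)
    then have "\<bar>u (?w x y)\<bar> \<le> U" by (rule U)
    then show ?thesis unfolding abs_mult
      using f(2)[of x] k_nonneg[of y] k_le[of y] B_nonneg F by (intro mult_mono mult_nonneg_nonneg) auto
  qed
  define J where "J y = (\<integral>x. f x * u (?w x y) \<partial>lcube)" for y
  define I where "I = (\<integral>x. f x * u x \<partial>lcube)"
  note Fub = Fubini_bounded[OF lcube.finite_measure_axioms lcube.finite_measure_axioms m bd]
  have "(\<integral>x. f x * v x \<partial>lcube) = (\<integral>x. (\<integral>y. f x * (k y * u (?w x y)) \<partial>lcube) \<partial>lcube)"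
    by (simp add: v_def)
  also have "\<dots> = (\<integral>y. (\<integral>x. f x * (k y * u (?w x y)) \<partial>lcube) \<partial>lcube)"
    by (rule Fub(1)[symmetric])
  also have inner: "(\<lambda>y. \<integral>x. f x * (k y * u (?w x y)) \<partial>lcube) = (\<lambda>y. k y * J y)"
  proof
    fix y
    have "(\<lambda>x. f x * (k y * u (?w x y))) = (\<lambda>x. k y * (f x * u (?w x y)))" by (simp add: mult_ac)
    then show "(\<integral>x. f x * (k y * u (?w x y)) \<partial>lcube) = k y * J y" by (simp add: J_def)
  qed
  finally have fv: "(\<integral>x. f x * v x \<partial>lcube) = (\<integral>y. k y * J y \<partial>lcube)" .
  have kJ: "integrable lcube (\<lambda>y. k y * J y)" using Fub(3) unfolding inner .
  have kint: "integrable lcube k"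
    by (rule integrable_bounded[where B=B]) (use k_nonneg k_le lcube.finite_measure_axioms in auto)
  have "I - (\<integral>y. k y * J y \<partial>lcube) = (\<integral>y. k y * I \<partial>lcube) - (\<integral>y. k y * J y \<partial>lcube)"
    using integral_k by simp
  also have "\<dots> = (\<integral>y. k y * (I - J y) \<partial>lcube)"
    using kJ kint by (simp add: right_diff_distrib)
  also have "\<bar>\<dots>\<bar> \<le> (\<integral>y. norm (k y * (I - J y)) \<partial>lcube)"
    unfolding real_norm_def[symmetric] by (rule integral_norm_bound)
  also have "\<dots> \<le> (\<integral>y. k y * ?E \<partial>lcube)"
  proof (rule integral_mono')
    show "integrable lcube (\<lambda>y. k y * ?E)" using kint by (intro integrable_mult_left)
    fix y :: "real ^ 'd" assume "y \<in> space lcube"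
    then have "\<bar>I - J y\<bar> \<le> ?E"
      unfolding I_def J_def by (intro translation_estimate f) (simp add: space_lcube)
    then show "norm (k y * (I - J y)) \<le> k y * ?E"
      unfolding real_norm_def abs_mult using k_nonneg[of y] by (simp add: mult_left_mono)
  qed (use k_nonneg F s_pos N1_nonneg in simp)
  also have "\<dots> = ?E" using integral_k by simp
  finally show ?thesis by (simp only: fv I_def)
qed

end

section \<open>Approximation by the discrete spaces\<close>

lemma successive_triangulation:
  "successive_uniform_refinements \<T> \<Longrightarrow> simplicial_triangulation_of cube (\<T> n)"
  unfolding successive_uniform_refinements_def by blast

lemma piecewise_affineI:
  fixes T :: "(real ^ 'd) set set"
  assumes T: "simplicial_triangulation_of cube T"
    and "\<And>S x. S \<in> T \<Longrightarrow> x \<in> S \<Longrightarrow> x \<in> cube \<Longrightarrow> u x = a S \<bullet> x + b S"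
  shows "piecewise_affine T u a b"
proof
  show "cube \<subseteq> \<Union>T" using simplicial_triangulation_facts(5)[OF T] closure_subset by blast
  show "closed S" if "S \<in> T" for S
    using simplicial_triangulation_facts(2)[OF T that] by (rule compact_imp_closed)
qed (use simplicial_triangulation_facts(1,3,4)[OF T] assms(2) in auto)

lemma W_discrete_piecewise_affine:
  fixes \<T> :: "nat \<Rightarrow> (real ^ 'd) set set"
  assumes T: "successive_uniform_refinements \<T>" and u: "u \<in> W_discrete \<T> m"
  shows "\<exists>a b. piecewise_affine (\<T> (Suc m)) u a b"
proof -
  have "\<forall>S\<in>\<T> (Suc m). \<exists>ab. \<forall>x\<in>S \<inter> cube. u x = fst ab \<bullet> x + snd ab"
    using u unfolding W_discrete_def by fastforce
  from bchoice[OF this] obtain ab where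
    "\<forall>S\<in>\<T> (Suc m). \<forall>x\<in>S \<inter> cube. u x = fst (ab S) \<bullet> x + snd (ab S)" ..
  then have "piecewise_affine (\<T> (Suc m)) u (\<lambda>S. fst (ab S)) (\<lambda>S. snd (ab S))"
    by (intro piecewise_affineI successive_triangulation[OF T]) blast
  then show ?thesis by blast
qed

lemma W_discrete_regular:
  fixes \<T> :: "nat \<Rightarrow> (real ^ 'd) set set"
  assumes "successive_uniform_refinements \<T>" "u \<in> W_discrete \<T> m"
  obtains L G where "L-lipschitz_on cube u" "grad u \<in> borel_measurable lcube"
    "\<And>x. x \<in> cube \<Longrightarrow> norm (grad u x) \<le> G"
    "AE x in lcube. (u has_derivative (\<lambda>h. grad u x \<bullet> h)) (at x)"
proof -
  obtain a b where "piecewise_affine (\<T> (Suc m)) u a b"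
    using W_discrete_piecewise_affine[OF assms] by blast
  then interpret piecewise_affine "\<T> (Suc m)" u a b .
  obtain L where L: "L-lipschitz_on cube u" using lipschitz by blast
  obtain G where G: "\<forall>x\<in>cube. norm (grad u x) \<le> G" using grad_bounded by blast
  have "grad u \<in> borel_measurable lcube"
    using borel_measurable_grad measurable_cong_sets[OF sets_lcube refl] by blast
  from that[OF L this _ AE_has_derivative] G show thesis by blast
qed

lemma W_discrete_measurable:
  "u \<in> W_discrete \<T> m \<Longrightarrow> u \<in> borel_measurable lcube"
  unfolding W_discrete_def by (intro borel_measurable_continuous_cube) simp

lemma W_discrete_zero: "(\<lambda>_. 0) \<in> W_discrete \<T> m"
  unfolding W_discrete_def by (auto intro!: exI[of _ 0])

lemma grad_zero: "grad (\<lambda>_. 0) x = 0"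
  by (rule grad_eqI) (simp add: has_derivative_const)

text \<open>\<open>P\<close> stands for the gradient of \<open>v\<close>. The interpolant lacks mean
  zero in general, so its mean is subtracted and returned as \<open>c0\<close>.\<close>

lemma W_discrete_interpolation:
  fixes \<T> :: "nat \<Rightarrow> (real ^ 'd) set set"
  assumes T: "successive_uniform_refinements \<T>"
    and \<kappa>: "0 \<le> \<kappa>" "\<And>S. S \<in> \<T> (Suc m) \<Longrightarrow> \<exists>c r. 0 < r \<and> cball c r \<subseteq> S \<and> diameter S \<le> \<kappa> * r"
    and h: "\<And>S. S \<in> \<T> (Suc m) \<Longrightarrow> diameter S \<le> h"
    and M: "0 \<le> M"
    and first: "\<And>x c. x \<in> closure cube \<Longrightarrow> c \<in> closure cube \<Longrightarrow>
      \<bar>v x - v c - P c \<bullet> (x - c)\<bar> \<le> (M * norm (x - c)) * norm (x - c)"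
    and lip: "\<And>x c. x \<in> closure cube \<Longrightarrow> c \<in> closure cube \<Longrightarrow> norm (P x - P c) \<le> M * norm (x - c)"
  obtains w c0 where "w \<in> W_discrete \<T> m"
    "\<And>x. x \<in> cube \<Longrightarrow> \<bar>w x + c0 - v x\<bar> \<le> 2 * h * (M * h)"
    "AE x in lcube. norm (grad w x - P x) \<le> (\<kappa> + 1) * (M * h)"
proof -
  let ?T = "\<T> (Suc m)"
  note tri = simplicial_triangulation_facts[OF successive_triangulation[OF T, of "Suc m"]]
  obtain w' a b where w': "continuous_on (closure cube) w'"
    "\<And>S x. S \<in> ?T \<Longrightarrow> x \<in> S \<Longrightarrow> w' x = a S \<bullet> x + b S"
    "\<And>S v'. S \<in> ?T \<Longrightarrow> v' extreme_point_of S \<Longrightarrow> w' v' = v v'"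
    using triangulation_interpolation[OF tri(7), of v] unfolding tri(5) by metis
  \<comment> \<open>Both gradients are compared with \<open>P c\<close> at the centre of the
    inscribed ball: the interpolation error gives \<kappa>, the variation of \<open>P\<close>
    between \<open>x\<close> and \<open>c\<close> gives the extra 1.\<close>
  have err: "norm (a S - P x) \<le> (\<kappa> + 1) * (M * h) \<and> \<bar>a S \<bullet> x + b S - v x\<bar> \<le> 2 * h * (M * h)"
    if S: "S \<in> ?T" and x: "x \<in> S" for S x
  proof -
    obtain c r where cr: "0 < r" "cball c r \<subseteq> S" "diameter S \<le> \<kappa> * r" using \<kappa>(2)[OF S] by blast
    have bS: "bounded S" using tri(2)[OF S] compact_imp_bounded by blast
    have dist: "norm (y - z) \<le> diameter S" if "y \<in> S" "z \<in> S" for y z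
      using diameter_bounded_bound[OF bS that] by (simp add: dist_norm)
    have cS: "c \<in> S" using cr by auto
    have sub: "y \<in> closure cube" if "y \<in> S" for y using tri(6)[OF S] that by blast
    have hS: "diameter S \<le> h" by (rule h[OF S])
    have h0: "0 \<le> h" using dist[OF cS cS] hS by simp
    have \<omega>: "0 \<le> M * h" using M h0 by simp
    have first': "\<bar>v y - v c - P c \<bullet> (y - c)\<bar> \<le> (M * h) * norm (y - c)" if y: "y \<in> S" for y
    proof -
      have "(M * norm (y - c)) * norm (y - c) \<le> (M * h) * norm (y - c)"
        using dist[OF y cS] hS M by (intro mult_right_mono mult_left_mono) auto
      then show ?thesis using first[OF sub[OF y] sub[OF cS]] by linarith
    qed
    have vert: "a S \<bullet> y + b S = v y" if "y extreme_point_of S" for y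
    proof -
      have "y \<in> S" using that by (simp add: extreme_point_of_def)
      then show ?thesis using w'(2)[OF S] w'(3)[OF S that] by simp
    qed
    note E = simplex_interpolation_error[OF tri(2)[OF S] tri(3)[OF S] cr(1,2) _ cr(3) \<omega>, where b="b S" and g=v]
    have E1: "norm (a S - P c) \<le> \<kappa> * (M * h)"
      by (rule E(1)) (rule dist, assumption, rule cS, erule first', erule vert)
    have E2: "\<bar>a S \<bullet> x + b S - v x\<bar> \<le> 2 * diameter S * (M * h)"
      by (rule E(2)[where P="P c"]) (rule dist, assumption, rule cS, erule first', erule vert, rule x)
    have "norm (a S - P x) \<le> norm (a S - P c) + norm (P x - P c)"
      using norm_triangle_ineq4[of "a S - P c" "P x - P c"] by simp
    also have "norm (P x - P c) \<le> M * norm (x - c)" by (rule lip[OF sub[OF x] sub[OF cS]])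
    also have "M * norm (x - c) \<le> M * h" using dist[OF x cS] hS M by (intro mult_left_mono) auto
    also have "norm (a S - P c) \<le> \<kappa> * (M * h)" by (rule E1)
    finally have 1: "norm (a S - P x) \<le> (\<kappa> + 1) * (M * h)" by (simp add: algebra_simps)
    have "2 * diameter S * (M * h) \<le> 2 * h * (M * h)" using hS \<omega> by (intro mult_right_mono) auto
    then show ?thesis using 1 E2 by linarith
  qed
  define c0 where "c0 = (\<integral>x. w' x \<partial>lcube)"
  define w where "w x = w' x - c0" for x
  interpret w: piecewise_affine ?T w a "\<lambda>S. b S - c0"
    by (rule piecewise_affineI[OF successive_triangulation[OF T]]) (simp add: w_def w'(2))
  have w'c: "continuous_on cube w'" using w'(1) closure_subset continuous_on_subset by blast
  have w'm: "w' \<in> borel_measurable lcube" by (rule borel_measurable_continuous_cube[OF w'c])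
  have "bounded (w' ` closure cube)"
    using w'(1) by (intro compact_imp_bounded compact_continuous_image) (simp_all add: closure_cube)
  then obtain W where W: "\<And>x. x \<in> closure cube \<Longrightarrow> \<bar>w' x\<bar> \<le> W" unfolding bounded_iff by auto
  have w'i: "integrable lcube w'"
    by (rule integrable_bounded[OF lcube.finite_measure_axioms w'm, of W])
       (use W cube_subset_closure in \<open>auto simp: space_lcube\<close>)
  have wc: "continuous_on cube w" unfolding w_def by (intro continuous_intros w'c)
  have "(\<integral>x. w x \<partial>lcube) = 0"
    unfolding w_def using w'i by (simp add: c0_def[symmetric] space_lcube measure_lcube)
  then have int0: "(\<integral>x. w x \<partial>lebesgue_on cube) = 0"
    using integral_lebesgue_on_cube[OF borel_measurable_continuous_cube[OF wc]] by simp
  have aff: "\<forall>S\<in>?T. \<exists>a b. \<forall>x\<in>S \<inter> cube. w x = a \<bullet> x + b"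
    using w.affine by blast
  show thesis
  proof (rule that[of w c0])
    show "w \<in> W_discrete \<T> m" unfolding W_discrete_def using wc int0 aff by blast
    show "\<bar>w x + c0 - v x\<bar> \<le> 2 * h * (M * h)" if x: "x \<in> cube" for x
    proof -
      obtain S where S: "S \<in> ?T" "x \<in> S" using x w.cube_cover by blast
      then show ?thesis using err[OF S] w'(2)[OF S] by (simp add: w_def)
    qed
    show "AE x in lcube. norm (grad w x - P x) \<le> (\<kappa> + 1) * (M * h)"
    proof (rule AE_mp[OF w.AE_interior], intro AE_I2 impI)
      fix x assume x: "x \<in> space lcube" "\<exists>S\<in>?T. x \<in> interior S"
      then obtain S where S: "S \<in> ?T" "x \<in> interior S" "x \<in> cube" by (auto simp: space_lcube)
      have "x \<in> S" using S(2) interior_subset by blast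
      then show "norm (grad w x - P x) \<le> (\<kappa> + 1) * (M * h)"
        using err[OF S(1)] grad_eqI[OF w.has_derivative_interior[OF S]] by simp
    qed
  qed
qed

section \<open>Measures with piecewise constant density\<close>

text \<open>Having a density, \<nu> ignores the faces of the mesh, so gradient bounds that hold
  Lebesgue-almost everywhere may be integrated against it.\<close>

lemma M_discrete_AE:
  assumes "\<nu> \<in> M_discrete \<T> n" "AE x in lcube. P x"
  shows "AE x in \<nu>. P x"
  using assms unfolding M_discrete_def by (auto simp: AE_density)

lemma M_discrete_sets: "\<nu> \<in> M_discrete \<T> n \<Longrightarrow> sets \<nu> = sets lcube"
  unfolding M_discrete_def by auto

text \<open>Sampling \<open>g\<close> once per simplex errs by at most \<epsilon>. Raising the
  samples by \<open>2 * \<epsilon>\<close> leaves at least \<epsilon> above \<open>g\<close>, the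
  coercive reserve, at a cost of at most \<open>3 * \<epsilon>\<close>.\<close>

lemma M_discrete_piecewise_constant_approximation:
  fixes \<T> :: "nat \<Rightarrow> (real ^ 'd) set set" and g :: "real ^ 'd \<Rightarrow> real"
  assumes T: "successive_uniform_refinements \<T>"
    and g: "\<And>z. 0 \<le> g z" "\<And>z z'. \<bar>g z - g z'\<bar> \<le> D * norm (z - z')" "0 \<le> D"
    and h: "\<And>S. S \<in> \<T> n \<Longrightarrow> diameter S \<le> h" "D * h \<le> \<epsilon>" and \<epsilon>: "0 < \<epsilon>"
  obtains g' where "g' \<in> borel_measurable lcube"
    "\<And>z. z \<in> cube \<Longrightarrow> g z + \<epsilon> \<le> g' z" "\<And>z. z \<in> cube \<Longrightarrow> g' z \<le> g z + 3 * \<epsilon>"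
    "density lcube (\<lambda>x. ennreal (g' x)) \<in> M_discrete \<T> n"
proof -
  let ?T = "\<T> n"
  have tri0: "simplicial_triangulation_of cube ?T" by (rule successive_triangulation[OF T])
  note tri = simplicial_triangulation_facts[OF tri0]
  interpret zero: piecewise_affine ?T "\<lambda>_. 0" "\<lambda>_. 0" "\<lambda>_. 0"
    by (rule piecewise_affineI[OF tri0]) simp
  \<comment> \<open>The simplex is chosen from the set of all simplices containing the point, so
    \<open>g'\<close> depends on that set alone and is Borel also on shared faces.\<close>
  define sel where "sel I = (SOME S :: (real ^ 'd) set. S \<in> I)" for I
  define cen where "cen S = (SOME c :: real ^ 'd. c \<in> S)" for S
  define g' where "g' z = g (cen (sel {S\<in>?T. z \<in> S})) + 2 * \<epsilon>" for z
  have cen: "cen S \<in> S" if S: "S \<in> ?T" for S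
  proof -
    obtain x where "x \<in> S" using tri(4)[OF S] interior_subset by blast
    then show ?thesis unfolding cen_def by (rule someI)
  qed
  have close: "\<bar>g' z - (g z + 2 * \<epsilon>)\<bar> \<le> \<epsilon>" if z: "z \<in> cube" for z
  proof -
    define S where "S = sel {S\<in>?T. z \<in> S}"
    obtain S' where S': "S' \<in> ?T" "z \<in> S'" using z zero.cube_cover by blast
    have "S \<in> {S\<in>?T. z \<in> S}" unfolding S_def sel_def by (rule someI[of _ S']) (use S' in simp)
    then have S: "S \<in> ?T" "z \<in> S" by auto
    have "bounded S" using tri(2)[OF S(1)] compact_imp_bounded by blast
    from diameter_bounded_bound[OF this cen[OF S(1)] S(2)]
    have "norm (cen S - z) \<le> h" using h(1)[OF S(1)] by (simp add: dist_norm)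
    then have "D * norm (cen S - z) \<le> \<epsilon>" using h(2) g(3) mult_left_mono order_trans by blast
    then show ?thesis using g(2)[of "cen S" z] by (simp add: g'_def S_def[symmetric])
  qed
  have m: "g' \<in> borel_measurable lcube"
  proof (rule measurable_finite_atoms[OF tri(1)])
    show "S \<inter> space lcube \<in> sets lcube" if "S \<in> ?T" for S
      using tri(2)[OF that] compact_imp_closed borel_closed
      by (auto simp: sets_restrict_space space_lcube)
    show "g' x = g' y" if "{S\<in>?T. x \<in> S} = {S\<in>?T. y \<in> S}" for x y
      unfolding g'_def that ..
  qed simp
  have const: "AE x in lcube. x \<in> S \<longrightarrow> g' x = g (cen S) + 2 * \<epsilon>" if S: "S \<in> ?T" for S
  proof (rule AE_mp[OF zero.AE_interior], intro AE_I2 impI)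
    fix x assume "\<exists>S'\<in>?T. x \<in> interior S'" "x \<in> S"
    then obtain S' where S': "S' \<in> ?T" "x \<in> interior S'" by blast
    have "S'' = S'" if "S'' \<in> ?T" "x \<in> S''" for S''
      by (rule simplicial_triangulation_interior_unique[OF tri0 S'(1) that(1) S'(2) that(2)])
    then have "{S\<in>?T. x \<in> S} = {S}" using S \<open>x \<in> S\<close> by blast
    then show "g' x = g (cen S) + 2 * \<epsilon>" by (simp add: g'_def sel_def)
  qed
  have nonneg: "0 \<le> g' x" if "x \<in> cube" for x using close[OF that] g(1)[of x] \<epsilon> by linarith
  show thesis
  proof (rule that[OF m])
    show "g z + \<epsilon> \<le> g' z" "g' z \<le> g z + 3 * \<epsilon>" if "z \<in> cube" for z using close[OF that] by linarith+
    show "density lcube (\<lambda>x. ennreal (g' x)) \<in> M_discrete \<T> n"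
      unfolding M_discrete_def using m nonneg const by blast
  qed
qed

section \<open>Mollification of measures\<close>

context cube_kernel begin

text \<open>The Lebesgue density of the mollified measure, adjoint to averaging functions with the
  kernel \<open>K x\<close>.\<close>

definition smoothed :: "(real ^ 'd) measure \<Rightarrow> real ^ 'd \<Rightarrow> real" where
  "smoothed \<nu> z = (\<integral>x. K x z \<partial>\<nu>)"

context
  fixes \<nu> :: "(real ^ 'd) measure"
  assumes \<nu>_finite: "finite_measure \<nu>" and \<nu>_sets: "sets \<nu> = sets lcube"
begin

lemma \<nu>_space: "space \<nu> = cube"
  using sets_eq_imp_space_eq[OF \<nu>_sets] by (simp add: space_lcube)

lemma \<nu>_id: "(\<lambda>x. x) \<in> borel_measurable \<nu>"
  using id_cube_measurable measurable_cong_sets[OF \<nu>_sets refl] by blast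

lemma K_\<nu>_integrable: "integrable \<nu> (\<lambda>x. K x z)"
  by (rule integrable_bounded[OF \<nu>_finite, of _ C]) (use K_abs_le K_measurable[OF \<nu>_id] in auto)

lemma smoothed_nonneg: "0 \<le> smoothed \<nu> z"
  unfolding smoothed_def using K_nonneg by (intro Bochner_Integration.integral_nonneg) auto

lemma smoothed_le: "smoothed \<nu> z \<le> C * measure \<nu> cube"
proof -
  have "smoothed \<nu> z \<le> (\<integral>x. C \<partial>\<nu>)"
    unfolding smoothed_def using K_\<nu>_integrable K_le \<nu>_finite
    by (intro integral_mono) (auto simp: finite_measure.integrable_const)
  then show ?thesis by (simp add: \<nu>_space mult.commute)
qed

lemma smoothed_lipschitz: "\<bar>smoothed \<nu> z - smoothed \<nu> z'\<bar> \<le> (C * measure \<nu> cube) * norm (z - z')"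
proof -
  have "smoothed \<nu> z - smoothed \<nu> z' = (\<integral>x. K x z - K x z' \<partial>\<nu>)"
    unfolding smoothed_def using K_\<nu>_integrable by simp
  also have "norm \<dots> \<le> (\<integral>x. norm (K x z - K x z') \<partial>\<nu>)" by (rule integral_norm_bound)
  also have "\<dots> \<le> (\<integral>x. C * norm (z - z') \<partial>\<nu>)"
    using K_\<nu>_integrable K_lipschitz_right \<nu>_finite
    by (intro integral_mono integrable_norm) (auto simp: finite_measure.integrable_const)
  finally show ?thesis by (simp add: \<nu>_space mult_ac)
qed

lemma smoothed_measurable: "smoothed \<nu> \<in> borel_measurable lcube"
proof -
  have "(C * measure \<nu> cube)-lipschitz_on cube (smoothed \<nu>)"
    using smoothed_lipschitz C_nonneg by (intro lipschitz_onI) (auto simp: dist_norm)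
  then show ?thesis by (intro borel_measurable_continuous_cube lipschitz_on_continuous_on)
qed

lemma integral_smoothed:
  assumes \<phi>: "\<phi> \<in> borel_measurable lcube" "\<And>x. x \<in> cube \<Longrightarrow> \<bar>\<phi> x\<bar> \<le> A"
  shows "(\<integral>z. \<phi> z * smoothed \<nu> z \<partial>lcube) = (\<integral>x. (\<integral>z. K x z * \<phi> z \<partial>lcube) \<partial>\<nu>)"
    "integrable \<nu> (\<lambda>x. \<integral>z. K x z * \<phi> z \<partial>lcube)"
proof -
  have m: "(\<lambda>(x, z). K x z * \<phi> z) \<in> borel_measurable (\<nu> \<Otimes>\<^sub>M lcube)"
  proof -
    have "(\<lambda>p. K (fst p) (snd p)) \<in> borel_measurable (\<nu> \<Otimes>\<^sub>M lcube)"
      using measurable_compose[OF measurable_fst \<nu>_id] measurable_compose[OF measurable_snd id_cube_measurable]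
      by (rule K_measurable)
    from borel_measurable_times[OF this measurable_compose[OF measurable_snd \<phi>(1)]]
    show ?thesis by (simp add: case_prod_beta)
  qed
  have bd: "\<bar>K x z * \<phi> z\<bar> \<le> C * A" if "x \<in> space \<nu>" "z \<in> space lcube" for x z
    unfolding abs_mult using K_abs_le \<phi>(2) C_nonneg that by (intro mult_mono) (auto simp: space_lcube)
  note F = Fubini_bounded[OF \<nu>_finite lcube.finite_measure_axioms m bd]
  have eq: "(\<lambda>z. \<phi> z * smoothed \<nu> z) = (\<lambda>z. \<integral>x. K x z * \<phi> z \<partial>\<nu>)"
    by (simp add: smoothed_def mult.commute)
  show "(\<integral>z. \<phi> z * smoothed \<nu> z \<partial>lcube) = (\<integral>x. (\<integral>z. K x z * \<phi> z \<partial>lcube) \<partial>\<nu>)"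
    unfolding eq by (rule F(1))
  show "integrable \<nu> (\<lambda>x. \<integral>z. K x z * \<phi> z \<partial>lcube)" by (rule F(2))
qed

lemma integral_smoothed_mass: "(\<integral>z. smoothed \<nu> z \<partial>lcube) = measure \<nu> cube"
proof -
  have "(\<integral>z. 1 * smoothed \<nu> z \<partial>lcube) = (\<integral>x. (\<integral>z. K x z * 1 \<partial>lcube) \<partial>\<nu>)"
    by (rule integral_smoothed(1)[of _ 1]) auto
  also have "\<dots> = (\<integral>x. 1 \<partial>\<nu>)"
    by (rule Bochner_Integration.integral_cong) (auto simp: \<nu>_space integral_K_eq_1 cube_subset_closure)
  finally show ?thesis by (simp add: \<nu>_space)
qed

text \<open>By adjointness the test function is replaced by its average under \<open>K x\<close>, a
  probability density supported near \<open>x\<close>; its oscillation at that distance bounds the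
  change.\<close>

lemma integral_smoothed_close:
  assumes \<phi>: "\<phi> \<in> borel_measurable lcube" "\<And>x. x \<in> cube \<Longrightarrow> \<bar>\<phi> x\<bar> \<le> A"
    and osc: "\<And>x z. x \<in> cube \<Longrightarrow> z \<in> cube \<Longrightarrow> norm (z - x) \<le> s * real CARD('d) \<Longrightarrow> \<bar>\<phi> z - \<phi> x\<bar> \<le> \<omega>"
  shows "\<bar>(\<integral>z. \<phi> z * smoothed \<nu> z \<partial>lcube) - (\<integral>x. \<phi> x \<partial>\<nu>)\<bar> \<le> \<omega> * measure \<nu> cube"
proof -
  have Kint: "integrable lcube (K x)" for x
    by (rule integrable_bounded[where B=C])
       (use K_abs_le in \<open>auto simp: space_lcube lcube.finite_measure_axioms\<close>)
  have K\<phi>int: "integrable lcube (\<lambda>z. K x z * \<phi> z)" for x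
  proof (rule integrable_bounded[where B="C * A"])
    show "(\<lambda>z. K x z * \<phi> z) \<in> borel_measurable lcube"
      by (intro borel_measurable_times K_measurable id_cube_measurable \<phi>(1)) simp
    show "norm (K x z * \<phi> z) \<le> C * A" if "z \<in> space lcube" for z
      unfolding real_norm_def abs_mult
      using K_abs_le \<phi>(2) C_nonneg that by (intro mult_mono) (auto simp: space_lcube)
  qed (rule lcube.finite_measure_axioms)
  have \<phi>\<nu>: "integrable \<nu> \<phi>"
    by (rule integrable_bounded[OF \<nu>_finite, of _ A])
       (use \<phi> measurable_cong_cube[OF \<nu>_sets] in \<open>auto simp: \<nu>_space\<close>)
  have I: "(\<integral>z. \<phi> z * smoothed \<nu> z \<partial>lcube) = (\<integral>x. (\<integral>z. K x z * \<phi> z \<partial>lcube) \<partial>\<nu>)"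
    "integrable \<nu> (\<lambda>x. \<integral>z. K x z * \<phi> z \<partial>lcube)"
    by (rule integral_smoothed[OF \<phi>], assumption)+
  have pw: "\<bar>(\<integral>z. K x z * \<phi> z \<partial>lcube) - \<phi> x\<bar> \<le> \<omega>" if x: "x \<in> cube" for x
  proof -
    have K1: "(\<integral>z. K x z \<partial>lcube) = 1" by (rule integral_K_eq_1[OF cube_subset_closure[OF x]])
    have "(\<integral>z. K x z * \<phi> z \<partial>lcube) - \<phi> x = (\<integral>z. K x z * \<phi> z \<partial>lcube) - (\<integral>z. K x z * \<phi> x \<partial>lcube)"
      using K1 by simp
    also have "\<dots> = (\<integral>z. K x z * (\<phi> z - \<phi> x) \<partial>lcube)"
      using K\<phi>int Kint by (simp add: right_diff_distrib)
    also have "norm \<dots> \<le> (\<integral>z. norm (K x z * (\<phi> z - \<phi> x)) \<partial>lcube)" by (rule integral_norm_bound)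
    also have "\<dots> \<le> (\<integral>z. K x z * \<omega> \<partial>lcube)"
    proof (intro integral_mono integrable_norm)
      show "integrable lcube (\<lambda>z. K x z * (\<phi> z - \<phi> x))"
        using K\<phi>int Kint by (simp add: right_diff_distrib)
      show "integrable lcube (\<lambda>z. K x z * \<omega>)" using Kint by simp
      fix z :: "real ^ 'd" assume "z \<in> space lcube"
      then have z: "z \<in> cube" by (simp add: space_lcube)
      show "norm (K x z * (\<phi> z - \<phi> x)) \<le> K x z * \<omega>"
      proof (cases "K x z = 0")
        case False
        then have "\<bar>\<phi> z - \<phi> x\<bar> \<le> \<omega>"
          using K_support[OF cube_subset_closure[OF x]] osc[OF x z] by blast
        then show ?thesis using K_nonneg[of x z] by (simp add: abs_mult mult_left_mono)
      qed simp
    qed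
    also have "\<dots> = \<omega>" using K1 by simp
    finally show ?thesis by simp
  qed
  have "(\<integral>z. \<phi> z * smoothed \<nu> z \<partial>lcube) - (\<integral>x. \<phi> x \<partial>\<nu>)
      = (\<integral>x. (\<integral>z. K x z * \<phi> z \<partial>lcube) - \<phi> x \<partial>\<nu>)"
    using I \<phi>\<nu> by simp
  also have "norm \<dots> \<le> (\<integral>x. norm ((\<integral>z. K x z * \<phi> z \<partial>lcube) - \<phi> x) \<partial>\<nu>)"
    by (rule integral_norm_bound)
  also have "\<dots> \<le> (\<integral>x. \<omega> \<partial>\<nu>)"
    using I(2) \<phi>\<nu> pw \<nu>_finite
    by (intro integral_mono integrable_norm Bochner_Integration.integrable_diff)
       (auto simp: finite_measure.integrable_const \<nu>_space)
  finally show ?thesis by (simp add: \<nu>_space mult.commute)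
qed

end

end

text \<open>Convexity of the square: \<open>norm q\<close> is at most the combination of
  \<open>norm p\<close> and \<open>t / s\<close> with weights \<open>1 - s\<close> and
  \<open>s\<close>. The error is divided by \<open>s\<close>, but the coefficient of the square of
  \<open>norm p\<close> stays at most 1.\<close>

lemma norm_square_perturbation_le:
  fixes q p :: "'a::real_inner"
  assumes "0 < s" "s \<le> 1" "norm (q - (1 - s) *\<^sub>R p) \<le> t"
  shows "(norm q)\<^sup>2 \<le> (norm p)\<^sup>2 + t\<^sup>2 / s"
proof -
  define z where "z = t / s"
  have t: "t = s * z" using assms(1) by (simp add: z_def)
  have "norm q \<le> norm ((1 - s) *\<^sub>R p) + norm (q - (1 - s) *\<^sub>R p)"
    using norm_triangle_ineq[of "(1 - s) *\<^sub>R p" "q - (1 - s) *\<^sub>R p"] by simp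
  also have "\<dots> \<le> (1 - s) * norm p + s * z" using assms by (simp add: t)
  finally have "(norm q)\<^sup>2 \<le> ((1 - s) * norm p + s * z)\<^sup>2" by (rule power_mono) simp
  \<comment> \<open>The exact defect in the convexity inequality; it is nonnegative and
    dropped.\<close>
  also have "\<dots> = (1 - s) * (norm p)\<^sup>2 + s * z\<^sup>2 - s * (1 - s) * (norm p - z)\<^sup>2"
    by (simp add: power2_eq_square algebra_simps)
  also have "\<dots> \<le> (norm p)\<^sup>2 + s * z\<^sup>2"
    using assms(1,2) by (simp add: mult_left_le_one_le add_increasing2 diff_le_eq)
  also have "s * z\<^sup>2 = t\<^sup>2 / s" using assms(1) by (simp add: z_def power2_eq_square)
  finally show ?thesis .
qed

section \<open>Coarse competitors obtained from fine ones\<close>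

context mollified begin

lemma integrable_p_square:
  assumes "finite_measure \<nu>" "sets \<nu> = sets lcube"
  shows "integrable \<nu> (\<lambda>x. (norm (p x))\<^sup>2)"
proof (rule integrable_bounded[OF assms(1)])
  have "p \<in> borel_measurable \<nu>" using p_measurable measurable_cong_cube[OF assms(2)] by blast
  then show "(\<lambda>x. (norm (p x))\<^sup>2) \<in> borel_measurable \<nu>" by measurable
  show "norm ((norm (p x))\<^sup>2) \<le> (C * N1)\<^sup>2" for x
    using power_mono[OF p_le norm_ge_zero, of x 2] by simp
qed

text \<open>Jensen at each point, then the kernel is moved from the function to the measure by
  adjointness.\<close>

lemma integral_p_square_le:
  assumes \<nu>: "finite_measure \<nu>" "sets \<nu> = sets lcube"
  shows "(\<integral>x. (norm (p x))\<^sup>2 \<partial>\<nu>) \<le> (\<integral>z. (norm (grad u z))\<^sup>2 * smoothed \<nu> z \<partial>lcube)"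
proof -
  have \<phi>: "(\<lambda>z. (norm (grad u z))\<^sup>2) \<in> borel_measurable lcube" using grad_measurable by measurable
  have bd: "\<bar>(norm (grad u z))\<^sup>2\<bar> \<le> G\<^sup>2" if "z \<in> cube" for z
    using power_mono[OF grad_le[OF that] norm_ge_zero, of 2] by simp
  have I: "(\<integral>z. (norm (grad u z))\<^sup>2 * smoothed \<nu> z \<partial>lcube) = (\<integral>x. (\<integral>z. K x z * (norm (grad u z))\<^sup>2 \<partial>lcube) \<partial>\<nu>)"
    "integrable \<nu> (\<lambda>x. \<integral>z. K x z * (norm (grad u z))\<^sup>2 \<partial>lcube)"
    by (rule integral_smoothed[OF \<nu> \<phi> bd], assumption)+
  show ?thesis
    unfolding I(1)
  proof (rule integral_mono[OF integrable_p_square[OF \<nu>] I(2)])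
    fix x assume "x \<in> space \<nu>"
    then show "(norm (p x))\<^sup>2 \<le> (\<integral>z. K x z * (norm (grad u z))\<^sup>2 \<partial>lcube)"
      by (intro p_square_le cube_subset_closure) (simp add: \<nu>_space[OF \<nu>])
  qed
qed

text \<open>The competitor \<open>w\<close> interpolates the mollified \<open>u\<close> on the
  coarse mesh; \<tau> is the gradient interpolation error per unit of \<open>N1\<close>. All errors
  are relative to \<open>N1\<close>, so they hold however fine the mesh of \<open>u\<close>
  is.\<close>

lemma coarse_competitor:
  fixes \<T> :: "nat \<Rightarrow> (real ^ 'd) set set"
  assumes T: "successive_uniform_refinements \<T>"
    and \<kappa>: "0 \<le> \<kappa>" "\<And>S. S \<in> \<T> (Suc m) \<Longrightarrow> \<exists>c r. 0 < r \<and> cball c r \<subseteq> S \<and> diameter S \<le> \<kappa> * r"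
    and h: "\<And>S. S \<in> \<T> (Suc m) \<Longrightarrow> diameter S \<le> h" "0 \<le> h"
    and \<nu>: "finite_measure \<nu>" "\<nu> \<in> M_discrete \<T> n"
    and f: "f \<in> borel_measurable lcube" "\<And>x. \<bar>f x\<bar> \<le> F"
  defines "\<tau> \<equiv> (\<kappa> + 1) * (C * h)"
  obtains w c0 where "w \<in> W_discrete \<T> m"
    "\<bar>(\<integral>x. f x * u x \<partial>lcube) - (\<integral>x. f x * (w x + c0) \<partial>lcube)\<bar>
      \<le> (F * (s * real CARD('d)) * 2 ^ CARD('d) + F * (2 * h * (C * h))) * N1"
    "(\<integral>x. (norm (grad w x))\<^sup>2 \<partial>\<nu>) \<le>
      (\<integral>z. (norm (grad u z))\<^sup>2 * smoothed \<nu> z \<partial>lcube) + measure \<nu> cube * (\<tau>\<^sup>2 / s * N1\<^sup>2)"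
    "(\<integral>x. (norm (grad w x))\<^sup>2 \<partial>lcube) \<le> (C\<^sup>2 + \<tau>\<^sup>2 / s) * N1\<^sup>2"
proof -
  have \<nu>s: "sets \<nu> = sets lcube" by (rule M_discrete_sets[OF \<nu>(2)])
  have M0: "0 \<le> C * N1" using C_nonneg N1_nonneg by simp
  have lip: "norm ((1 - s) *\<^sub>R p x - (1 - s) *\<^sub>R p c) \<le> C * N1 * norm (x - c)" for x c
  proof -
    have "norm ((1 - s) *\<^sub>R p x - (1 - s) *\<^sub>R p c) = (1 - s) * norm (p x - p c)"
      using s_le by (simp add: scaleR_diff_right[symmetric] del: scaleR_diff_right)
    also have "\<dots> \<le> norm (p x - p c)" using s_pos s_le by (simp add: mult_left_le_one_le)
    also have "\<dots> \<le> C * N1 * norm (x - c)" by (rule p_lipschitz)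
    finally show ?thesis .
  qed
  obtain w c0 where w: "w \<in> W_discrete \<T> m"
    "\<And>x. x \<in> cube \<Longrightarrow> \<bar>w x + c0 - v x\<bar> \<le> 2 * h * ((C * N1) * h)"
    "AE x in lcube. norm (grad w x - (1 - s) *\<^sub>R p x) \<le> (\<kappa> + 1) * ((C * N1) * h)"
    by (rule W_discrete_interpolation[OF T \<kappa> h(1) M0 v_first_order lip]) blast+
  have \<tau>: "(\<kappa> + 1) * ((C * N1) * h) = \<tau> * N1" by (simp add: \<tau>_def mult_ac)
  obtain L' G' where w': "L'-lipschitz_on cube w" "grad w \<in> borel_measurable lcube"
    "\<And>x. x \<in> cube \<Longrightarrow> norm (grad w x) \<le> G'"
    by (rule W_discrete_regular[OF T w(1)]) blast
  have ae: "AE x in lcube. (norm (grad w x))\<^sup>2 \<le> (norm (p x))\<^sup>2 + \<tau>\<^sup>2 / s * N1\<^sup>2"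
    using w(3)
  proof (eventually_elim)
    case (elim x)
    then have "(norm (grad w x))\<^sup>2 \<le> (norm (p x))\<^sup>2 + (\<tau> * N1)\<^sup>2 / s"
      using s_pos s_le by (intro norm_square_perturbation_le) (auto simp: \<tau>)
    then show ?case by (simp add: power_mult_distrib)
  qed
  have gw_int: "integrable M (\<lambda>x. (norm (grad w x))\<^sup>2)"
    if M: "finite_measure M" "sets M = sets lcube" for M
  proof (rule integrable_bounded[OF M(1)])
    have "grad w \<in> borel_measurable M" using w'(2) measurable_cong_cube[OF M(2)] by blast
    then show "(\<lambda>x. (norm (grad w x))\<^sup>2) \<in> borel_measurable M" by measurable
    show "norm ((norm (grad w x))\<^sup>2) \<le> G'\<^sup>2" if "x \<in> space M" for x
      using that power_mono[OF w'(3) norm_ge_zero, of x 2] by (simp add: \<nu>_space[OF M])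
  qed
  \<comment> \<open>Stated for a general measure, since it is applied both to \<nu> and to Lebesgue
    measure.\<close>
  have main: "(\<integral>x. (norm (grad w x))\<^sup>2 \<partial>M) \<le> (\<integral>x. (norm (p x))\<^sup>2 \<partial>M) + measure M cube * (\<tau>\<^sup>2 / s * N1\<^sup>2)"
    if M: "finite_measure M" "sets M = sets lcube"
      and aeM: "AE x in M. (norm (grad w x))\<^sup>2 \<le> (norm (p x))\<^sup>2 + \<tau>\<^sup>2 / s * N1\<^sup>2" for M
  proof -
    note ip = integrable_p_square[OF M]
    have ic: "integrable M (\<lambda>_. \<tau>\<^sup>2 / s * N1\<^sup>2)" using M(1) by (rule finite_measure.integrable_const)
    have "(\<integral>x. (norm (grad w x))\<^sup>2 \<partial>M) \<le> (\<integral>x. (norm (p x))\<^sup>2 + \<tau>\<^sup>2 / s * N1\<^sup>2 \<partial>M)"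
      by (rule integral_mono_AE[OF gw_int[OF M] Bochner_Integration.integrable_add[OF ip ic] aeM])
    also have "\<dots> = (\<integral>x. (norm (p x))\<^sup>2 \<partial>M) + (\<integral>x. \<tau>\<^sup>2 / s * N1\<^sup>2 \<partial>M)"
      by (rule Bochner_Integration.integral_add[OF ip ic])
    also have "(\<integral>x. \<tau>\<^sup>2 / s * N1\<^sup>2 \<partial>M) = measure M cube * (\<tau>\<^sup>2 / s * N1\<^sup>2)"
      unfolding lebesgue_integral_const by (simp add: \<nu>_space[OF M])
    finally show ?thesis .
  qed
  have 1: "\<bar>(\<integral>x. f x * u x \<partial>lcube) - (\<integral>x. f x * (w x + c0) \<partial>lcube)\<bar>
      \<le> (F * (s * real CARD('d)) * 2 ^ CARD('d) + F * (2 * h * (C * h))) * N1"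
  proof -
    have F: "0 \<le> F" using f(2)[of 0] by simp
    have "bounded (v ` cube)"
    proof -
      have "(C * N1)-lipschitz_on cube v"
        using v_lipschitz M0 by (intro lipschitz_onI) (auto simp: dist_norm cube_subset_closure)
      then show ?thesis
        by (intro bounded_uniformly_continuous_image lipschitz_on_uniformly_continuous bounded_cube)
    qed
    then obtain V where V: "\<And>x. x \<in> cube \<Longrightarrow> \<bar>v x\<bar> \<le> V" unfolding bounded_iff by auto
    let ?e = "2 * h * ((C * N1) * h)"
    have wm: "w \<in> borel_measurable lcube" by (rule W_discrete_measurable[OF w(1)])
    have fv: "integrable lcube (\<lambda>x. f x * v x)"
    proof (rule integrable_bounded[where B="F * V"])
      show "norm (f x * v x) \<le> F * V" if "x \<in> space lcube" for x
        unfolding real_norm_def abs_mult using f(2)[of x] V[of x] F that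
        by (intro mult_mono) (auto simp: space_lcube)
    qed (use f v_measurable lcube.finite_measure_axioms in auto)
    have fd: "\<bar>f x * (w x + c0 - v x)\<bar> \<le> F * ?e" if "x \<in> cube" for x
      unfolding abs_mult using f(2)[of x] w(2)[OF that] F by (intro mult_mono) auto
    have fdm: "(\<lambda>x. f x * (w x + c0 - v x)) \<in> borel_measurable lcube"
      using f(1) wm v_measurable by measurable
    have fdi: "integrable lcube (\<lambda>x. f x * (w x + c0 - v x))"
      by (rule integrable_bounded[OF lcube.finite_measure_axioms fdm, of "F * ?e"])
         (use fd in \<open>simp add: space_lcube\<close>)
    have split: "f x * (w x + c0) = f x * v x + f x * (w x + c0 - v x)" for x
      by (simp add: algebra_simps)
    have "(\<integral>x. f x * (w x + c0) \<partial>lcube) = (\<integral>x. f x * v x \<partial>lcube) + (\<integral>x. f x * (w x + c0 - v x) \<partial>lcube)"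
      unfolding split by (rule Bochner_Integration.integral_add[OF fv fdi])
    moreover have "\<bar>\<integral>x. f x * (w x + c0 - v x) \<partial>lcube\<bar> \<le> F * ?e"
    proof -
      have "\<bar>\<integral>x. f x * (w x + c0 - v x) \<partial>lcube\<bar> \<le> (\<integral>x. norm (f x * (w x + c0 - v x)) \<partial>lcube)"
        unfolding real_norm_def[symmetric] by (rule integral_norm_bound)
      also have "\<dots> \<le> (\<integral>x. F * ?e \<partial>(lcube :: (real ^ 'd) measure))"
        by (rule integral_mono[OF integrable_norm[OF fdi] lcube.integrable_const])
           (use fd in \<open>simp add: space_lcube\<close>)
      also have "\<dots> = F * ?e"
        unfolding lebesgue_integral_const by (simp add: space_lcube measure_lcube)
      finally show ?thesis .
    qed
    moreover have "\<bar>(\<integral>x. f x * u x \<partial>lcube) - (\<integral>x. f x * v x \<partial>lcube)\<bar>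
        \<le> F * (s * real CARD('d)) * 2 ^ CARD('d) * N1"
      by (rule integral_mollification_error[OF f])
    moreover have "(F * (s * real CARD('d)) * 2 ^ CARD('d) + F * (2 * h * (C * h))) * N1
        = F * (s * real CARD('d)) * 2 ^ CARD('d) * N1 + F * ?e"
      by (simp add: algebra_simps)
    ultimately show ?thesis by linarith
  qed
  have 2: "(\<integral>x. (norm (grad w x))\<^sup>2 \<partial>\<nu>) \<le>
      (\<integral>z. (norm (grad u z))\<^sup>2 * smoothed \<nu> z \<partial>lcube) + measure \<nu> cube * (\<tau>\<^sup>2 / s * N1\<^sup>2)"
    using main[OF \<nu>(1) \<nu>s M_discrete_AE[OF \<nu>(2) ae]] integral_p_square_le[OF \<nu>(1) \<nu>s] by linarith
  \<comment> \<open>The crude uniform bound on \<open>p\<close> suffices, as this term will be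
    multiplied by the small \<open>\<delta> m\<close>.\<close>
  have "(\<integral>x. (norm (p x))\<^sup>2 \<partial>lcube) \<le> (\<integral>x. (C * N1)\<^sup>2 \<partial>(lcube :: (real ^ 'd) measure))"
    using power_mono[OF p_le norm_ge_zero, of _ 2]
    by (intro integral_mono integrable_p_square lcube.integrable_const lcube.finite_measure_axioms refl)
  then have "(\<integral>x. (norm (p x))\<^sup>2 \<partial>lcube) \<le> C\<^sup>2 * N1\<^sup>2"
    unfolding lebesgue_integral_const by (simp add: space_lcube measure_lcube power_mult_distrib)
  with main[OF lcube.finite_measure_axioms refl ae]
  have 3: "(\<integral>x. (norm (grad w x))\<^sup>2 \<partial>lcube) \<le> (C\<^sup>2 + \<tau>\<^sup>2 / s) * N1\<^sup>2"
    by (simp add: measure_lcube algebra_simps)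
  show thesis by (rule that[OF w(1) 1 2 3])
qed

end

section \<open>Energy estimates\<close>

lemma integral_density_cube:
  assumes g: "g \<in> borel_measurable lcube" "\<And>x. x \<in> cube \<Longrightarrow> 0 \<le> g x"
    and \<phi>: "\<phi> \<in> borel_measurable lcube"
  shows "(\<integral>x. \<phi> x \<partial>density lcube (\<lambda>x. ennreal (g x))) = (\<integral>x. \<phi> x * g x \<partial>lcube :: real)"
  using integral_density[OF \<phi> g(1)] g(2) AE_I2[of lcube "\<lambda>x. 0 \<le> g x"]
  by (simp add: space_lcube mult.commute)

lemma density_cube_Mplus:
  fixes g :: "real ^ 'd \<Rightarrow> real"
  assumes g: "g \<in> borel_measurable lcube" "\<And>x. x \<in> cube \<Longrightarrow> g x \<le> D"
  shows "density lcube (\<lambda>x. ennreal (g x)) \<in> Mplus"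
proof -
  let ?\<nu> = "density lcube (\<lambda>x. ennreal (g x))"
  have "emeasure ?\<nu> cube = (\<integral>\<^sup>+x. ennreal (g x) * indicator cube x \<partial>lcube)"
    using g(1) by (intro emeasure_density) (auto simp: sets_restrict_space_iff)
  also have "\<dots> \<le> (\<integral>\<^sup>+x. ennreal D \<partial>(lcube :: (real ^ 'd) measure))"
    using g(2) by (intro nn_integral_mono) (auto simp: space_lcube ennreal_leI)
  also have "\<dots> = ennreal D"
    by (simp add: space_lcube emeasure_lcube)
  finally have "emeasure ?\<nu> cube < \<infinity>"
    by (rule le_less_trans) simp
  then have "finite_measure ?\<nu>" by (intro finite_measureI) (auto simp: space_lcube)
  then show ?thesis unfolding Mplus_def by (simp add: space_lcube sets_lcube)
qed

lemma quadratic_absorption: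
  fixes a \<epsilon> N :: real
  assumes "0 < \<epsilon>"
  shows "2 * a * N - \<epsilon> / 2 * N\<^sup>2 \<le> 2 * a\<^sup>2 / \<epsilon>"
proof -
  have "0 \<le> (\<epsilon> * N - 2 * a)\<^sup>2" by simp
  then have "\<epsilon> * (4 * a * N - \<epsilon> * N\<^sup>2) \<le> 4 * a\<^sup>2" by (simp add: power2_eq_square algebra_simps)
  then have "4 * a * N - \<epsilon> * N\<^sup>2 \<le> 4 * a\<^sup>2 / \<epsilon>" using assms by (simp add: pos_le_divide_eq mult.commute)
  then show ?thesis by simp
qed

context mollified begin

text \<open>Here \<open>D\<close> stands for \<open>\<delta> m\<close>. The reserve \<epsilon> in
  \<open>g\<close> yields \<epsilon> times the square of \<open>N1\<close>: a quarter pays for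
  interpolation against \<nu>, a quarter for the \<open>D\<close> term of the coarse competitor, and
  the remaining half absorbs the linear error at the price
  \<open>2 * a\<^sup>2 / \<epsilon>\<close>.\<close>

lemma fine_energy_estimate:
  fixes \<T> :: "nat \<Rightarrow> (real ^ 'd) set set"
  assumes T: "successive_uniform_refinements \<T>"
    and \<kappa>: "0 \<le> \<kappa>" "\<And>S. S \<in> \<T> (Suc m) \<Longrightarrow> \<exists>c r. 0 < r \<and> cball c r \<subseteq> S \<and> diameter S \<le> \<kappa> * r"
    and h: "\<And>S. S \<in> \<T> (Suc m) \<Longrightarrow> diameter S \<le> h" "0 \<le> h"
    and \<nu>: "finite_measure \<nu>" "\<nu> \<in> M_discrete \<T> n"
    and f: "f \<in> borel_measurable lcube" "\<And>x. \<bar>f x\<bar> \<le> F"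
    and g: "g \<in> borel_measurable lcube" "\<And>z. z \<in> cube \<Longrightarrow> smoothed \<nu> z + \<epsilon> \<le> g z"
      "\<And>z. z \<in> cube \<Longrightarrow> g z \<le> B'" and \<epsilon>: "0 < \<epsilon>"
    and a: "F * (s * real CARD('d)) * 2 ^ CARD('d) + F * (2 * h * (C * h)) \<le> a"
    and small: "measure \<nu> cube * (((\<kappa> + 1) * (C * h))\<^sup>2 / s) \<le> \<epsilon> / 4"
      "D * (C\<^sup>2 + ((\<kappa> + 1) * (C * h))\<^sup>2 / s) \<le> \<epsilon> / 4" "0 \<le> D"
    and R: "\<And>w c0. w \<in> W_discrete \<T> m \<Longrightarrow> 2 * (\<integral>x. f x * (w x + c0) \<partial>lcube) -
      ((\<integral>x. (norm (grad w x))\<^sup>2 \<partial>\<nu>) + D * (\<integral>x. (norm (grad w x))\<^sup>2 \<partial>lcube)) \<le> R"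
  shows "2 * (\<integral>x. f x * u x \<partial>lcube) -
      (\<integral>x. (norm (grad u x))\<^sup>2 \<partial>density lcube (\<lambda>x. ennreal (g x))) \<le> R + 2 * a\<^sup>2 / \<epsilon>"
proof -
  let ?\<tau> = "(\<kappa> + 1) * (C * h)"
  have \<nu>s: "sets \<nu> = sets lcube" by (rule M_discrete_sets[OF \<nu>(2)])
  obtain w c0 where w: "w \<in> W_discrete \<T> m"
    "\<bar>(\<integral>x. f x * u x \<partial>lcube) - (\<integral>x. f x * (w x + c0) \<partial>lcube)\<bar>
      \<le> (F * (s * real CARD('d)) * 2 ^ CARD('d) + F * (2 * h * (C * h))) * N1"
    "(\<integral>x. (norm (grad w x))\<^sup>2 \<partial>\<nu>) \<le>
      (\<integral>z. (norm (grad u z))\<^sup>2 * smoothed \<nu> z \<partial>lcube) + measure \<nu> cube * (?\<tau>\<^sup>2 / s * N1\<^sup>2)"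
    "(\<integral>x. (norm (grad w x))\<^sup>2 \<partial>lcube) \<le> (C\<^sup>2 + ?\<tau>\<^sup>2 / s) * N1\<^sup>2"
    by (rule coarse_competitor[OF T \<kappa> h \<nu> f]) blast+
  define fu where "fu = (\<integral>x. f x * u x \<partial>lcube)"
  define fw where "fw = (\<integral>x. f x * (w x + c0) \<partial>lcube)"
  define Su where "Su = (\<integral>z. (norm (grad u z))\<^sup>2 * smoothed \<nu> z \<partial>lcube)"
  define gu where "gu = (\<integral>x. (norm (grad u x))\<^sup>2 \<partial>density lcube (\<lambda>x. ennreal (g x)))"
  define w\<nu> where "w\<nu> = (\<integral>x. (norm (grad w x))\<^sup>2 \<partial>\<nu>)"
  define wl where "wl = (\<integral>x. (norm (grad w x))\<^sup>2 \<partial>lcube)"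
  have gm: "(\<lambda>x. (norm (grad u x))\<^sup>2) \<in> borel_measurable lcube" using grad_measurable by measurable
  have g_nonneg: "0 \<le> g x" if "x \<in> cube" for x
    using g(2)[OF that] smoothed_nonneg[OF \<nu>(1) \<nu>s, of x] \<epsilon> by linarith
  have grad2: "(norm (grad u x))\<^sup>2 \<le> G\<^sup>2" if "x \<in> cube" for x
    using power_mono[OF grad_le[OF that] norm_ge_zero, of 2] .
  have gu_eq: "gu = (\<integral>x. (norm (grad u x))\<^sup>2 * g x \<partial>lcube)"
    unfolding gu_def by (rule integral_density_cube[OF g(1) g_nonneg gm])
  have int_S: "integrable lcube (\<lambda>x. (norm (grad u x))\<^sup>2 * smoothed \<nu> x)"
  proof (rule integrable_bounded[where B="G\<^sup>2 * (C * measure \<nu> cube)"])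
    show "(\<lambda>x. (norm (grad u x))\<^sup>2 * smoothed \<nu> x) \<in> borel_measurable lcube"
      using gm smoothed_measurable[OF \<nu>(1) \<nu>s] by (rule borel_measurable_times)
    show "norm ((norm (grad u x))\<^sup>2 * smoothed \<nu> x) \<le> G\<^sup>2 * (C * measure \<nu> cube)" if "x \<in> space lcube" for x
      unfolding norm_mult using grad2[of x] smoothed_nonneg[OF \<nu>(1) \<nu>s, of x] smoothed_le[OF \<nu>(1) \<nu>s, of x] that
      by (intro mult_mono) (auto simp: space_lcube)
  qed (rule lcube.finite_measure_axioms)
  have int_g: "integrable lcube (\<lambda>x. (norm (grad u x))\<^sup>2 * g x)"
  proof (rule integrable_bounded[where B="G\<^sup>2 * B'"])
    show "(\<lambda>x. (norm (grad u x))\<^sup>2 * g x) \<in> borel_measurable lcube"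
      using gm g(1) by (rule borel_measurable_times)
    show "norm ((norm (grad u x))\<^sup>2 * g x) \<le> G\<^sup>2 * B'" if "x \<in> space lcube" for x
      unfolding norm_mult using grad2[of x] g_nonneg[of x] g(3)[of x] that
      by (intro mult_mono) (auto simp: space_lcube)
  qed (rule lcube.finite_measure_axioms)
  have "Su + \<epsilon> * N2 = (\<integral>x. (norm (grad u x))\<^sup>2 * smoothed \<nu> x + \<epsilon> * (norm (grad u x))\<^sup>2 \<partial>lcube)"
    unfolding Su_def N2_def using int_S integrable_norm_grad_square by simp
  also have "\<dots> \<le> gu"
    unfolding gu_eq
  proof (rule integral_mono[OF _ int_g])
    show "integrable lcube (\<lambda>x. (norm (grad u x))\<^sup>2 * smoothed \<nu> x + \<epsilon> * (norm (grad u x))\<^sup>2)"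
      using int_S integrable_norm_grad_square by simp
    fix x :: "real ^ 'd" assume "x \<in> space lcube"
    then have "(norm (grad u x))\<^sup>2 * (smoothed \<nu> x + \<epsilon>) \<le> (norm (grad u x))\<^sup>2 * g x"
      using g(2) by (intro mult_left_mono) (auto simp: space_lcube)
    then show "(norm (grad u x))\<^sup>2 * smoothed \<nu> x + \<epsilon> * (norm (grad u x))\<^sup>2 \<le> (norm (grad u x))\<^sup>2 * g x"
      by (simp add: algebra_simps)
  qed
  finally have gu: "Su + \<epsilon> * N2 \<le> gu" .
  have N: "\<epsilon> * N1\<^sup>2 \<le> \<epsilon> * N2" using N1_square_le \<epsilon> by (intro mult_left_mono) auto
  have 1: "fu \<le> fw + a * N1"
  proof -
    have "fu - fw \<le> (F * (s * real CARD('d)) * 2 ^ CARD('d) + F * (2 * h * (C * h))) * N1"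
      using w(2) unfolding fu_def fw_def by linarith
    also have "\<dots> \<le> a * N1" using a N1_nonneg by (rule mult_right_mono)
    finally show ?thesis by linarith
  qed
  have 2: "w\<nu> \<le> Su + \<epsilon> / 4 * N1\<^sup>2"
  proof -
    have "measure \<nu> cube * (?\<tau>\<^sup>2 / s * N1\<^sup>2) \<le> \<epsilon> / 4 * N1\<^sup>2"
      using mult_right_mono[OF small(1), of "N1\<^sup>2"] by (simp only: mult.assoc zero_le_power2 simp_thms)
    then show ?thesis using w(3) unfolding w\<nu>_def Su_def by linarith
  qed
  have 3: "D * wl \<le> \<epsilon> / 4 * N1\<^sup>2"
  proof -
    have "D * ((C\<^sup>2 + ?\<tau>\<^sup>2 / s) * N1\<^sup>2) \<le> \<epsilon> / 4 * N1\<^sup>2"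
      using mult_right_mono[OF small(2), of "N1\<^sup>2"] by (simp only: mult.assoc zero_le_power2 simp_thms)
    then show ?thesis using mult_left_mono[OF w(4) small(3)] unfolding wl_def by linarith
  qed
  have 4: "2 * fw - (w\<nu> + D * wl) \<le> R" unfolding fw_def w\<nu>_def wl_def by (rule R[OF w(1)])
  have 5: "2 * a * N1 - \<epsilon> / 2 * N1\<^sup>2 \<le> 2 * a\<^sup>2 / \<epsilon>" by (rule quadratic_absorption[OF \<epsilon>])
  have "2 * fu - gu \<le> R + 2 * a\<^sup>2 / \<epsilon>"
    using 1 2 3 4 5 gu N by (simp add: algebra_simps)
  then show ?thesis unfolding fu_def gu_def .
qed

end

lemma energy_leD:
  assumes "energy f \<T> \<delta> n m \<nu> \<le> ereal e"
  shows "\<nu> \<in> M_discrete \<T> n"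
    "w \<in> W_discrete \<T> m \<Longrightarrow> 2 * (\<integral>x. f x * w x \<partial>lebesgue_on cube) - ((\<integral>x. (norm (grad w x))\<^sup>2 \<partial>\<nu>)
      + \<delta> m * (\<integral>x. (norm (grad w x))\<^sup>2 \<partial>lebesgue_on cube)) + measure \<nu> cube \<le> e"
proof -
  let ?J = "\<lambda>w. 2 * (\<integral>x. f x * w x \<partial>lebesgue_on cube) - ((\<integral>x. (norm (grad w x))\<^sup>2 \<partial>\<nu>)
      + \<delta> m * (\<integral>x. (norm (grad w x))\<^sup>2 \<partial>lebesgue_on cube))"
  show \<nu>: "\<nu> \<in> M_discrete \<T> n" using assms unfolding energy_def by (auto split: if_splits)
  assume w: "w \<in> W_discrete \<T> m"
  have "ereal (?J w) + ereal (measure \<nu> cube) \<le> (SUP u\<in>W_discrete \<T> m. ereal (?J u)) + ereal (measure \<nu> cube)"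
    using w by (intro add_right_mono SUP_upper)
  also have "\<dots> \<le> ereal e" using assms \<nu> unfolding energy_def by simp
  finally show "?J w + measure \<nu> cube \<le> e" by simp
qed

lemma energy_leI:
  assumes "\<nu> \<in> M_discrete \<T> n"
    and "\<And>w. w \<in> W_discrete \<T> m \<Longrightarrow> 2 * (\<integral>x. f x * w x \<partial>lebesgue_on cube) - ((\<integral>x. (norm (grad w x))\<^sup>2 \<partial>\<nu>)
      + \<delta> m * (\<integral>x. (norm (grad w x))\<^sup>2 \<partial>lebesgue_on cube)) + measure \<nu> cube \<le> e"
  shows "energy f \<T> \<delta> n m \<nu> \<le> ereal e"
proof -
  let ?J = "\<lambda>w. 2 * (\<integral>x. f x * w x \<partial>lebesgue_on cube) - ((\<integral>x. (norm (grad w x))\<^sup>2 \<partial>\<nu>)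
      + \<delta> m * (\<integral>x. (norm (grad w x))\<^sup>2 \<partial>lebesgue_on cube))"
  have "(SUP u\<in>W_discrete \<T> m. ereal (?J u)) \<le> ereal (e - measure \<nu> cube)"
  proof (rule SUP_least)
    fix w assume "w \<in> W_discrete \<T> m"
    from assms(2)[OF this] show "ereal (?J w) \<le> ereal (e - measure \<nu> cube)" by simp
  qed
  then have "(SUP u\<in>W_discrete \<T> m. ereal (?J u)) + ereal (measure \<nu> cube) \<le> ereal (e - measure \<nu> cube) + ereal (measure \<nu> cube)"
    by (rule add_right_mono)
  then show ?thesis using assms(1) unfolding energy_def by simp
qed

section \<open>Monotonicity of the energies in both indices\<close>

lemma W_discrete_mono:
  assumes T: "successive_uniform_refinements \<T>"
  shows "W_discrete \<T> m \<subseteq> W_discrete \<T> (Suc m)"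
proof
  fix u assume "u \<in> W_discrete \<T> m"
  then have u: "continuous_on cube u" "\<forall>S\<in>\<T> (Suc m). \<exists>a b. \<forall>x\<in>S \<inter> cube. u x = a \<bullet> x + b"
    "(\<integral>x. u x \<partial>lebesgue_on cube) = 0"
    unfolding W_discrete_def by simp_all
  have "\<forall>S\<in>\<T> (Suc (Suc m)). \<exists>a b. \<forall>x\<in>S \<inter> cube. u x = a \<bullet> x + b"
  proof
    fix S assume S: "S \<in> \<T> (Suc (Suc m))"
    have "uniform_refinement (\<T> (Suc m)) (\<T> (Suc (Suc m)))"
      using T unfolding successive_uniform_refinements_def by blast
    then obtain S0 where S0: "S0 \<in> \<T> (Suc m)" "S \<subseteq> S0"
      using S unfolding uniform_refinement_def by blast
    obtain a b where "\<forall>x\<in>S0 \<inter> cube. u x = a \<bullet> x + b" using u(2) S0(1) by blast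
    then have "\<forall>x\<in>S \<inter> cube. u x = a \<bullet> x + b" using S0(2) by blast
    then show "\<exists>a b. \<forall>x\<in>S \<inter> cube. u x = a \<bullet> x + b" by blast
  qed
  with u(1,3) show "u \<in> W_discrete \<T> (Suc m)" unfolding W_discrete_def by simp
qed

lemma M_discrete_mono:
  assumes T: "successive_uniform_refinements \<T>"
  shows "M_discrete \<T> n \<subseteq> M_discrete \<T> (Suc n)"
proof
  fix \<nu> assume "\<nu> \<in> M_discrete \<T> n"
  then obtain g where g: "\<nu> = density lcube (\<lambda>x. ennreal (g x))" "g \<in> borel_measurable lcube"
    "\<forall>x\<in>cube. 0 \<le> g x" "\<forall>S\<in>\<T> n. \<exists>c. AE x in lcube. x \<in> S \<longrightarrow> g x = c"
    unfolding M_discrete_def by blast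
  have "\<exists>c. AE x in lcube. x \<in> S \<longrightarrow> g x = c" if S: "S \<in> \<T> (Suc n)" for S
  proof -
    have "uniform_refinement (\<T> n) (\<T> (Suc n))"
      using T unfolding successive_uniform_refinements_def by blast
    then obtain S0 where S0: "S0 \<in> \<T> n" "S \<subseteq> S0"
      using S unfolding uniform_refinement_def by blast
    then obtain c where "AE x in lcube. x \<in> S0 \<longrightarrow> g x = c" using g(4) by blast
    then have "AE x in lcube. x \<in> S \<longrightarrow> g x = c" by eventually_elim (use S0(2) in blast)
    then show ?thesis by blast
  qed
  then show "\<nu> \<in> M_discrete \<T> (Suc n)" unfolding M_discrete_def using g(1-3) by blast
qed

lemma energy_antimono_left:
  assumes T: "successive_uniform_refinements \<T>" and "n \<le> n'"
  shows "energy f \<T> \<delta> n' m \<mu> \<le> energy f \<T> \<delta> n m \<mu>"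
proof -
  have "energy f \<T> \<delta> (Suc n) m \<mu> \<le> energy f \<T> \<delta> n m \<mu>" for n
  proof (cases "\<mu> \<in> M_discrete \<T> n")
    case True
    then have "\<mu> \<in> M_discrete \<T> (Suc n)" using M_discrete_mono[OF T] by blast
    with True show ?thesis unfolding energy_def by simp
  qed (simp add: energy_def)
  then show ?thesis
    using lift_Suc_antimono_le[of "\<lambda>n. energy f \<T> \<delta> n m \<mu>"] assms(2) by blast
qed

lemma energy_mono_right:
  assumes T: "successive_uniform_refinements \<T>" and \<delta>: "decseq \<delta>" and "m \<le> m'"
  shows "energy f \<T> \<delta> n m \<mu> \<le> energy f \<T> \<delta> n m' \<mu>"
proof -
  have "energy f \<T> \<delta> n m \<mu> \<le> energy f \<T> \<delta> n (Suc m) \<mu>" for m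
  proof (cases "\<mu> \<in> M_discrete \<T> n")
    case True
    let ?J = "\<lambda>m u. ereal (2 * (\<integral>x. f x * u x \<partial>lebesgue_on cube) - ((\<integral>x. (norm (grad u x))\<^sup>2 \<partial>\<mu>)
      + \<delta> m * (\<integral>x. (norm (grad u x))\<^sup>2 \<partial>lebesgue_on cube)))"
    have "(SUP u\<in>W_discrete \<T> m. ?J m u) \<le> (SUP u\<in>W_discrete \<T> (Suc m). ?J (Suc m) u)"
    proof (rule SUP_mono)
      fix u assume "u \<in> W_discrete \<T> m"
      then have u: "u \<in> W_discrete \<T> (Suc m)" using W_discrete_mono[OF T] by blast
      have "\<delta> (Suc m) * (\<integral>x. (norm (grad u x))\<^sup>2 \<partial>lebesgue_on cube)
          \<le> \<delta> m * (\<integral>x. (norm (grad u x))\<^sup>2 \<partial>lebesgue_on cube)"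
        using decseq_SucD[OF \<delta>] by (intro mult_right_mono) auto
      then have "?J m u \<le> ?J (Suc m) u" by simp
      with u show "\<exists>u'\<in>W_discrete \<T> (Suc m). ?J m u \<le> ?J (Suc m) u'" by blast
    qed
    then show ?thesis unfolding energy_def using True by (simp add: add_right_mono)
  qed (simp add: energy_def)
  then show ?thesis
    using lift_Suc_mono_le[of "\<lambda>m. energy f \<T> \<delta> n m \<mu>"] assms(3) by blast
qed

section \<open>Construction of the recovery measure\<close>

lemma eventually_osc_small:
  fixes \<phi> :: "real ^ 'd \<Rightarrow> real"
  assumes \<phi>: "continuous_on (closure cube) \<phi>" and "0 < \<omega>"
  shows "\<forall>\<^sub>F s in at_right (0::real). \<forall>x\<in>closure cube. \<forall>z\<in>closure cube.
    norm (z - x) \<le> s * real CARD('d) \<longrightarrow> \<bar>\<phi> z - \<phi> x\<bar> \<le> \<omega>"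
proof -
  have "uniformly_continuous_on (closure cube) \<phi>"
    using \<phi> by (intro compact_uniformly_continuous) (simp_all add: closure_cube)
  then obtain \<rho> where \<rho>: "\<rho> > 0"
    "\<And>x z. x \<in> closure cube \<Longrightarrow> z \<in> closure cube \<Longrightarrow> dist z x < \<rho> \<Longrightarrow> dist (\<phi> z) (\<phi> x) < \<omega>"
    using \<open>0 < \<omega>\<close> unfolding uniformly_continuous_on_def by blast
  have "((\<lambda>s. s * real CARD('d)) \<longlongrightarrow> 0 * real CARD('d)) (at_right 0)"
    by (intro tendsto_intros)
  then have "\<forall>\<^sub>F s in at_right 0. s * real CARD('d) < \<rho>"
    using \<rho>(1) by (intro order_tendstoD(2)) auto
  then show ?thesis
  proof (eventually_elim)
    case (elim s)
    show ?case
    proof (intro ballI impI)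
      fix x z :: "real ^ 'd" assume "x \<in> closure cube" "z \<in> closure cube" "norm (z - x) \<le> s * real CARD('d)"
      then have "dist (\<phi> z) (\<phi> x) < \<omega>" using elim by (intro \<rho>(2)) (auto simp: dist_norm)
      then show "\<bar>\<phi> z - \<phi> x\<bar> \<le> \<omega>" by (simp add: dist_real_def)
    qed
  qed
qed

lemma continuous_family_bounded:
  assumes "finite \<Phi>" "\<And>\<phi>. \<phi> \<in> \<Phi> \<Longrightarrow> continuous_on (closure cube :: (real ^ 'd) set) (\<phi> :: real ^ 'd \<Rightarrow> real)"
  shows "\<exists>A\<ge>0. \<forall>\<phi>\<in>\<Phi>. \<forall>x\<in>closure cube. \<bar>\<phi> x\<bar> \<le> A"
  using assms
proof (induction \<Phi> rule: finite_induct)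
  case (insert \<phi> \<Phi>)
  then obtain A where A: "A \<ge> 0" "\<forall>\<phi>\<in>\<Phi>. \<forall>x\<in>closure cube. \<bar>\<phi> x\<bar> \<le> A" by blast
  have "bounded (\<phi> ` closure cube)"
    using insert.prems[of \<phi>] by (intro compact_imp_bounded compact_continuous_image) (simp_all add: closure_cube)
  then obtain A' where "\<forall>x\<in>closure cube. \<bar>\<phi> x\<bar> \<le> A'" unfolding bounded_iff by auto
  then have "\<forall>\<phi>'\<in>insert \<phi> \<Phi>. \<forall>x\<in>closure cube. \<bar>\<phi>' x\<bar> \<le> max A A'" using A(2) by fastforce
  then show ?case using A(1) by (intro exI[of _ "max A A'"]) auto
qed auto

lemma integrable_cube_mult:
  fixes \<phi> g :: "real ^ 'd \<Rightarrow> real"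
  assumes "\<phi> \<in> borel_measurable lcube" "\<And>x. x \<in> cube \<Longrightarrow> \<bar>\<phi> x\<bar> \<le> b" "integrable lcube g"
  shows "integrable lcube (\<lambda>x. \<phi> x * g x)"
proof (rule Bochner_Integration.integrable_bound)
  show "integrable lcube (\<lambda>x. b * g x)" using assms(3) by simp
  show "(\<lambda>x. \<phi> x * g x) \<in> borel_measurable lcube"
    using assms(1) borel_measurable_integrable[OF assms(3)] by (rule borel_measurable_times)
  show "AE x in lcube. norm (\<phi> x * g x) \<le> norm (b * g x)"
  proof (rule AE_I2)
    fix x :: "real ^ 'd" assume "x \<in> space lcube"
    then have "\<bar>\<phi> x\<bar> \<le> \<bar>b\<bar>" using assms(2)[of x] by (simp add: space_lcube)
    then show "norm (\<phi> x * g x) \<le> norm (b * g x)" by (simp add: abs_mult mult_right_mono)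
  qed
qed

text \<open>The order of choices avoids circularity: \<epsilon> and \<omega> come from the data,
  then \<open>s\<close>, then the coarse mesh size \<open>h\<close> from \<open>s\<close>, then
  \<open>m\<close>, and only then \<nu> and the level \<open>n\<close>. Until \<nu> is available,
  its mass is represented by the bound \<open>e1\<close>.\<close>

lemma energy_limit_recovery:
  fixes f :: "real ^ 'd \<Rightarrow> real" and \<T> :: "nat \<Rightarrow> (real ^ 'd) set set" and \<mu> :: "(real ^ 'd) measure"
  assumes f: "f \<in> L_infinity cube" "(\<integral>x. f x \<partial>lebesgue_on cube) = 0"
    and T: "successive_uniform_refinements \<T>"
    and \<delta>: "\<And>m. 0 < \<delta> m" "\<delta> \<longlonglongrightarrow> 0"
    and U: "openin weak_star U" "\<mu> \<in> U" and e: "energy_limit f \<T> \<delta> \<mu> < ereal e"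
  shows "\<exists>n. \<exists>\<nu>\<in>U. \<forall>k. energy f \<T> \<delta> n k \<nu> \<le> ereal e"
proof -
  have \<mu>: "\<mu> \<in> Mplus" using U openin_subset topspace_weak_star by blast
  obtain e' where e': "energy_limit f \<T> \<delta> \<mu> < ereal e'" "e' < e"
    using ereal_dense2[OF e] by auto
  obtain f1 F where f1: "f1 \<in> borel_measurable lcube" "0 \<le> F" "\<And>x. \<bar>f1 x\<bar> \<le> F"
    "\<And>u. u \<in> borel_measurable lcube \<Longrightarrow>
      (\<integral>x. f x * u x \<partial>lebesgue_on cube) = (\<integral>x. f1 x * u x \<partial>lcube)"
    by (rule L_infinity_borel_representative[OF f(1)]) blast
  have f1_0: "(\<integral>x. f1 x \<partial>lcube) = 0"
    using f1(4)[of "\<lambda>_. 1"] f(2) by simp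
  have f1_integrable: "integrable lcube f1"
    by (rule integrable_bounded[OF lcube.finite_measure_axioms f1(1), of F]) (use f1(3) in simp)
  from weak_star_neighbourhood_basis[OF U]
  obtain \<Phi> r where \<Phi>: "finite \<Phi>" "0 < (r::real)" "\<forall>\<phi>\<in>\<Phi>. continuous_on (closure cube) \<phi>"
    and basis: "\<forall>\<nu>\<in>Mplus. (\<forall>\<phi>\<in>\<Phi>. \<bar>(\<integral>x. \<phi> x \<partial>\<nu>) - (\<integral>x. \<phi> x \<partial>\<mu>)\<bar> < r) \<longrightarrow> \<nu> \<in> U"
    by (elim exE conjE) (rule that)
  note \<Phi>_cont = bspec[OF \<Phi>(3)]
  obtain A where A: "A \<ge> 0" "\<forall>\<phi>\<in>\<Phi>. \<forall>x\<in>closure cube. \<bar>\<phi> x\<bar> \<le> A"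
    using continuous_family_bounded[OF \<Phi>(1) \<Phi>_cont] by blast
  \<comment> \<open>The gap \<gamma> is shared equally between the extra mass of \<nu>' and the
    linear error. The tolerance \<open>r\<close> is split into thirds: rounding, smoothing, and the
    distance from \<nu> to \<mu>.\<close>
  define \<gamma> where "\<gamma> = e - e'"
  \<comment> \<open>An advance bound for the mass of \<nu>; the added 1 makes it positive.\<close>
  define e1 where "e1 = \<bar>e'\<bar> + 1"
  define \<epsilon> where "\<epsilon> = min (\<gamma> / 6) (r / (9 * (A + 1)))"
  define \<omega> where "\<omega> = r / (3 * e1)"
  have \<gamma>: "0 < \<gamma>" and e1: "1 \<le> e1" "e' \<le> e1" using e'(2) by (auto simp: \<gamma>_def e1_def)
  have \<epsilon>: "0 < \<epsilon>" "3 * \<epsilon> \<le> \<gamma> / 2" using \<gamma> \<Phi>(2) A(1) by (auto simp: \<epsilon>_def)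
  have \<epsilon>A: "3 * \<epsilon> * A \<le> r / 3"
  proof -
    have "\<epsilon> * (9 * (A + 1)) \<le> r"
      using A(1) by (subst pos_le_divide_eq[symmetric]) (auto simp: \<epsilon>_def)
    then show ?thesis using \<epsilon>(1) by (simp add: algebra_simps)
  qed
  have \<omega>: "0 < \<omega>" "\<omega> * e1 = r / 3" using \<Phi>(2) e1 by (auto simp: \<omega>_def)

  \<comment> \<open>The linear error will be at most \<open>s * F'\<close>: the first summand is the
    mollification error divided by \<open>s\<close>, and the 1 reserves room for an interpolation
    error below \<open>s\<close>.\<close>
  define F' where "F' = F * real CARD('d) * 2 ^ CARD('d) + 1"
  have "\<forall>\<^sub>F s in at_right 0. 2 * (s * F')\<^sup>2 / \<epsilon> < \<gamma> / 2"
  proof -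
    have "((\<lambda>s. 2 * (s * F')\<^sup>2 / \<epsilon>) \<longlongrightarrow> 2 * (0 * F')\<^sup>2 / \<epsilon>) (at_right 0)"
      using \<epsilon>(1) by (intro tendsto_intros) auto
    then show ?thesis using \<gamma> by (intro order_tendstoD(2)) auto
  qed
  moreover have "\<forall>\<^sub>F s in at_right (0::real). \<forall>\<phi>\<in>\<Phi>. \<forall>x\<in>closure cube. \<forall>z\<in>closure cube.
    norm (z - x) \<le> s * real CARD('d) \<longrightarrow> \<bar>\<phi> z - \<phi> x\<bar> \<le> \<omega>"
    using eventually_osc_small[OF \<Phi>_cont \<omega>(1)] \<Phi>(1) by (intro eventually_ball_finite) auto
  moreover have "\<forall>\<^sub>F s in at_right (0::real). 0 < s \<and> s < 1/2"
    unfolding eventually_at_right_field by (intro exI[of _ "1/2"]) auto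
  ultimately have "\<forall>\<^sub>F s in at_right (0::real). 2 * (s * F')\<^sup>2 / \<epsilon> < \<gamma> / 2 \<and> (\<forall>\<phi>\<in>\<Phi>. \<forall>x\<in>closure cube. \<forall>z\<in>closure cube.
    norm (z - x) \<le> s * real CARD('d) \<longrightarrow> \<bar>\<phi> z - \<phi> x\<bar> \<le> \<omega>) \<and> 0 < s \<and> s < 1/2"
    by eventually_elim simp
  from eventually_happens'[OF trivial_limit_at_right_real this]
  obtain s where s: "2 * (s * F')\<^sup>2 / \<epsilon> < \<gamma> / 2"
    "\<forall>\<phi>\<in>\<Phi>. \<forall>x\<in>closure cube. \<forall>z\<in>closure cube. norm (z - x) \<le> s * real CARD('d) \<longrightarrow> \<bar>\<phi> z - \<phi> x\<bar> \<le> \<omega>"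
    "0 < s" "s < 1/2"
    by blast
  obtain k :: "real ^ 'd \<Rightarrow> real" and B where k: "\<And>y. 0 \<le> k y" "\<And>y. k y \<le> B" "\<And>y. y \<notin> cube \<Longrightarrow> k y = 0"
    "\<And>x y. \<bar>k x - k y\<bar> \<le> B * norm (x - y)" "(\<integral>y. k y \<partial>lcube) = 1"
    by (rule exists_lipschitz_cube_density) blast
  interpret cube_kernel k B s
    using k s(3,4) by unfold_locales auto
  obtain \<kappa> where \<kappa>: "0 < \<kappa>" "\<And>n S. S \<in> \<T> n \<Longrightarrow> \<exists>c r. 0 < r \<and> cball c r \<subseteq> S \<and> diameter S \<le> \<kappa> * r"
    using T unfolding successive_uniform_refinements_def shape_regular_def by blast

  have "\<forall>\<^sub>F h in at_right 0. F * (2 * h * (C * h)) < s"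
  proof -
    have "((\<lambda>h. F * (2 * h * (C * h))) \<longlongrightarrow> F * (2 * 0 * (C * 0))) (at_right 0)"
      by (intro tendsto_intros)
    then show ?thesis using s(3) by (intro order_tendstoD(2)) auto
  qed
  moreover have "\<forall>\<^sub>F h in at_right 0. ((\<kappa> + 1) * (C * h))\<^sup>2 / s < \<epsilon> / (4 * e1)"
  proof -
    have "((\<lambda>h. ((\<kappa> + 1) * (C * h))\<^sup>2 / s) \<longlongrightarrow> ((\<kappa> + 1) * (C * 0))\<^sup>2 / s) (at_right 0)"
      using s(3) by (intro tendsto_intros) auto
    then show ?thesis using \<epsilon>(1) e1 by (intro order_tendstoD(2)) auto
  qed
  moreover have "\<forall>\<^sub>F h in at_right (0::real). 0 < h"
    by (simp add: eventually_at_right_less)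
  ultimately have "\<forall>\<^sub>F h in at_right 0. F * (2 * h * (C * h)) < s \<and> ((\<kappa> + 1) * (C * h))\<^sup>2 / s < \<epsilon> / (4 * e1) \<and> 0 < h"
    by eventually_elim simp
  from eventually_happens'[OF trivial_limit_at_right_real this]
  obtain h where h: "F * (2 * h * (C * h)) < s" "((\<kappa> + 1) * (C * h))\<^sup>2 / s < \<epsilon> / (4 * e1)" "0 < h"
    by blast
  let ?\<tau>2 = "((\<kappa> + 1) * (C * h))\<^sup>2 / s"
  have \<tau>2: "e1 * ?\<tau>2 \<le> \<epsilon> / 4" "?\<tau>2 \<le> \<epsilon>"
  proof -
    show *: "e1 * ?\<tau>2 \<le> \<epsilon> / 4" using mult_left_mono[OF less_imp_le[OF h(2)], of e1] e1 by simp
    have "0 \<le> ?\<tau>2" using s(3) by simp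
    then have "1 * ?\<tau>2 \<le> e1 * ?\<tau>2" using e1(1) by (intro mult_right_mono) auto
    then show "?\<tau>2 \<le> \<epsilon>" using * \<epsilon>(1) by linarith
  qed
  obtain M where M: "\<And>n S. n \<ge> M \<Longrightarrow> S \<in> \<T> n \<Longrightarrow> diameter S < h"
    using refinement_mesh[OF T h(3)] by blast
  \<comment> \<open>The constant \<open>C\<close> blows up as \<open>s\<close> shrinks, but
    \<open>s\<close> is already fixed, so a small \<open>\<delta> m\<close> compensates it.\<close>
  have "(\<lambda>m. \<delta> m * (C\<^sup>2 + \<epsilon>)) \<longlonglongrightarrow> 0 * (C\<^sup>2 + \<epsilon>)" using \<delta>(2) by (intro tendsto_intros)
  then have "\<forall>\<^sub>F m in sequentially. \<delta> m * (C\<^sup>2 + \<epsilon>) < \<epsilon> / 4" using \<epsilon>(1) by (intro order_tendstoD(2)) auto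
  then obtain M' where M': "\<And>m. m \<ge> M' \<Longrightarrow> \<delta> m * (C\<^sup>2 + \<epsilon>) < \<epsilon> / 4"
    unfolding eventually_sequentially by blast
  define m where "m = max M M'"
  have mesh_m: "diameter S \<le> h" if "S \<in> \<T> (Suc m)" for S
    by (rule less_imp_le, rule M[OF _ that]) (simp add: m_def)
  have \<delta>m: "\<delta> m * (C\<^sup>2 + ?\<tau>2) \<le> \<epsilon> / 4"
  proof -
    have "\<delta> m * (C\<^sup>2 + ?\<tau>2) \<le> \<delta> m * (C\<^sup>2 + \<epsilon>)" using \<tau>2(2) \<delta>(1)[of m] by (intro mult_left_mono) auto
    moreover have "\<delta> m * (C\<^sup>2 + \<epsilon>) < \<epsilon> / 4" by (rule M') (simp add: m_def)
    ultimately show ?thesis by linarith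
  qed

  define U' where "U' = {\<nu> \<in> Mplus. \<forall>\<phi>\<in>\<Phi>. \<bar>(\<integral>x. \<phi> x \<partial>\<nu>) - (\<integral>x. \<phi> x \<partial>\<mu>)\<bar> < r / 3}"
  have U': "U' \<in> neighbourhoods weak_star \<mu>"
  proof (rule neighbourhoods_openI)
    have "openin weak_star {\<nu> \<in> topspace weak_star. (\<integral>x. \<phi> x \<partial>\<nu>) \<in> ball (\<integral>x. \<phi> x \<partial>\<mu>) (r / 3)}" if "\<phi> \<in> \<Phi>" for \<phi>
      by (rule openin_continuous_map_preimage[OF continuous_map_weak_star_integral[OF \<Phi>_cont[OF that]]]) simp
    \<comment> \<open>Intersecting with the whole space also covers an empty \<Phi>.\<close>
    then have "openin weak_star (topspace weak_star \<inter>
        \<Inter>((\<lambda>\<phi>. {\<nu> \<in> topspace weak_star. (\<integral>x. \<phi> x \<partial>\<nu>) \<in> ball (\<integral>x. \<phi> x \<partial>\<mu>) (r / 3)}) ` \<Phi>))"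
      using \<Phi>(1) by (intro openin_Int_Inter) auto
    also have "topspace weak_star \<inter>
        \<Inter>((\<lambda>\<phi>. {\<nu> \<in> topspace weak_star. (\<integral>x. \<phi> x \<partial>\<nu>) \<in> ball (\<integral>x. \<phi> x \<partial>\<mu>) (r / 3)}) ` \<Phi>) = U'"
      unfolding U'_def topspace_weak_star by (auto simp: dist_real_def abs_minus_commute)
    finally show "openin weak_star U'" .
    show "\<mu> \<in> U'" using \<mu> \<Phi>(2) by (simp add: U'_def)
  qed
  \<comment> \<open>The neighbourhood formula for the envelope produces \<nu> near \<mu> with energy
    below \<open>e'\<close> at the chosen \<open>m\<close>.\<close>
  have "(INF y\<in>U'. energy_inf f \<T> \<delta> m y) \<le> energy_tilde f \<T> \<delta> m \<mu>"
    unfolding energy_tilde_def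
    using \<mu> U' by (subst lsc_envelope_eq_SUP_INF) (auto simp: topspace_weak_star intro: SUP_upper)
  also have "\<dots> \<le> energy_limit f \<T> \<delta> \<mu>" unfolding energy_limit_def by (rule SUP_upper) simp
  also note e'(1)
  finally obtain \<nu> where \<nu>: "\<nu> \<in> U'" "energy_inf f \<T> \<delta> m \<nu> < ereal e'" by (auto simp: INF_less_iff)
  then obtain n0 where n0: "energy f \<T> \<delta> n0 m \<nu> < ereal e'" unfolding energy_inf_def by (auto simp: INF_less_iff)
  note \<nu>D = energy_leD[OF less_imp_le[OF n0]]
  have \<nu>fin: "finite_measure \<nu>" using \<nu>(1) unfolding U'_def Mplus_def by blast
  have \<nu>sets: "sets \<nu> = sets lcube" by (rule M_discrete_sets[OF \<nu>D(1)])
  \<comment> \<open>The zero function is an admissible competitor and leaves only the mass.\<close>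
  have mass: "measure \<nu> cube \<le> e1"
    using \<nu>D(2)[OF W_discrete_zero] e1 by (simp add: grad_zero)
  have CM: "0 \<le> C * measure \<nu> cube" "C * measure \<nu> cube \<le> C * e1"
    using C_nonneg mass by (auto intro: mult_left_mono)
  \<comment> \<open>A second mesh size, for rounding the smoothed density, whose Lipschitz constant
    is at most \<open>C * e1\<close>; the added 1 avoids division by zero.\<close>
  define h' where "h' = \<epsilon> / (C * e1 + 1)"
  have Ce1: "0 \<le> C * e1" using C_nonneg e1 by simp
  have h': "0 < h'" unfolding h'_def using Ce1 \<epsilon>(1) by (simp add: add_nonneg_pos)
  have h'\<epsilon>: "C * measure \<nu> cube * h' \<le> \<epsilon>"
  proof -
    have "C * measure \<nu> cube * h' \<le> (C * e1 + 1) * h'" using CM h' by (intro mult_right_mono) auto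
    also have "\<dots> = \<epsilon>" using Ce1 by (simp add: h'_def)
    finally show ?thesis .
  qed
  \<comment> \<open>This level resolves the smoothed density; it has no relation to the level
    \<open>n0\<close> of \<nu>.\<close>
  obtain n where n: "\<And>S. S \<in> \<T> n \<Longrightarrow> diameter S < h'"
    using refinement_mesh[OF T h'] by blast
  obtain g where g: "g \<in> borel_measurable lcube"
    "\<And>z. z \<in> cube \<Longrightarrow> smoothed \<nu> z + \<epsilon> \<le> g z" "\<And>z. z \<in> cube \<Longrightarrow> g z \<le> smoothed \<nu> z + 3 * \<epsilon>"
    "density lcube (\<lambda>x. ennreal (g x)) \<in> M_discrete \<T> n"
    by (rule M_discrete_piecewise_constant_approximation[OF T smoothed_nonneg[OF \<nu>fin \<nu>sets]
          smoothed_lipschitz[OF \<nu>fin \<nu>sets] CM(1) less_imp_le[OF n] h'\<epsilon> \<epsilon>(1)]) blast+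
  define \<nu>' where "\<nu>' = density lcube (\<lambda>x. ennreal (g x))"
  have g_le: "g z \<le> C * measure \<nu> cube + 3 * \<epsilon>" if "z \<in> cube" for z
    using g(3)[OF that] smoothed_le[OF \<nu>fin \<nu>sets, of z] by linarith
  have g_nonneg: "0 \<le> g z" if "z \<in> cube" for z
    using g(2)[OF that] smoothed_nonneg[OF \<nu>fin \<nu>sets, of z] \<epsilon>(1) by linarith
  have \<nu>'M: "\<nu>' \<in> Mplus" unfolding \<nu>'_def by (rule density_cube_Mplus[OF g(1) g_le])
  have g_int: "integrable lcube g"
    by (rule integrable_bounded[OF lcube.finite_measure_axioms g(1), of "C * measure \<nu> cube + 3 * \<epsilon>"])
       (use g_le g_nonneg in \<open>simp add: space_lcube\<close>)
  have sm_int: "integrable lcube (smoothed \<nu>)"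
    by (rule integrable_bounded[OF lcube.finite_measure_axioms smoothed_measurable[OF \<nu>fin \<nu>sets], of "C * measure \<nu> cube"])
       (use smoothed_le[OF \<nu>fin \<nu>sets] smoothed_nonneg[OF \<nu>fin \<nu>sets] in simp)
  have close: "\<bar>(\<integral>x. \<phi> x \<partial>\<nu>') - (\<integral>x. \<phi> x * smoothed \<nu> x \<partial>lcube)\<bar> \<le> 3 * \<epsilon> * b"
    if \<phi>: "\<phi> \<in> borel_measurable lcube" "\<And>x. x \<in> cube \<Longrightarrow> \<bar>\<phi> x\<bar> \<le> b" for \<phi> b
  proof -
    have gi: "integrable lcube (\<lambda>x. \<phi> x * g x)" "integrable lcube (\<lambda>x. \<phi> x * smoothed \<nu> x)"
      using integrable_cube_mult[OF \<phi> g_int] integrable_cube_mult[OF \<phi> sm_int] by blast+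
    have eq: "(\<integral>x. \<phi> x \<partial>\<nu>') = (\<integral>x. \<phi> x * g x \<partial>lcube)"
      unfolding \<nu>'_def by (rule integral_density_cube[OF g(1) g_nonneg \<phi>(1)])
    have "(\<integral>x. \<phi> x \<partial>\<nu>') - (\<integral>x. \<phi> x * smoothed \<nu> x \<partial>lcube) = (\<integral>x. \<phi> x * g x - \<phi> x * smoothed \<nu> x \<partial>lcube)"
      unfolding eq using gi by simp
    also have "norm \<dots> \<le> (\<integral>x. norm (\<phi> x * g x - \<phi> x * smoothed \<nu> x) \<partial>lcube)"
      by (rule integral_norm_bound)
    also have "\<dots> \<le> (\<integral>x. 3 * \<epsilon> * b \<partial>(lcube :: (real ^ 'd) measure))"
    proof (intro integral_mono integrable_norm Bochner_Integration.integrable_diff gi lcube.integrable_const)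
      fix x :: "real ^ 'd" assume "x \<in> space lcube"
      then have x: "x \<in> cube" by (simp add: space_lcube)
      have "norm (\<phi> x * g x - \<phi> x * smoothed \<nu> x) = \<bar>\<phi> x\<bar> * \<bar>g x - smoothed \<nu> x\<bar>"
        by (simp add: right_diff_distrib[symmetric] abs_mult)
      also have "\<dots> \<le> b * (3 * \<epsilon>)"
        using \<phi>(2)[OF x] g(2,3)[OF x] \<epsilon>(1) by (intro mult_mono) auto
      finally show "norm (\<phi> x * g x - \<phi> x * smoothed \<nu> x) \<le> 3 * \<epsilon> * b" by (simp add: mult.commute)
    qed
    also have "\<dots> = 3 * \<epsilon> * b"
      unfolding lebesgue_integral_const by (simp add: space_lcube measure_lcube)
    finally show ?thesis by simp
  qed
  have mass': "measure \<nu>' cube \<le> measure \<nu> cube + 3 * \<epsilon>"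
  proof -
    have "\<bar>(\<integral>x. 1 \<partial>\<nu>') - (\<integral>x. 1 * smoothed \<nu> x \<partial>lcube)\<bar> \<le> 3 * \<epsilon> * 1" by (rule close) auto
    moreover have "(\<integral>x. 1 \<partial>\<nu>') = measure \<nu>' cube"
      unfolding lebesgue_integral_const by (simp add: \<nu>'_def space_lcube)
    ultimately show ?thesis using integral_smoothed_mass[OF \<nu>fin \<nu>sets] by simp
  qed
  have \<nu>'U: "\<nu>' \<in> U"
  proof (rule bspec[OF basis \<nu>'M, THEN mp], rule ballI)
    fix \<phi> assume \<phi>: "\<phi> \<in> \<Phi>"
    have \<phi>m: "\<phi> \<in> borel_measurable lcube"
      using \<Phi>_cont[OF \<phi>] closure_subset by (intro borel_measurable_continuous_cube) (rule continuous_on_subset)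
    have \<phi>A: "\<bar>\<phi> x\<bar> \<le> A" if "x \<in> cube" for x using A(2) \<phi> cube_subset_closure[OF that] by blast
    have "\<bar>(\<integral>x. \<phi> x \<partial>\<nu>') - (\<integral>x. \<phi> x * smoothed \<nu> x \<partial>lcube)\<bar> \<le> 3 * \<epsilon> * A"
      by (rule close[OF \<phi>m \<phi>A])
    moreover have "\<bar>(\<integral>z. \<phi> z * smoothed \<nu> z \<partial>lcube) - (\<integral>x. \<phi> x \<partial>\<nu>)\<bar> \<le> \<omega> * measure \<nu> cube"
      by (rule integral_smoothed_close[OF \<nu>fin \<nu>sets \<phi>m \<phi>A])
         (use s(2) \<phi> cube_subset_closure in blast)+
    moreover have "\<omega> * measure \<nu> cube \<le> r / 3"
      using mult_left_mono[OF mass, of \<omega>] \<omega> by simp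
    moreover have "\<bar>(\<integral>x. \<phi> x \<partial>\<nu>) - (\<integral>x. \<phi> x \<partial>\<mu>)\<bar> < r / 3"
      using \<nu>(1) \<phi> unfolding U'_def by blast
    ultimately show "\<bar>(\<integral>x. \<phi> x \<partial>\<nu>') - (\<integral>x. \<phi> x \<partial>\<mu>)\<bar> < r" using \<epsilon>A by linarith
  qed

  have F's: "F * (s * real CARD('d)) * 2 ^ CARD('d) + F * (2 * h * (C * h)) \<le> s * F'"
    using h(1) by (simp add: F'_def algebra_simps)
  \<comment> \<open>The constant \<open>c0\<close> disappears because \<open>f\<close> has zero
    integral, so the energy bound for \<nu> applies to shifted competitors too.\<close>
  have R: "2 * (\<integral>x. f1 x * (w x + c0) \<partial>lcube) - ((\<integral>x. (norm (grad w x))\<^sup>2 \<partial>\<nu>)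
      + \<delta> m * (\<integral>x. (norm (grad w x))\<^sup>2 \<partial>lcube)) \<le> e' - measure \<nu> cube"
    if w: "w \<in> W_discrete \<T> m" for w c0
  proof -
    obtain L G where w': "L-lipschitz_on cube w" "grad w \<in> borel_measurable lcube"
      by (rule W_discrete_regular[OF T w]) blast
    obtain b where b: "\<And>x. x \<in> cube \<Longrightarrow> \<bar>w x\<bar> \<le> b"
      using bounded_uniformly_continuous_image[OF lipschitz_on_uniformly_continuous[OF w'(1)] bounded_cube]
      unfolding bounded_iff by auto
    have wm: "w \<in> borel_measurable lcube" by (rule W_discrete_measurable[OF w])
    have "(\<integral>x. f1 x * (w x + c0) \<partial>lcube) = (\<integral>x. f1 x * w x + c0 * f1 x \<partial>lcube)"
      by (simp add: algebra_simps)
    also have "\<dots> = (\<integral>x. f1 x * w x \<partial>lcube) + c0 * (\<integral>x. f1 x \<partial>lcube)"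
      using integrable_cube_mult[OF wm b f1_integrable] f1_integrable by (simp add: mult.commute)
    finally have "(\<integral>x. f1 x * (w x + c0) \<partial>lcube) = (\<integral>x. f x * w x \<partial>lebesgue_on cube)"
      using f1(4)[OF wm] f1_0 by simp
    moreover have "(\<lambda>x. (norm (grad w x))\<^sup>2) \<in> borel_measurable lcube" using w'(2) by measurable
    note integral_lebesgue_on_cube[OF this]
    ultimately show ?thesis using \<nu>D(2)[OF w] by simp
  qed
  \<comment> \<open>No constant above involves \<open>j\<close>. The term with
    \<open>\<delta> j\<close> is dropped by its sign, as coercivity comes from the density of \<nu>'
    alone.\<close>
  have "energy f \<T> \<delta> n j \<nu>' \<le> ereal e" for j
  proof (rule energy_leI)
    show "\<nu>' \<in> M_discrete \<T> n" unfolding \<nu>'_def by (rule g(4))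
    fix u assume u: "u \<in> W_discrete \<T> j"
    obtain L G where u': "L-lipschitz_on cube u" "grad u \<in> borel_measurable lcube"
      "\<And>x. x \<in> cube \<Longrightarrow> norm (grad u x) \<le> G"
      "AE x in lcube. (u has_derivative (\<lambda>h. grad u x \<bullet> h)) (at x)"
      by (rule W_discrete_regular[OF T u]) blast
    interpret mollified k B s u L G using u' by unfold_locales
    have small1: "measure \<nu> cube * ?\<tau>2 \<le> \<epsilon> / 4"
    proof -
      have "measure \<nu> cube * ?\<tau>2 \<le> e1 * ?\<tau>2" using mass s(3) by (intro mult_right_mono) auto
      then show ?thesis using \<tau>2(1) by linarith
    qed
    have "2 * (\<integral>x. f1 x * u x \<partial>lcube) - (\<integral>x. (norm (grad u x))\<^sup>2 \<partial>\<nu>') \<le> (e' - measure \<nu> cube) + 2 * (s * F')\<^sup>2 / \<epsilon>"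
      unfolding \<nu>'_def
      by (rule fine_energy_estimate[OF T less_imp_le[OF \<kappa>(1)] \<kappa>(2) mesh_m less_imp_le[OF h(3)] \<nu>fin \<nu>D(1)
            f1(1,3) g(1,2) g_le \<epsilon>(1) F's small1 \<delta>m less_imp_le[OF \<delta>(1)] R])
    moreover have "0 \<le> \<delta> j * (\<integral>x. (norm (grad u x))\<^sup>2 \<partial>lebesgue_on cube)"
      using \<delta>(1)[of j] by simp
    moreover have "(\<integral>x. f x * u x \<partial>lebesgue_on cube) = (\<integral>x. f1 x * u x \<partial>lcube)"
      by (rule f1(4)[OF W_discrete_measurable[OF u]])
    ultimately show "2 * (\<integral>x. f x * u x \<partial>lebesgue_on cube) - ((\<integral>x. (norm (grad u x))\<^sup>2 \<partial>\<nu>')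
      + \<delta> j * (\<integral>x. (norm (grad u x))\<^sup>2 \<partial>lebesgue_on cube)) + measure \<nu>' cube \<le> e"
      using s(1) mass' \<epsilon>(2) unfolding \<gamma>_def by simp
  qed
  then show ?thesis using \<nu>'U by blast
qed

theorem proposition2p8:
  fixes f :: "real ^ 'd \<Rightarrow> real"
    and \<T> :: "nat \<Rightarrow> (real ^ 'd) set set"
    and \<delta> :: "nat \<Rightarrow> real"
  assumes "f \<in> L_infinity cube"
    and "(\<integral>x. f x \<partial>lebesgue_on cube) = 0"
    and "compactly_contained (convex hull (ess_support cube f)) cube"
    and "successive_uniform_refinements \<T>"
    and "decseq \<delta>" and "\<forall>m. 0 < \<delta> m" and "\<delta> \<longlonglongrightarrow> 0"
  shows "is_Gamma_lim weak_star (\<lambda>m. energy_tilde f \<T> \<delta> m) (energy_limit f \<T> \<delta>)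
    \<and> is_Gamma_lim weak_star (\<lambda>n. energy_diag f \<T> \<delta> n) (energy_limit f \<T> \<delta>)
    \<and> (\<exists>G. (\<forall>m. is_Gamma_lim weak_star (\<lambda>n. energy f \<T> \<delta> n m) (G m))
           \<and> is_Gamma_lim weak_star G (energy_limit f \<T> \<delta>))
    \<and> (\<exists>H. (\<forall>n. is_Gamma_lim weak_star (\<lambda>m. energy f \<T> \<delta> n m) (H n))
           \<and> is_Gamma_lim weak_star H (energy_limit f \<T> \<delta>))"
proof -
  let ?X = "weak_star :: (real ^ 'd) measure topology"
  let ?E = "energy f \<T> \<delta>" and ?Et = "energy_tilde f \<T> \<delta>" and ?El = "energy_limit f \<T> \<delta>"
  note T = assms(4)
  note dec = energy_antimono_left[OF T, of _ _ f \<delta>]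
  note inc = energy_mono_right[OF T assms(5), of _ _ f]
  have Et_lsc: "lower_semicontinuous ?X (?Et m)" for m
    unfolding energy_tilde_def by (rule lsc_envelope_lsc)
  have inf_mono: "energy_inf f \<T> \<delta> m \<mu> \<le> energy_inf f \<T> \<delta> m' \<mu>" if "m \<le> m'" for m m' \<mu>
    unfolding energy_inf_def using inc[OF that] by (intro INF_mono) blast
  have Et_mono: "?Et m \<mu> \<le> ?Et m' \<mu>" if "\<mu> \<in> topspace ?X" "m \<le> m'" for m m' \<mu>
    unfolding energy_tilde_def by (rule lsc_envelope_mono[OF inf_mono[OF that(2)] that(1)])
  have El_lsc: "lower_semicontinuous ?X ?El"
    using lower_semicontinuous_SUP[of UNIV ?X ?Et, OF Et_lsc] by (simp add: energy_limit_def[abs_def])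
  \<comment> \<open>Each \<open>?Et m\<close> is already lower semicontinuous, so the envelopes in
    the monotone limit change nothing.\<close>
  have limit: "is_Gamma_lim ?X ?Et ?El"
  proof (rule is_Gamma_lim_cong[OF _ is_Gamma_lim_incseq])
    show "(SUP m. lsc_envelope ?X (?Et m) x) = ?El x" if "x \<in> topspace ?X" for x
      using that by (simp add: energy_limit_def lsc_envelope_lsc_eq[OF Et_lsc])
  qed (rule Et_mono)
  have recover: "\<exists>n. \<exists>\<nu>\<in>U. \<forall>k. ?E n k \<nu> \<le> ereal e"
    if "openin ?X U" "\<mu> \<in> U" "?El \<mu> < ereal e" for U \<mu> e
    using assms by (intro energy_limit_recovery[OF _ _ T _ _ that]) auto
  \<comment> \<open>Supplies the inner limit \<open>G\<close> of the first iterated limit; the outer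
    one is \<open>limit\<close>.\<close>
  have n_limit: "is_Gamma_lim ?X (\<lambda>n. ?E n m) (?Et m)" for m
    unfolding energy_tilde_def energy_inf_def[abs_def] using dec by (intro is_Gamma_lim_decseq) blast

  have diag_le: "Gamma_limsup ?X (energy_diag f \<T> \<delta>) \<mu> \<le> ?El \<mu>" for \<mu>
  proof (rule dense_ge)
    fix z assume z: "?El \<mu> < z"
    show "Gamma_limsup ?X (energy_diag f \<T> \<delta>) \<mu> \<le> z"
    \<comment> \<open>Only real \<open>z\<close> requires work: infinity is trivial and minus
      infinity is excluded by \<open>z\<close>.\<close>
    proof (cases z)
      case (real e)
      show ?thesis
        unfolding Gamma_limsup_def
      proof (rule SUP_least)
        fix U assume "U \<in> neighbourhoods ?X \<mu>"
        then obtain V where V: "openin ?X V" "\<mu> \<in> V" "V \<subseteq> U" unfolding neighbourhoods_def by blast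
        obtain n \<nu> where \<nu>: "\<nu> \<in> V" "\<And>k. ?E n k \<nu> \<le> ereal e"
          using recover[OF V(1,2)] z real by blast
        \<comment> \<open>On the diagonal the second index grows with \<open>n'\<close>, so the
          bound at the fixed level \<open>n\<close> must hold for every \<open>k\<close>; it is used
          at \<open>k = n'\<close>.\<close>
        have "(INF y\<in>U. energy_diag f \<T> \<delta> n' y) \<le> z" if "n' \<ge> n" for n'
        proof -
          have "(INF y\<in>U. energy_diag f \<T> \<delta> n' y) \<le> energy_diag f \<T> \<delta> n' \<nu>"
            using \<nu>(1) V(3) by (intro INF_lower) blast
          also have "\<dots> \<le> ?E n n' \<nu>" unfolding energy_diag_def by (rule dec[OF that])
          also have "\<dots> \<le> z" using \<nu>(2) real by simp
          finally show ?thesis .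
        qed
        then show "limsup (\<lambda>n. INF y\<in>U. energy_diag f \<T> \<delta> n y) \<le> z"
          by (intro Limsup_bounded) (auto simp: eventually_sequentially)
      qed
    qed (use z in auto)
  qed
  have diag_ge: "?El \<mu> \<le> Gamma_liminf ?X (energy_diag f \<T> \<delta>) \<mu>" if \<mu>: "\<mu> \<in> topspace ?X" for \<mu>
    unfolding energy_limit_def
  proof (rule SUP_least)
    fix m
    show "?Et m \<mu> \<le> Gamma_liminf ?X (energy_diag f \<T> \<delta>) \<mu>"
      unfolding energy_tilde_def lsc_envelope_eq_SUP_INF[OF \<mu>] Gamma_liminf_def
    proof (rule SUP_mono, intro bexI)
      fix U assume "U \<in> neighbourhoods ?X \<mu>"
      \<comment> \<open>For \<open>n \<ge> m\<close> the diagonal lies above the energy with second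
        index \<open>m\<close>, hence above its infimum over levels.\<close>
      have "(INF y\<in>U. energy_inf f \<T> \<delta> m y) \<le> (INF y\<in>U. energy_diag f \<T> \<delta> n y)" if "n \<ge> m" for n
      proof (rule INF_mono)
        fix y assume "y \<in> U"
        have "energy_inf f \<T> \<delta> m y \<le> ?E n m y" unfolding energy_inf_def by (rule INF_lower) simp
        also have "\<dots> \<le> energy_diag f \<T> \<delta> n y" unfolding energy_diag_def by (rule inc[OF that])
        finally show "\<exists>z\<in>U. energy_inf f \<T> \<delta> m z \<le> energy_diag f \<T> \<delta> n y" using \<open>y \<in> U\<close> by blast
      qed
      then show "(INF y\<in>U. energy_inf f \<T> \<delta> m y) \<le> liminf (\<lambda>n. INF y\<in>U. energy_diag f \<T> \<delta> n y)"
        by (intro Liminf_bounded) (auto simp: eventually_sequentially)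
    qed
  qed

  \<comment> \<open>The inner limit of the second iterated limit: in \<open>m\<close> the energies
    increase at fixed \<open>n\<close>.\<close>
  define H where "H n \<mu> = (SUP m. lsc_envelope ?X (?E n m) \<mu>)" for n \<mu>
  have m_limit: "is_Gamma_lim ?X (\<lambda>m. ?E n m) (H n)" for n
    unfolding H_def[abs_def] using inc by (intro is_Gamma_lim_incseq) blast
  have H_lim: "is_Gamma_lim ?X H ?El"
  proof (rule is_Gamma_lim_cong[OF _ is_Gamma_lim_decseq])
    show "H n' x \<le> H n x" if "x \<in> topspace ?X" "n \<le> n'" for n n' x
      unfolding H_def using dec[OF that(2)] that(1) by (intro SUP_mono bexI lsc_envelope_mono) auto
    fix \<mu> assume \<mu>: "\<mu> \<in> topspace ?X"
    show "lsc_envelope ?X (\<lambda>x. INF n. H n x) \<mu> = ?El \<mu>"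
    proof (rule antisym)
      show "?El \<mu> \<le> lsc_envelope ?X (\<lambda>x. INF n. H n x) \<mu>"
      proof (rule lsc_envelope_greatest[OF El_lsc])
        fix x assume x: "x \<in> topspace ?X"
        have "?Et m x \<le> lsc_envelope ?X (?E n m) x" for n m
          unfolding energy_tilde_def energy_inf_def[abs_def]
          by (rule lsc_envelope_mono[OF INF_lower x]) simp
        then show "?El x \<le> (INF n. H n x)"
          unfolding energy_limit_def H_def by (intro INF_greatest SUP_mono) blast
      qed
      show "lsc_envelope ?X (\<lambda>x. INF n. H n x) \<mu> \<le> ?El \<mu>"
      proof (rule dense_ge)
        fix z assume z: "?El \<mu> < z"
        show "lsc_envelope ?X (\<lambda>x. INF n. H n x) \<mu> \<le> z"
        proof (cases z)
          case (real e)
          show ?thesis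
            unfolding lsc_envelope_eq_SUP_INF[OF \<mu>]
          proof (rule SUP_least)
            fix U assume "U \<in> neighbourhoods ?X \<mu>"
            then obtain V where V: "openin ?X V" "\<mu> \<in> V" "V \<subseteq> U" unfolding neighbourhoods_def by blast
            obtain n \<nu> where \<nu>: "\<nu> \<in> V" "\<And>k. ?E n k \<nu> \<le> ereal e"
              using recover[OF V(1,2)] z real by blast
            have \<nu>X: "\<nu> \<in> topspace ?X" using V(1) \<nu>(1) openin_subset by blast
            \<comment> \<open>A supremum over all \<open>k\<close> at one fixed level
              \<open>n\<close>, again bounded because the recovery measure serves every
              \<open>k\<close>.\<close>
            have "H n \<nu> \<le> z"
              unfolding H_def real
            proof (rule SUP_least)
              fix k
              have "lsc_envelope ?X (?E n k) \<nu> \<le> ?E n k \<nu>" by (rule lsc_envelope_le[OF \<nu>X])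
              also note \<nu>(2)[of k]
              finally show "lsc_envelope ?X (?E n k) \<nu> \<le> ereal e" .
            qed
            then have "(INF n. H n \<nu>) \<le> z" by (rule order_trans[OF INF_lower, rotated]) simp
            then show "(INF y\<in>U. INF n. H n y) \<le> z"
              using INF_lower[of \<nu> U "\<lambda>y. INF n. H n y"] \<nu>(1) V(3) by (meson order_trans subsetD)
          qed
        qed (use z in auto)
      qed
    qed
  qed
  have "is_Gamma_lim ?X (\<lambda>n. energy_diag f \<T> \<delta> n) ?El"
    unfolding is_Gamma_lim_def using diag_le diag_ge by blast
  then show ?thesis using limit n_limit m_limit H_lim by blast
qed

end
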